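(* Suppose that $M$ is RDD, we can sample from $|t|/\|t\|_1$ in $O(1)$ time, $\|t\|_1$, $\mathrm{nnz}(M)$ and $f_{\mathrm{row}}(M)$ are known, and $b=e_w$ for a given $w\in[n]$. Then there exists a randomized algorithm that computes $\hat x$ with $\Pr\{|\hat x-t^{\top}x^{\ast}|\le\varepsilon\|D_M^{-1}b\|_\infty\}\ge\frac34$ with average time complexity $$O\big(f_{\mathrm{row}}(M)^{1/3}(\mathrm{nnz}(M)/n)^{2/3}\|t\|_1^{2/3}L^{7/3}\varepsilon^{-2/3}\big),$$ where the average is over all choices of $w\in[n]$.
   Context: Setting: $M\in\mathbb{R}^{n\times n}$, $b\in\operatorname{range}(M)$, $t\in\mathbb{R}^n$, $t\ne0$, nonzero entries of absolute value in $[1/\mathrm{poly}(n),\mathrm{poly}(n)]$. RDD: positive diagonal and $M(j,j)\ge\sum_{k\ne j}|M(j,k)|$. Write $M=D_M-A_M^{\top}$ ($D_M$ diagonal part, $A_M^{\top}$ zero diagonal); $x^{\ast}:=\frac12\sum_{\ell\ge0}(\frac12(I+D_M^{-1}A_M^{\top}))^{\ell}D_M^{-1}b$. $\mathrm{nnz}(M)$ = number of nonzero entries. Access: diagonal of $M$ in $O(1)$; nonzero entries of rows/columns of $M$ in time linear in their number; entries of $b,t$ in $O(1)$. The algorithm is given $\varepsilon>0$, $0<\gamma\le\gamma_{\max}(M)$ with $\gamma_{\max}(M)=\max_{p\in[1,\infty]}\big(1-\|\frac12(I+D_M^{-1/q}A_M^{\top}D_M^{-1/p})|_{\operatorname{range}(I-D_M^{-1/q}A_M^{\top}D_M^{-1/p})}\|_p\big)$,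 $q$ conjugate to $p$; $L=\Theta\big(\frac1\gamma\log(\frac{1}{\gamma E}d_{\max}(M)\|t\|_0\|D_M^{-1}t\|_\infty\|b\|_0\|D_M^{-1}b\|_\infty)\big)$, $E$ the target accuracy, with suitable bounds on quantities in the log known. $f_{\mathrm{row}}(M)$: maximum time to simulate one step of the (possibly terminating) random walk with transition matrix $\frac12(I+D_M^{-1}|A_M^{\top}|)$. *)

theory Defs
  imports "Jordan_Normal_Form.Matrix" "HOL-Probability.SPMF"
begin

unbundle no vec_syntax
hide_const (open) Finite_Cartesian_Product.vec Finite_Cartesian_Product.mat
  Finite_Cartesian_Product.row Determinants.det
hide_type (open) Finite_Cartesian_Product.vec

section \<open>Matrices, norms and the quantity to be estimated\<close>

definition RDD :: "real mat \<Rightarrow> bool" where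
  "RDD M \<longleftrightarrow> (\<forall>j<dim_row M. 0 < M $$ (j,j) \<and>
     (\<Sum>k\<in>{..<dim_col M} - {j}. \<bar>M $$ (j,k)\<bar>) \<le> M $$ (j,j))"

definition diag_powr :: "real mat \<Rightarrow> real \<Rightarrow> real mat" where
  "diag_powr M s = Matrix.mat (dim_row M) (dim_row M)
     (\<lambda>(i,j). if i = j then M $$ (i,i) powr s else 0)"

definition diag_part :: "real mat \<Rightarrow> real mat" where
  "diag_part M = Matrix.mat (dim_row M) (dim_row M) (\<lambda>(i,j). if i = j then M $$ (i,i) else 0)"

text \<open>The matrix \<open>A\<^sub>M\<^sup>T\<close> in the splitting \<open>M = D\<^sub>M - A\<^sub>M\<^sup>T\<close>.\<close>

definition AT :: "real mat \<Rightarrow> real mat" where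
  "AT M = diag_part M - M"

definition x_star :: "real mat \<Rightarrow> real Matrix.vec \<Rightarrow> real Matrix.vec" where
  "x_star M b = (let W = (1/2) \<cdot>\<^sub>m (1\<^sub>m (dim_row M) + diag_powr M (-1) * AT M) in
     Matrix.vec (dim_row M)
       (\<lambda>i. 1/2 * (\<Sum>l. ((W ^\<^sub>m l) *\<^sub>v (diag_powr M (-1) *\<^sub>v b)) $ i)))"

definition mat_range :: "real mat \<Rightarrow> real Matrix.vec set" where
  "mat_range B = {B *\<^sub>v x | x. x \<in> carrier_vec (dim_col B)}"

definition pnorm :: "ereal \<Rightarrow> real Matrix.vec \<Rightarrow> real" where
  "pnorm p v = (if p = \<infinity> then Max ((\<lambda>i. \<bar>v $ i\<bar>) ` {..<dim_vec v})
     else (\<Sum>i<dim_vec v. \<bar>v $ i\<bar> powr real_of_ereal p) powr (1 / real_of_ereal p))"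

definition op_pnorm_on :: "ereal \<Rightarrow> real mat \<Rightarrow> real Matrix.vec set \<Rightarrow> real" where
  "op_pnorm_on p B S = (SUP v\<in>{v \<in> S. pnorm p v \<le> 1}. pnorm p (B *\<^sub>v v))"

text \<open>\<open>D\<^sub>M\<close> to the \<open>-1/q\<close>, times \<open>A\<^sub>M\<^sup>T\<close>, times \<open>D\<^sub>M\<close> to the \<open>-1/p\<close>, where \<open>1/q = 1 - 1/p\<close>
  and \<open>1/\<infinity> = 0\<close>.\<close>

definition scaled_AT :: "real mat \<Rightarrow> ereal \<Rightarrow> real mat" where
  "scaled_AT M p = (let u = real_of_ereal (1 / p) in
     diag_powr M (- (1 - u)) * AT M * diag_powr M (- u))"

text \<open>The supremum over \<open>p\<close> is a maximum: the operand depends continuously on \<open>1/p\<close>, which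
  ranges over \<open>[0,1]\<close>.\<close>

definition gamma_max :: "real mat \<Rightarrow> real" where
  "gamma_max M = (SUP p\<in>{1..\<infinity>}. 1 - op_pnorm_on p
     ((1/2) \<cdot>\<^sub>m (1\<^sub>m (dim_row M) + scaled_AT M p))
     (mat_range (1\<^sub>m (dim_row M) - scaled_AT M p)))"

definition nnz :: "real mat \<Rightarrow> nat" where
  "nnz M = card {(i,j). i < dim_row M \<and> j < dim_col M \<and> M $$ (i,j) \<noteq> 0}"

definition norm0 :: "real Matrix.vec \<Rightarrow> nat" where
  "norm0 v = card {i. i < dim_vec v \<and> v $ i \<noteq> 0}"

definition d_max :: "real mat \<Rightarrow> real" where
  "d_max M = Max ((\<lambda>j. M $$ (j,j)) ` {..<dim_row M})"

text \<open>The scale of the truncation length \<open>L\<close> for target accuracy \<open>E\<close>.  The logarithm is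
  cut off at 1 from below, since its argument may be smaller than 1 when \<open>E\<close> is large.\<close>

definition L_scale ::
    "real mat \<Rightarrow> real Matrix.vec \<Rightarrow> real Matrix.vec \<Rightarrow> real \<Rightarrow> real \<Rightarrow> real" where
  "L_scale M t b \<gamma> E = 1 / \<gamma> * max 1 (ln (1 / (\<gamma> * E) * d_max M
      * real (norm0 t) * pnorm \<infinity> (diag_powr M (-1) *\<^sub>v t)
      * real (norm0 b) * pnorm \<infinity> (diag_powr M (-1) *\<^sub>v b)))"

definition poly_bounded :: "real poly \<Rightarrow> nat \<Rightarrow> real set \<Rightarrow> bool" where
  "poly_bounded Q n S \<longleftrightarrow>
     (\<forall>a\<in>S. a \<noteq> 0 \<longrightarrow> 1 / poly Q (real n) \<le> \<bar>a\<bar> \<and> \<bar>a\<bar> \<le> poly Q (real n))"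

section \<open>Access to the input\<close>

text \<open>An implementation of the access to \<open>M\<close>: the order in which the nonzero positions of
  each row and column are listed, and the time needed to simulate one step of the random walk
  from each vertex.\<close>

record access =
  row_list :: "nat \<Rightarrow> nat list"
  col_list :: "nat \<Rightarrow> nat list"
  step_time :: "nat \<Rightarrow> nat"

definition valid_access :: "real mat \<Rightarrow> access \<Rightarrow> bool" where
  "valid_access M acc \<longleftrightarrow>
     (\<forall>j<dim_row M. distinct (row_list acc j) \<and>
        set (row_list acc j) = {k. k < dim_col M \<and> M $$ (j,k) \<noteq> 0}) \<and>
     (\<forall>k<dim_col M. distinct (col_list acc k) \<and>
        set (col_list acc k) = {j. j < dim_row M \<and> M $$ (j,k) \<noteq> 0}) \<and>
     (\<forall>j<dim_row M. 1 \<le> step_time acc j)"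

definition f_row :: "real mat \<Rightarrow> access \<Rightarrow> nat" where
  "f_row M acc = Max (step_time acc ` {..<dim_row M})"

text \<open>One step from \<open>j\<close> of the random walk with (substochastic) transition matrix
  \<open>1/2 (I + D\<^sub>M\<^sup>-\<^sup>1 |A\<^sub>M\<^sup>T|)\<close>; the missing mass is the probability of termination.\<close>

definition walk_step :: "real mat \<Rightarrow> nat \<Rightarrow> nat spmf" where
  "walk_step M j = embed_spmf (\<lambda>k. if k < dim_row M
     then 1/2 * ((if k = j then 1 else 0) + \<bar>AT M $$ (j,k)\<bar> / M $$ (j,j)) else 0)"

definition sample_abs :: "real Matrix.vec \<Rightarrow> nat pmf" where
  "sample_abs t = embed_pmf (\<lambda>j. if j < dim_vec t then \<bar>t $ j\<bar> / pnorm 1 t else 0)"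

section \<open>A randomized real RAM\<close>

text \<open>Registers and two-dimensional arrays hold natural numbers or reals.  On
  natural numbers only addition and (truncated) subtraction are available, on reals the field
  operations; reals cannot be rounded to natural numbers.  Register and array names are fixed in the
  program text, so that an expression is evaluated in constant time.\<close>

datatype iexp = INat nat | IReg nat | IArr nat iexp iexp | IAdd iexp iexp | ISub iexp iexp

datatype rexp = ROfNat iexp | RReg nat | RArr nat iexp iexp
  | RAdd rexp rexp | RSub rexp rexp | RMul rexp rexp | RDiv rexp rexp

datatype bexp = ILess iexp iexp | RLess rexp rexp | BNot bexp | BAnd bexp bexp

datatype com =
    Skip
  | ISet nat iexp
  | RSet nat rexp
  | IStore nat iexp iexp iexp
  | RStore nat iexp iexp rexp
  | Seq com com
  | Cond bexp com com
  | While bexp com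
  | Uniform nat iexp \<comment> \<open>a uniformly random element of \<open>{0..m}\<close>\<close>
  | GetDiag nat iexp
  | GetB nat iexp
  | GetT nat iexp
  | LoadRow nat nat iexp
  | LoadCol nat nat iexp
  | SampleT nat
  | Step nat nat iexp

record state =
  ireg :: "nat \<Rightarrow> nat"
  rreg :: "nat \<Rightarrow> real"
  iarr :: "nat \<Rightarrow> nat \<Rightarrow> nat \<Rightarrow> nat"
  rarr :: "nat \<Rightarrow> nat \<Rightarrow> nat \<Rightarrow> real"
  clock :: nat

primrec ival :: "iexp \<Rightarrow> state \<Rightarrow> nat" where
  "ival (INat k) s = k"
| "ival (IReg x) s = ireg s x"
| "ival (IArr a i j) s = iarr s a (ival i s) (ival j s)"
| "ival (IAdd e f) s = ival e s + ival f s"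
| "ival (ISub e f) s = ival e s - ival f s"

primrec rval :: "rexp \<Rightarrow> state \<Rightarrow> real" where
  "rval (ROfNat e) s = real (ival e s)"
| "rval (RReg x) s = rreg s x"
| "rval (RArr a i j) s = rarr s a (ival i s) (ival j s)"
| "rval (RAdd e f) s = rval e s + rval f s"
| "rval (RSub e f) s = rval e s - rval f s"
| "rval (RMul e f) s = rval e s * rval f s"
| "rval (RDiv e f) s = rval e s / rval f s"

primrec bval :: "bexp \<Rightarrow> state \<Rightarrow> bool" where
  "bval (ILess e f) s = (ival e s < ival f s)"
| "bval (RLess e f) s = (rval e s < rval f s)"
| "bval (BNot b) s = (\<not> bval b s)"
| "bval (BAnd b c) s = (bval b s \<and> bval c s)"

definition spend :: "nat \<Rightarrow> state \<Rightarrow> state" where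
  "spend k s = s\<lparr>clock := clock s + k\<rparr>"

definition set_ireg :: "nat \<Rightarrow> nat \<Rightarrow> state \<Rightarrow> state" where
  "set_ireg x v s = s\<lparr>ireg := (ireg s)(x := v)\<rparr>"

definition set_rreg :: "nat \<Rightarrow> real \<Rightarrow> state \<Rightarrow> state" where
  "set_rreg x v s = s\<lparr>rreg := (rreg s)(x := v)\<rparr>"

definition set_iarr :: "nat \<Rightarrow> nat \<Rightarrow> nat \<Rightarrow> nat \<Rightarrow> state \<Rightarrow> state" where
  "set_iarr a i j v s = s\<lparr>iarr := (iarr s)(a := (iarr s a)(i := (iarr s a i)(j := v)))\<rparr>"

definition set_rarr :: "nat \<Rightarrow> nat \<Rightarrow> nat \<Rightarrow> real \<Rightarrow> state \<Rightarrow> state" where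
  "set_rarr a i j v s = s\<lparr>rarr := (rarr s)(a := (rarr s a)(i := (rarr s a i)(j := v)))\<rparr>"

text \<open>Copies a list of indices and the corresponding matrix entries to row 0 of the arrays
  named \<open>a\<close>, stores the length of the list in register \<open>x\<close>, and takes time linear in it.\<close>

definition load_list :: "nat \<Rightarrow> nat \<Rightarrow> nat list \<Rightarrow> (nat \<Rightarrow> real) \<Rightarrow> state \<Rightarrow> state" where
  "load_list x a ks val s = spend (1 + length ks) (set_ireg x (length ks)
     (fold (\<lambda>i s'. set_iarr a 0 i (ks ! i) (set_rarr a 0 i (val (ks ! i)) s'))
        [0..<length ks] s))"

partial_function (spmf) while_spmf ::
    "('s \<Rightarrow> bool) \<Rightarrow> ('s \<Rightarrow> 's spmf) \<Rightarrow> 's \<Rightarrow> 's spmf" where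
  "while_spmf g c s = (if g s then bind_spmf (c s) (while_spmf g c) else return_spmf s)"

text \<open>The missing mass of \<open>exec M b t acc P s\<close> is the probability that the run diverges.
  A step of the random walk reports the new vertex \<open>k\<close> together with the matrix entry \<open>M(j,k)\<close> at
  the position it used (needed for its sign); termination of the walk is reported as vertex \<open>n\<close>.\<close>

primrec exec ::
    "real mat \<Rightarrow> real Matrix.vec \<Rightarrow> real Matrix.vec \<Rightarrow> access \<Rightarrow> com \<Rightarrow> state \<Rightarrow> state spmf"
where
  "exec M b t acc Skip s = return_spmf s"
| "exec M b t acc (ISet x e) s = return_spmf (spend 1 (set_ireg x (ival e s) s))"
| "exec M b t acc (RSet x e) s = return_spmf (spend 1 (set_rreg x (rval e s) s))"
| "exec M b t acc (IStore a i j e) s =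
     return_spmf (spend 1 (set_iarr a (ival i s) (ival j s) (ival e s) s))"
| "exec M b t acc (RStore a i j e) s =
     return_spmf (spend 1 (set_rarr a (ival i s) (ival j s) (rval e s) s))"
| "exec M b t acc (Seq c d) s = bind_spmf (exec M b t acc c s) (exec M b t acc d)"
| "exec M b t acc (Cond g c d) s =
     (if bval g s then exec M b t acc c (spend 1 s) else exec M b t acc d (spend 1 s))"
| "exec M b t acc (While g c) s =
     map_spmf (spend 1) (while_spmf (bval g) (\<lambda>s'. exec M b t acc c (spend 1 s')) s)"
| "exec M b t acc (Uniform x e) s =
     map_spmf (\<lambda>k. spend 1 (set_ireg x k s)) (spmf_of_set {..ival e s})"
| "exec M b t acc (GetDiag x e) s =
     return_spmf (spend 1 (set_rreg x (M $$ (ival e s, ival e s)) s))"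
| "exec M b t acc (GetB x e) s = return_spmf (spend 1 (set_rreg x (b $ ival e s) s))"
| "exec M b t acc (GetT x e) s = return_spmf (spend 1 (set_rreg x (t $ ival e s) s))"
| "exec M b t acc (LoadRow x a e) s = (let j = ival e s in
     return_spmf (load_list x a (row_list acc j) (\<lambda>k. M $$ (j,k)) s))"
| "exec M b t acc (LoadCol x a e) s = (let k = ival e s in
     return_spmf (load_list x a (col_list acc k) (\<lambda>j. M $$ (j,k)) s))"
| "exec M b t acc (SampleT x) s =
     map_spmf (\<lambda>j. spend 1 (set_ireg x j s)) (spmf_of_pmf (sample_abs t))"
| "exec M b t acc (Step x y e) s = (let j = ival e s in
     map_spmf (\<lambda>r. spend (step_time acc j) (case r of
         None \<Rightarrow> set_ireg x (dim_row M) (set_rreg y 0 s)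
       | Some k \<Rightarrow> set_ireg x k (set_rreg y (M $$ (j,k)) s)))
     (spmf_of_pmf (walk_step M j)))"

text \<open>The known quantities are \<open>n\<close>, \<open>w\<close>, \<open>L\<close>, \<open>nnz(M)\<close>, \<open>f\<^sub>r\<^sub>o\<^sub>w(M)\<close> (natural) and
  \<open>\<epsilon>\<close>, \<open>\<gamma>\<close>, the 1-norm of \<open>t\<close> (real); the estimate is left in real register 0.\<close>

definition initial ::
    "real mat \<Rightarrow> real Matrix.vec \<Rightarrow> access \<Rightarrow> nat \<Rightarrow> nat \<Rightarrow> real \<Rightarrow> real \<Rightarrow> state" where
  "initial M t acc w L \<epsilon> \<gamma> =
     \<lparr>ireg = (\<lambda>_. 0)(0 := dim_row M, 1 := w, 2 := L, 3 := nnz M, 4 := f_row M acc),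
      rreg = (\<lambda>_. 0)(0 := \<epsilon>, 1 := \<gamma>, 2 := pnorm 1 t),
      iarr = (\<lambda>_ _ _. 0), rarr = (\<lambda>_ _ _. 0), clock = 0\<rparr>"

definition result :: "state \<Rightarrow> real" where
  "result s = rreg s 0"

text \<open>All runs halt within time \<open>T\<close>: an infinite run would have a finite prefix of positive
  probability that takes longer than \<open>T\<close>.\<close>

definition halts_within :: "state spmf \<Rightarrow> nat \<Rightarrow> bool" where
  "halts_within p T \<longleftrightarrow> lossless_spmf p \<and> (\<forall>s\<in>set_spmf p. clock s \<le> T)"

end

theory Submission
  imports Defs
begin

text \<open>
  Let \<open>W = 1/2 (I + D\<^sup>-\<^sup>1 A\<^sup>T)\<close>, a matrix whose rows have absolute sum at most 1.  By the definition of
  \<open>gamma_max\<close> the series for \<open>x\<^sup>*\<close> may be truncated after \<open>L\<close> terms, so it suffices to estimate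
  \<open>t\<^sup>T (\<Sum>l<L. W\<^sup>l v)\<close> for \<open>v = D\<^sup>-\<^sup>1 e\<^sub>w\<close>.  Keep a residual vector \<open>u\<^sub>l\<close> for each level \<open>l\<close>, initially
  \<open>u\<^sub>0 = v\<close>.  Pushing an entry of \<open>u\<^sub>l\<close> adds its contribution to an exact partial result and moves it
  through \<open>W\<close> into \<open>u\<^sub>l\<^sub>+\<^sub>1\<close>.  Entries are pushed while they exceed \<open>\<theta> = 1 / (h d)\<close>, where \<open>d = M(w,w)\<close>.  A
  push at \<open>(l,k)\<close> consumes more than \<open>1/h\<close> of the weight \<open>(|W|\<^sup>l)(k,w)\<close>, and these weights sum to at most 1
  over \<open>w\<close>, so on average over \<open>w\<close> the pushes cost at most \<open>L (h - 1) nnz(M) / n\<close>.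

  What is left is \<open>t\<^sup>T (\<Sum>j + l < L. W\<^sup>j u\<^sub>l)\<close>.  It is the mean of \<open>\<parallel>t\<parallel>\<^sub>1 L\<^sup>2 \<sigma> u\<^sub>l(X\<^sub>j)\<close>, or 0 if \<open>j + l \<ge> L\<close>,
  over independent uniform \<open>j, l < L\<close> and a random walk \<open>X\<close> with sign \<open>\<sigma>\<close> started from \<open>|t| / \<parallel>t\<parallel>\<^sub>1\<close>.
  Since \<open>|u\<^sub>l| \<le> \<theta>\<close>, Chebyshev's inequality asks for \<open>4 (\<parallel>t\<parallel>\<^sub>1 L\<^sup>2 / (h \<epsilon>))\<^sup>2\<close> walks; if
  \<open>\<parallel>t\<parallel>\<^sub>1 L\<^sup>2 \<le> h \<epsilon>\<close>, the remainder is negligible and no walk is made.  The two costs balance at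
  \<open>h\<^sup>3 = \<parallel>t\<parallel>\<^sub>1\<^sup>2 L\<^sup>4 f\<^sub>r\<^sub>o\<^sub>w n / (nnz(M) \<epsilon>\<^sup>2)\<close>.
\<close>

section \<open>Expectation bounds for terminating programs\<close>

text \<open>Taking \<open>f\<close> to be the indicator of failure, \<open>v\<close> bounds the failure probability.\<close>

definition ensures :: "'a spmf \<Rightarrow> ('a \<Rightarrow> bool) \<Rightarrow> ('a \<Rightarrow> real) \<Rightarrow> real \<Rightarrow> bool" where
  "ensures p Q f v \<longleftrightarrow> (\<exists>p'. p = spmf_of_pmf p' \<and> finite (set_pmf p') \<and>
     (\<forall>s\<in>set_pmf p'. Q s) \<and> measure_pmf.expectation p' f \<le> v)"

abbreviation surely :: "'a spmf \<Rightarrow> ('a \<Rightarrow> bool) \<Rightarrow> bool" where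
  "surely p Q \<equiv> ensures p Q (\<lambda>_. 0) 0"

lemma ensuresE:
  assumes "ensures p Q f v"
  obtains p' where "p = spmf_of_pmf p'" "finite (set_pmf p')" "\<And>s. s \<in> set_pmf p' \<Longrightarrow> Q s"
    "measure_pmf.expectation p' f \<le> v"
  using assms unfolding ensures_def by blast

lemma ensures_return [simp]: "ensures (return_spmf s) Q f v \<longleftrightarrow> Q s \<and> f s \<le> v"
proof
  assume "ensures (return_spmf s) Q f v"
  then obtain p' where p': "spmf_of_pmf (return_pmf s) = spmf_of_pmf p'" "\<And>s. s \<in> set_pmf p' \<Longrightarrow> Q s"
      "measure_pmf.expectation p' f \<le> v"
    by (elim ensuresE) simp
  have "p' = return_pmf s"
    by (rule pmf_eqI) (metis p'(1) spmf_spmf_of_pmf)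
  then show "Q s \<and> f s \<le> v"
    using p' by simp
next
  assume "Q s \<and> f s \<le> v"
  then show "ensures (return_spmf s) Q f v"
    unfolding ensures_def by (intro exI[of _ "return_pmf s"]) auto
qed

lemma ensures_map_pmf:
  assumes "finite A" "set_pmf p \<subseteq> A" "\<And>a. a \<in> A \<Longrightarrow> Q (h a)"
  shows "ensures (map_spmf h (spmf_of_pmf p)) Q f (\<Sum>a\<in>A. pmf p a * f (h a))"
  unfolding ensures_def
proof (intro exI conjI)
  show "map_spmf h (spmf_of_pmf p) = spmf_of_pmf (map_pmf h p)"
    by simp
  show "finite (set_pmf (map_pmf h p))"
    using finite_subset[OF assms(2,1)] by simp
  show "\<forall>s\<in>set_pmf (map_pmf h p). Q s"
    using assms by auto
  have "measure_pmf.expectation p (\<lambda>a. f (h a)) = (\<Sum>a\<in>A. f (h a) * pmf p a)"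
    by (rule integral_measure_pmf_real[OF assms(1)]) (use assms(2) in auto)
  then show "measure_pmf.expectation (map_pmf h p) f \<le> (\<Sum>a\<in>A. pmf p a * f (h a))"
    by (simp add: mult.commute)
qed

lemma ensures_bind:
  assumes p: "ensures p R g v" and q: "\<And>s. R s \<Longrightarrow> ensures (q s) Q f (g s)"
  shows "ensures (bind_spmf p q) Q f v"
proof -
  obtain p' where p': "p = spmf_of_pmf p'" "finite (set_pmf p')" "\<And>s. s \<in> set_pmf p' \<Longrightarrow> R s"
      "measure_pmf.expectation p' g \<le> v"
    using p by (rule ensuresE) blast
  obtain q' where q': "\<And>s. R s \<Longrightarrow> q s = spmf_of_pmf (q' s) \<and> finite (set_pmf (q' s)) \<and>
     (\<forall>s\<in>set_pmf (q' s). Q s) \<and> measure_pmf.expectation (q' s) f \<le> g s"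
    using q unfolding ensures_def by metis
  have "bind_spmf p q = bind_pmf p' (\<lambda>s. spmf_of_pmf (q' s))"
    unfolding p'(1) bind_spmf_of_pmf by (rule bind_pmf_cong) (use p' q' in auto)
  then have bind: "bind_spmf p q = spmf_of_pmf (bind_pmf p' q')"
    by (simp add: spmf_of_pmf_bind)
  have "measure_pmf.expectation (bind_pmf p' q') f
      = (\<Sum>a\<in>set_pmf p'. pmf p' a *\<^sub>R measure_pmf.expectation (q' a) f)"
    by (rule pmf_expectation_bind) (use p' q' in auto)
  also have "\<dots> \<le> (\<Sum>a\<in>set_pmf p'. g a * pmf p' a)"
    by (rule sum_mono) (use p' q' in \<open>simp add: mult.commute[of _ "pmf p' _"] mult_left_mono\<close>)
  also have "\<dots> = measure_pmf.expectation p' g"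
    by (rule integral_measure_pmf_real[symmetric]) (use p' in auto)
  also note p'(4)
  finally show ?thesis
    unfolding ensures_def bind using p' q' by (intro exI[of _ "bind_pmf p' q'"]) auto
qed

lemma ensures_affine:
  assumes p: "ensures p Q f v" and "\<And>s. Q s \<Longrightarrow> Q' s" "\<And>s. Q s \<Longrightarrow> f' s \<le> a * f s + b"
    "0 \<le> a" "a * v + b \<le> v'"
  shows "ensures p Q' f' v'"
proof -
  obtain p' where p': "p = spmf_of_pmf p'" "finite (set_pmf p')" "\<And>s. s \<in> set_pmf p' \<Longrightarrow> Q s"
      "measure_pmf.expectation p' f \<le> v"
    using p by (rule ensuresE) blast
  have "measure_pmf.expectation p' f' \<le> measure_pmf.expectation p' (\<lambda>s. a * f s + b)"
    by (rule integral_mono_AE)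
      (use p' assms in \<open>auto intro: integrable_measure_pmf_finite AE_pmfI\<close>)
  also have "\<dots> = a * measure_pmf.expectation p' f + b"
    using p' by (subst Bochner_Integration.integral_add)
      (auto intro: integrable_measure_pmf_finite)
  also have "\<dots> \<le> a * v + b"
    using p' assms by (simp add: mult_left_mono)
  finally show ?thesis
    unfolding ensures_def using p' assms by (intro exI[of _ p']) auto
qed

lemma ensures_mono:
  assumes "ensures p Q f v" "\<And>s. Q s \<Longrightarrow> Q' s" "\<And>s. Q s \<Longrightarrow> f' s \<le> f s" "v \<le> v'"
  shows "ensures p Q' f' v'"
  by (rule ensures_affine[where a = 1 and b = 0, OF assms(1)]) (use assms in auto)

lemma ensures_if_surely:
  assumes "surely p R" "\<And>s. R s \<Longrightarrow> Q s" "\<And>s. R s \<Longrightarrow> f s \<le> v"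
  shows "ensures p Q f v"
  by (rule ensures_affine[where a = 0 and b = v, OF assms(1)]) (use assms in auto)

lemma ensures_map:
  assumes "ensures p (\<lambda>s. Q (h s)) (\<lambda>s. f (h s)) v"
  shows "ensures (map_spmf h p) Q f v"
  unfolding map_spmf_conv_bind_spmf
  by (rule ensures_bind[OF assms]) auto

lemma ensures_while:
  fixes m :: "'a \<Rightarrow> nat"
  assumes body: "\<And>s. I s \<Longrightarrow> g s \<Longrightarrow> ensures (c s) (\<lambda>s'. I s' \<and> m s' < m s) f (f s)"
    and "I s"
  shows "ensures (while_spmf g c s) (\<lambda>s'. I s' \<and> \<not> g s') f (f s)"
  using \<open>I s\<close>
proof (induction "m s" arbitrary: s rule: less_induct)
  case less
  show ?case
  proof (cases "g s")
    case True
    have "ensures (bind_spmf (c s) (while_spmf g c)) (\<lambda>s'. I s' \<and> \<not> g s') f (f s)"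
      by (rule ensures_bind[OF body]) (use less True in auto)
    then show ?thesis
      using True by (simp add: while_spmf.simps[of g c s])
  next
    case False
    then show ?thesis
      using less by (simp add: while_spmf.simps[of g c s])
  qed
qed

lemma halts_within_if_ensures:
  assumes "ensures p (\<lambda>s. clock s \<le> T) f v"
  shows "halts_within p T"
  using assms unfolding ensures_def halts_within_def by auto

lemma measure_ge_if_ensures:
  assumes "ensures p Q (\<lambda>s. if s \<in> A then 0 else 1) v"
  shows "measure (measure_spmf p) A \<ge> 1 - v"
proof -
  obtain p' where p': "p = spmf_of_pmf p'"
      "measure_pmf.expectation p' (\<lambda>s. if s \<in> A then 0 else 1) \<le> v"
    using assms by (rule ensuresE)
  have "(\<lambda>s. if s \<in> A then 0 else 1 :: real) = indicator (- A)"
    by (auto simp: indicator_def)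
  then have "measure_pmf.prob p' (- A) \<le> v"
    using p'(2) by simp
  then show ?thesis
    using measure_pmf.prob_compl[of A p'] by (simp add: p'(1) Compl_eq_Diff_UNIV)
qed

subsection \<open>Proof rules for the random access machine\<close>

lemma ensures_Seq:
  assumes "ensures (exec M b t acc c s) R g v"
    "\<And>s. R s \<Longrightarrow> ensures (exec M b t acc d s) Q f (g s)"
  shows "ensures (exec M b t acc (Seq c d) s) Q f v"
  using ensures_bind[OF assms] by simp

lemma ensures_Seq_surely:
  assumes "surely (exec M b t acc c s) R"
    "\<And>s. R s \<Longrightarrow> ensures (exec M b t acc d s) Q f v"
  shows "ensures (exec M b t acc (Seq c d) s) Q f v"
  by (rule ensures_Seq[where g = "\<lambda>_. v", OF ensures_if_surely[OF assms(1)] assms(2)]) auto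

lemma ensures_While:
  assumes body: "\<And>s. I s \<Longrightarrow> bval g s \<Longrightarrow>
      ensures (exec M b t acc c (spend 1 s)) (\<lambda>s'. I s' \<and> clock s < clock s') f (f s)"
    and bound: "\<And>s. I s \<Longrightarrow> clock s \<le> T" and "I s"
    and post: "\<And>s'. I s' \<Longrightarrow> \<not> bval g s' \<Longrightarrow> Q (spend 1 s') \<and> f' (spend 1 s') \<le> f s'"
  shows "ensures (exec M b t acc (While g c) s) Q f' (f s)"
  unfolding exec.simps
proof (rule ensures_map, rule ensures_mono)
  show "ensures (while_spmf (bval g) (\<lambda>s'. exec M b t acc c (spend 1 s')) s)
      (\<lambda>s'. I s' \<and> \<not> bval g s') f (f s)"
  proof (rule ensures_while[where m = "\<lambda>s. T - clock s"])
    fix s assume "I s" "bval g s"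
    show "ensures (exec M b t acc c (spend 1 s)) (\<lambda>s'. I s' \<and> T - clock s' < T - clock s) f (f s)"
      by (rule ensures_mono[OF body[OF \<open>I s\<close> \<open>bval g s\<close>]])
        (use bound in \<open>fastforce intro: diff_less_mono2 less_le_trans\<close>)+
  qed fact
qed (use post in auto)

lemma surely_While:
  assumes "\<And>s. I s \<Longrightarrow> bval g s \<Longrightarrow>
      surely (exec M b t acc c (spend 1 s)) (\<lambda>s'. I s' \<and> clock s < clock s')"
    and "\<And>s. I s \<Longrightarrow> clock s \<le> T" "I s"
    and "\<And>s'. I s' \<Longrightarrow> \<not> bval g s' \<Longrightarrow> Q (spend 1 s')"
  shows "surely (exec M b t acc (While g c) s) Q"
  by (rule ensures_While[where f = "\<lambda>_. 0" and I = I and T = T]) (use assms in auto)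

lemma ensures_Uniform:
  "ensures (exec M b t acc (Uniform x e) s)
     (\<lambda>s'. \<exists>k\<le>ival e s. s' = spend 1 (set_ireg x k s)) f
     ((\<Sum>k\<le>ival e s. f (spend 1 (set_ireg x k s))) / real (Suc (ival e s)))"
proof -
  let ?p = "pmf_of_set {..ival e s}" and ?h = "\<lambda>k. spend 1 (set_ireg x k s)"
  have "ensures (map_spmf ?h (spmf_of_pmf ?p)) (\<lambda>s'. \<exists>k\<le>ival e s. s' = ?h k) f
      (\<Sum>k\<le>ival e s. pmf ?p k * f (?h k))"
    by (rule ensures_map_pmf) auto
  then show ?thesis
    by (simp add: sum_divide_distrib)
qed

lemma state_simps [simp]:
  "ireg (spend k s) = ireg s" "rreg (spend k s) = rreg s" "iarr (spend k s) = iarr s"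
  "rarr (spend k s) = rarr s" "clock (spend k s) = clock s + k"
  "ireg (set_ireg x v s) = (ireg s)(x := v)" "rreg (set_ireg x v s) = rreg s"
  "iarr (set_ireg x v s) = iarr s" "rarr (set_ireg x v s) = rarr s"
  "clock (set_ireg x v s) = clock s"
  "ireg (set_rreg x r s) = ireg s" "rreg (set_rreg x r s) = (rreg s)(x := r)"
  "iarr (set_rreg x r s) = iarr s" "rarr (set_rreg x r s) = rarr s"
  "clock (set_rreg x r s) = clock s"
  "ireg (set_iarr a i j v s) = ireg s" "rreg (set_iarr a i j v s) = rreg s"
  "iarr (set_iarr a i j v s) = (iarr s)(a := (iarr s a)(i := (iarr s a i)(j := v)))"
  "rarr (set_iarr a i j v s) = rarr s" "clock (set_iarr a i j v s) = clock s"
  "ireg (set_rarr a i j r s) = ireg s" "rreg (set_rarr a i j r s) = rreg s"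
  "rarr (set_rarr a i j r s) = (rarr s)(a := (rarr s a)(i := (rarr s a i)(j := r)))"
  "iarr (set_rarr a i j r s) = iarr s" "clock (set_rarr a i j r s) = clock s"
  by (simp_all add: spend_def set_ireg_def set_rreg_def set_iarr_def set_rarr_def)

lemma fold_store_list:
  fixes a :: nat and val :: "nat \<Rightarrow> real" and s :: state
  assumes "m \<le> length ks"
  defines "s' \<equiv> fold (\<lambda>i s'. set_iarr a 0 i (ks ! i) (set_rarr a 0 i (val (ks ! i)) s')) [0..<m] s"
  shows "ireg s' = ireg s \<and> rreg s' = rreg s \<and> clock s' = clock s \<and>
    (\<forall>a'. a' \<noteq> a \<longrightarrow> iarr s' a' = iarr s a' \<and> rarr s' a' = rarr s a') \<and>
    (\<forall>i<m. iarr s' a 0 i = ks ! i \<and> rarr s' a 0 i = val (ks ! i))"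
  using assms(1) unfolding s'_def by (induction m) (auto simp: less_Suc_eq)

lemma load_list_simps:
  "ireg (load_list x a ks val s) = (ireg s)(x := length ks)"
  "rreg (load_list x a ks val s) = rreg s"
  "clock (load_list x a ks val s) = clock s + 1 + length ks"
  "a' \<noteq> a \<Longrightarrow> iarr (load_list x a ks val s) a' = iarr s a'"
  "a' \<noteq> a \<Longrightarrow> rarr (load_list x a ks val s) a' = rarr s a'"
  "i < length ks \<Longrightarrow> iarr (load_list x a ks val s) a 0 i = ks ! i"
  "i < length ks \<Longrightarrow> rarr (load_list x a ks val s) a 0 i = val (ks ! i)"
  using fold_store_list[of "length ks" ks a val s] by (auto simp: load_list_def)

section \<open>Residuals and pushes\<close>

definition mat_app :: "nat \<Rightarrow> (nat \<Rightarrow> nat \<Rightarrow> real) \<Rightarrow> (nat \<Rightarrow> real) \<Rightarrow> nat \<Rightarrow> real" where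
  "mat_app n W f i = (\<Sum>k<n. W i k * f k)"

definition substochastic :: "nat \<Rightarrow> (nat \<Rightarrow> nat \<Rightarrow> real) \<Rightarrow> bool" where
  "substochastic n W \<longleftrightarrow> (\<forall>i<n. (\<Sum>k<n. \<bar>W i k\<bar>) \<le> 1)"

definition neumann_sum ::
    "nat \<Rightarrow> (nat \<Rightarrow> nat \<Rightarrow> real) \<Rightarrow> (nat \<Rightarrow> real) \<Rightarrow> nat \<Rightarrow> (nat \<Rightarrow> real) \<Rightarrow> real" where
  "neumann_sum n W t m f = (\<Sum>j<m. \<Sum>i<n. t i * (mat_app n W ^^ j) f i)"

definition residual_sum ::
    "nat \<Rightarrow> (nat \<Rightarrow> nat \<Rightarrow> real) \<Rightarrow> (nat \<Rightarrow> real) \<Rightarrow> nat \<Rightarrow> (nat \<Rightarrow> nat \<Rightarrow> real) \<Rightarrow> real" where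
  "residual_sum n W t L u = (\<Sum>l\<le>L. neumann_sum n W t (L - l) (u l))"

definition initial_residual :: "(nat \<Rightarrow> real) \<Rightarrow> nat \<Rightarrow> nat \<Rightarrow> real" where
  "initial_residual f = (\<lambda>_ _. 0)(0 := f)"

definition push ::
    "(nat \<Rightarrow> nat \<Rightarrow> real) \<Rightarrow> nat \<Rightarrow> nat \<Rightarrow> (nat \<Rightarrow> nat \<Rightarrow> real) \<Rightarrow> nat \<Rightarrow> nat \<Rightarrow> real" where
  "push W l k u = u(l := (u l)(k := 0), Suc l := (\<lambda>j. u (Suc l) j + u l k * W j k))"

definition add_at :: "nat \<Rightarrow> nat \<Rightarrow> 'a \<Rightarrow> (nat \<Rightarrow> nat \<Rightarrow> 'a) \<Rightarrow> nat \<Rightarrow> nat \<Rightarrow> 'a::plus" where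
  "add_at l k x f = f(l := (f l)(k := f l k + x))"

subsection \<open>Iterates of a substochastic matrix\<close>

lemma mat_app_cong: "(\<And>k. k < n \<Longrightarrow> f k = g k) \<Longrightarrow> mat_app n W f i = mat_app n W g i"
  by (simp add: mat_app_def)

lemma mat_app_pow_cong:
  assumes "\<And>i. i < n \<Longrightarrow> f i = g i" "i < n"
  shows "(mat_app n W ^^ j) f i = (mat_app n W ^^ j) g i"
  using \<open>i < n\<close> by (induction j arbitrary: i) (auto simp: assms intro: mat_app_cong)

lemma mat_app_linear:
  "mat_app n W (\<lambda>i. f i + c * g i) = (\<lambda>i. mat_app n W f i + c * mat_app n W g i)"
  by (auto simp: mat_app_def sum.distrib sum_distrib_left algebra_simps intro!: ext)

lemma mat_app_pow_linear:
  "(mat_app n W ^^ j) (\<lambda>i. f i + c * g i) = (\<lambda>i. (mat_app n W ^^ j) f i + c * (mat_app n W ^^ j) g i)"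
  by (induction j) (auto simp: mat_app_linear)

lemma abs_mat_app_le: "\<bar>mat_app n W f i\<bar> \<le> mat_app n (\<lambda>i k. \<bar>W i k\<bar>) (\<lambda>k. \<bar>f k\<bar>) i"
  by (simp add: mat_app_def order.trans[OF sum_abs] abs_mult)

lemma mat_app_mono:
  assumes "\<And>i k. 0 \<le> W i k" "\<And>k. k < n \<Longrightarrow> f k \<le> g k"
  shows "mat_app n W f i \<le> mat_app n W g i"
  unfolding mat_app_def by (intro sum_mono mult_left_mono) (use assms in auto)

lemma mat_app_pow_nonneg:
  assumes "\<And>i k. 0 \<le> W i k" "\<And>k. 0 \<le> f k"
  shows "0 \<le> (mat_app n W ^^ j) f i"
  by (induction j arbitrary: i) (auto simp: assms mat_app_def intro!: sum_nonneg)

lemma mat_app_abs_const_le: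
  assumes "substochastic n W" "0 \<le> c" "i < n"
  shows "mat_app n (\<lambda>i k. \<bar>W i k\<bar>) (\<lambda>_. c) i \<le> c"
proof -
  have "(\<Sum>k<n. \<bar>W i k\<bar>) * c \<le> 1 * c"
    using assms by (intro mult_right_mono) (auto simp: substochastic_def)
  then show ?thesis
    by (simp add: mat_app_def sum_distrib_right)
qed

lemma abs_mat_app_pow_le:
  assumes "substochastic n W" "\<And>i. i < n \<Longrightarrow> \<bar>f i\<bar> \<le> c" "0 \<le> c" "i < n"
  shows "\<bar>(mat_app n W ^^ j) f i\<bar> \<le> c"
  using \<open>i < n\<close>
proof (induction j arbitrary: i)
  case (Suc j)
  have "\<bar>(mat_app n W ^^ Suc j) f i\<bar> \<le> mat_app n (\<lambda>i k. \<bar>W i k\<bar>) (\<lambda>k. \<bar>(mat_app n W ^^ j) f k\<bar>) i"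
    using abs_mat_app_le by simp
  also have "\<dots> \<le> mat_app n (\<lambda>i k. \<bar>W i k\<bar>) (\<lambda>_. c) i"
    by (rule mat_app_mono) (use Suc.IH in auto)
  also have "\<dots> \<le> c"
    by (rule mat_app_abs_const_le[OF assms(1,3) Suc.prems])
  finally show ?case .
qed (use assms in auto)

lemma abs_weighted_mat_app_pow_le:
  assumes "substochastic n W" "\<And>i. i < n \<Longrightarrow> \<bar>f i\<bar> \<le> c" "0 \<le> c"
  shows "\<bar>\<Sum>i<n. t i * (mat_app n W ^^ j) f i\<bar> \<le> (\<Sum>i<n. \<bar>t i\<bar>) * c"
proof -
  have "\<bar>\<Sum>i<n. t i * (mat_app n W ^^ j) f i\<bar> \<le> (\<Sum>i<n. \<bar>t i * (mat_app n W ^^ j) f i\<bar>)"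
    by (rule sum_abs)
  also have "\<dots> \<le> (\<Sum>i<n. \<bar>t i\<bar> * c)"
    by (rule sum_mono) (use assms in \<open>auto simp: abs_mult intro!: mult_left_mono abs_mat_app_pow_le\<close>)
  finally show ?thesis by (simp add: sum_distrib_right)
qed

subsection \<open>The value of the residuals\<close>

lemma neumann_sum_linear:
  "neumann_sum n W t m (\<lambda>i. f i + c * g i) = neumann_sum n W t m f + c * neumann_sum n W t m g"
  by (simp add: neumann_sum_def mat_app_pow_linear sum.distrib sum_distrib_left algebra_simps)

lemma neumann_sum_zero: "neumann_sum n W t m (\<lambda>_. 0) = 0"
  using neumann_sum_linear[of n W t m "\<lambda>_. 0" "-1" "\<lambda>_. 0"] by simp

lemma neumann_sum_Suc:
  "neumann_sum n W t (Suc m) f = (\<Sum>i<n. t i * f i) + neumann_sum n W t m (mat_app n W f)"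
  by (simp add: neumann_sum_def sum.lessThan_Suc_shift funpow_swap1 del: sum.lessThan_Suc)

lemma abs_neumann_sum_le:
  assumes "substochastic n W" "\<And>i. i < n \<Longrightarrow> \<bar>f i\<bar> \<le> c" "0 \<le> c"
  shows "\<bar>neumann_sum n W t m f\<bar> \<le> real m * ((\<Sum>i<n. \<bar>t i\<bar>) * c)"
proof -
  have "\<bar>neumann_sum n W t m f\<bar> \<le> (\<Sum>j<m. \<bar>\<Sum>i<n. t i * (mat_app n W ^^ j) f i\<bar>)"
    unfolding neumann_sum_def by (rule sum_abs)
  also have "\<dots> \<le> (\<Sum>j<m. (\<Sum>i<n. \<bar>t i\<bar>) * c)"
    by (rule sum_mono) (rule abs_weighted_mat_app_pow_le[OF assms])
  finally show ?thesis by simp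
qed

lemma residual_sum_initial: "residual_sum n W t L (initial_residual f) = neumann_sum n W t L f"
proof -
  have "residual_sum n W t L (initial_residual f)
      = (\<Sum>l\<le>L. if l = 0 then neumann_sum n W t L f else 0)"
    unfolding residual_sum_def initial_residual_def
    by (rule sum.cong) (auto simp: neumann_sum_zero)
  then show ?thesis by simp
qed

lemma residual_sum_push:
  assumes "l < L" "k < n"
  shows "t k * u l k + residual_sum n W t L (push W l k u) = residual_sum n W t L u"
proof -
  let ?e = "(\<lambda>_. 0)(k := 1 :: real)" and ?u' = "push W l k u"
  let ?V = "\<lambda>v i. neumann_sum n W t (L - i) (v i)"
  have levels: "{..L} = insert l (insert (Suc l) ({..L} - {l, Suc l}))"
    using assms by auto
  have split: "residual_sum n W t L v = ?V v l + ?V v (Suc l) + (\<Sum>i\<in>{..L} - {l, Suc l}. ?V v i)" for v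
    unfolding residual_sum_def by (subst levels) (simp add: add.assoc)
  have other_levels: "(\<Sum>i\<in>{..L} - {l, Suc l}. ?V ?u' i) = (\<Sum>i\<in>{..L} - {l, Suc l}. ?V u i)"
    by (rule sum.cong) (auto simp: push_def)
  have W_e: "mat_app n W ?e = (\<lambda>j. W j k)" and t_e: "(\<Sum>i<n. t i * ?e i) = t k"
    using assms by (auto simp: mat_app_def if_distrib[of "\<lambda>x. _ * x"] cong: if_cong)
  have "?V u l = ?V ?u' l + u l k * neumann_sum n W t (L - l) ?e"
  proof -
    have "u l = (\<lambda>i. ?u' l i + u l k * ?e i)" by (auto simp: push_def)
    then show ?thesis by (metis neumann_sum_linear)
  qed
  moreover have "?V ?u' (Suc l) = ?V u (Suc l) + u l k * neumann_sum n W t (L - Suc l) (\<lambda>j. W j k)"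
    by (simp add: push_def neumann_sum_linear)
  moreover have "neumann_sum n W t (L - l) ?e = t k + neumann_sum n W t (L - Suc l) (\<lambda>j. W j k)"
  proof -
    have "L - l = Suc (L - Suc l)" using assms by simp
    then show ?thesis by (simp only: neumann_sum_Suc W_e t_e)
  qed
  ultimately show ?thesis
    unfolding split[of u] split[of ?u'] other_levels by (simp add: algebra_simps)
qed

lemma residual_sum_eq:
  "residual_sum n W t L u =
     (\<Sum>l<L. \<Sum>j<L. if j + l < L then \<Sum>i<n. t i * (mat_app n W ^^ j) (u l) i else 0)"
proof -
  have "neumann_sum n W t (L - l) (u l)
      = (\<Sum>j<L. if j + l < L then \<Sum>i<n. t i * (mat_app n W ^^ j) (u l) i else 0)" for l
    unfolding neumann_sum_def by (rule sum.mono_neutral_cong_left) auto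
  moreover have "residual_sum n W t L u = (\<Sum>l<L. neumann_sum n W t (L - l) (u l))"
    unfolding residual_sum_def by (rule sum.mono_neutral_right) (auto simp: neumann_sum_def)
  ultimately show ?thesis by simp
qed

lemma abs_residual_sum_le:
  assumes "substochastic n W" "\<And>l i. l < L \<Longrightarrow> i < n \<Longrightarrow> \<bar>u l i\<bar> \<le> c" "0 \<le> c"
  shows "\<bar>residual_sum n W t L u\<bar> \<le> (real L)\<^sup>2 * ((\<Sum>i<n. \<bar>t i\<bar>) * c)"
proof -
  let ?B = "(\<Sum>i<n. \<bar>t i\<bar>) * c"
  have B: "0 \<le> ?B" using assms by (simp add: sum_nonneg)
  have "\<bar>residual_sum n W t L u\<bar>
      \<le> (\<Sum>l<L. \<Sum>j<L. \<bar>if j + l < L then \<Sum>i<n. t i * (mat_app n W ^^ j) (u l) i else 0\<bar>)"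
    unfolding residual_sum_eq by (rule order.trans[OF sum_abs sum_mono]) (rule sum_abs)
  also have "\<dots> \<le> (\<Sum>l<L. \<Sum>j<L. ?B)"
    by (intro sum_mono) (use B assms in \<open>auto intro!: abs_weighted_mat_app_pow_le\<close>)
  finally show ?thesis by (simp add: power2_eq_square)
qed

subsection \<open>The number of pushes\<close>

definition walk_mass :: "nat \<Rightarrow> (nat \<Rightarrow> nat \<Rightarrow> real) \<Rightarrow> nat \<Rightarrow> nat \<Rightarrow> nat \<Rightarrow> real" where
  "walk_mass n W l k w = (mat_app n (\<lambda>i j. \<bar>W i j\<bar>) ^^ l) ((\<lambda>_. 0)(w := 1)) k"

lemma walk_mass_nonneg: "0 \<le> walk_mass n W l k w"
  unfolding walk_mass_def by (rule mat_app_pow_nonneg) auto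

lemma walk_mass_Suc: "walk_mass n W (Suc l) k w = (\<Sum>i<n. \<bar>W k i\<bar> * walk_mass n W l i w)"
  by (simp add: walk_mass_def mat_app_def)

lemma sum_walk_mass_le_1:
  assumes "substochastic n W" "k < n"
  shows "(\<Sum>w<n. walk_mass n W l k w) \<le> 1"
  using \<open>k < n\<close>
proof (induction l arbitrary: k)
  case 0
  then show ?case by (simp add: walk_mass_def)
next
  case (Suc l)
  have "(\<Sum>w<n. walk_mass n W (Suc l) k w) = mat_app n (\<lambda>i j. \<bar>W i j\<bar>) (\<lambda>i. \<Sum>w<n. walk_mass n W l i w) k"
    unfolding walk_mass_Suc mat_app_def by (subst sum.swap) (simp add: sum_distrib_left)
  also have "\<dots> \<le> mat_app n (\<lambda>i j. \<bar>W i j\<bar>) (\<lambda>_. 1) k"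
    by (rule mat_app_mono) (use Suc.IH in auto)
  also have "\<dots> \<le> 1"
    by (rule mat_app_abs_const_le[OF assms(1) _ Suc.prems]) simp
  finally show ?case .
qed

text \<open>The largest natural number strictly below \<open>h\<close> times the walk mass.  Strictness makes the sum over
  \<open>w\<close> at most \<open>h - 1\<close>, so that nothing is charged to the pushes when \<open>h = 1\<close>.\<close>

definition max_pushes :: "nat \<Rightarrow> (nat \<Rightarrow> nat \<Rightarrow> real) \<Rightarrow> nat \<Rightarrow> nat \<Rightarrow> nat \<Rightarrow> nat \<Rightarrow> nat" where
  "max_pushes n W h w l k = nat (\<lceil>real h * walk_mass n W l k w\<rceil> - 1)"

lemma le_max_pushes: "real p < real h * walk_mass n W l k w \<Longrightarrow> p \<le> max_pushes n W h w l k"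
  unfolding max_pushes_def by linarith

lemma max_pushes_less:
  "0 < max_pushes n W h w l k \<Longrightarrow> real (max_pushes n W h w l k) < real h * walk_mass n W l k w"
  unfolding max_pushes_def by linarith

lemma max_pushes_le: "real (max_pushes n W h w l k) \<le> real h * walk_mass n W l k w"
  using max_pushes_less[of n W h w l k] walk_mass_nonneg[of n W l k w]
  by (cases "max_pushes n W h w l k = 0") (auto intro: less_imp_le)

lemma sum_max_pushes_le:
  assumes "substochastic n W" "k < n" "1 \<le> h"
  shows "(\<Sum>w<n. max_pushes n W h w l k) \<le> h - 1"
proof (cases "\<exists>w<n. 0 < max_pushes n W h w l k")
  case False
  then show ?thesis by simp
next
  case True
  then obtain w where w: "w < n" "0 < max_pushes n W h w l k" by auto
  have "(\<Sum>w<n. real (max_pushes n W h w l k)) < (\<Sum>w<n. real h * walk_mass n W l k w)"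
    by (rule sum_strict_mono_ex1) (use max_pushes_le max_pushes_less[OF w(2)] w in auto)
  also have "\<dots> \<le> real h * 1"
    unfolding sum_distrib_left[symmetric]
    by (rule mult_left_mono[OF sum_walk_mass_le_1]) (use assms in auto)
  finally have "real (\<Sum>w<n. max_pushes n W h w l k) < real h" by simp
  then show ?thesis by linarith
qed

text \<open>Ghost variables of pushing, with threshold \<open>\<theta>\<close>, from the initial residual \<open>f\<close>: \<open>p l k\<close> counts the
  pushes at \<open>(l,k)\<close>, and \<open>g l k\<close> is the total absolute value pushed there.\<close>

definition push_history ::
  "nat \<Rightarrow> (nat \<Rightarrow> nat \<Rightarrow> real) \<Rightarrow> real \<Rightarrow> (nat \<Rightarrow> real) \<Rightarrow> (nat \<Rightarrow> nat \<Rightarrow> real) \<Rightarrow>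
   (nat \<Rightarrow> nat \<Rightarrow> nat) \<Rightarrow> (nat \<Rightarrow> nat \<Rightarrow> real) \<Rightarrow> bool" where
  "push_history n W \<theta> f u p g \<longleftrightarrow>
     (\<forall>l k. 0 \<le> g l k) \<and> (\<forall>l k. p l k = 0 \<or> real (p l k) * \<theta> < g l k) \<and>
     (\<forall>k. \<bar>u 0 k\<bar> + g 0 k \<le> \<bar>f k\<bar>) \<and>
     (\<forall>l k. \<bar>u (Suc l) k\<bar> + g (Suc l) k \<le> mat_app n (\<lambda>i j. \<bar>W i j\<bar>) (g l) k)"

lemma push_history_initial: "push_history n W \<theta> f (initial_residual f) (\<lambda>_ _. 0) (\<lambda>_ _. 0)"
  by (simp add: push_history_def initial_residual_def mat_app_def)

lemma pushed_le:
  assumes "push_history n W \<theta> f u p g"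
  shows "g l k \<le> (mat_app n (\<lambda>i j. \<bar>W i j\<bar>) ^^ l) (\<lambda>k. \<bar>f k\<bar>) k"
proof (induction l arbitrary: k)
  case 0
  have "\<bar>u 0 k\<bar> + g 0 k \<le> \<bar>f k\<bar>"
    using assms by (simp add: push_history_def)
  then show ?case by simp
next
  case (Suc l)
  have "\<bar>u (Suc l) k\<bar> + g (Suc l) k \<le> mat_app n (\<lambda>i j. \<bar>W i j\<bar>) (g l) k"
    using assms by (simp add: push_history_def)
  also have "\<dots> \<le> mat_app n (\<lambda>i j. \<bar>W i j\<bar>) ((mat_app n (\<lambda>i j. \<bar>W i j\<bar>) ^^ l) (\<lambda>k. \<bar>f k\<bar>)) k"
    by (rule mat_app_mono) (use Suc.IH in auto)
  finally show ?case by simp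
qed

lemma pushes_le_max_pushes:
  assumes hist: "push_history n W \<theta> ((\<lambda>_. 0)(w := 1 / d)) u p g" and "0 < d" "0 < h"
    and \<theta>: "\<theta> = 1 / (d * real h)"
  shows "p l k \<le> max_pushes n W h w l k"
proof (cases "p l k = 0")
  case False
  have e_w: "(\<lambda>k. \<bar>((\<lambda>_. 0)(w := 1 / d)) k\<bar>) = (\<lambda>k. 0 + 1 / d * ((\<lambda>_. 0)(w := 1)) k)"
    using \<open>0 < d\<close> by auto
  have "(mat_app n (\<lambda>i j. \<bar>W i j\<bar>) ^^ l) (\<lambda>_. 0) k = 0"
    by (induction l arbitrary: k) (auto simp: mat_app_def)
  then have mass:
    "(mat_app n (\<lambda>i j. \<bar>W i j\<bar>) ^^ l) (\<lambda>k. \<bar>((\<lambda>_. 0)(w := 1 / d)) k\<bar>) k = walk_mass n W l k w / d"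
    unfolding e_w mat_app_pow_linear by (simp add: walk_mass_def)
  have "real (p l k) * \<theta> < g l k"
    using hist False unfolding push_history_def by metis
  also have "\<dots> \<le> walk_mass n W l k w / d"
    using pushed_le[OF hist, of l k] mass by simp
  finally show ?thesis
    using assms by (intro le_max_pushes) (simp add: field_simps)
qed simp

lemma push_history_push:
  assumes hist: "push_history n W \<theta> f u p g" and "k < n" and above: "\<theta> < \<bar>u l k\<bar>"
  shows "push_history n W \<theta> f (push W l k u) (add_at l k 1 p) (add_at l k \<bar>u l k\<bar> g)"
proof -
  let ?u' = "push W l k u" and ?g' = "add_at l k \<bar>u l k\<bar> g"
  let ?Wg = "\<lambda>g. mat_app n (\<lambda>i j. \<bar>W i j\<bar>) g"
  have row0: "\<bar>u 0 j\<bar> + g 0 j \<le> \<bar>f j\<bar>" and row: "\<bar>u (Suc m) j\<bar> + g (Suc m) j \<le> ?Wg (g m) j" for m j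
    using hist by (auto simp: push_history_def)
  have other_rows: "\<bar>?u' m j\<bar> + ?g' m j = \<bar>u m j\<bar> + g m j" if "m \<noteq> Suc l" for m j
    using that by (auto simp: push_def add_at_def)
  have next_row:
    "\<bar>?u' (Suc l) j\<bar> + ?g' (Suc l) j \<le> \<bar>u (Suc l) j\<bar> + g (Suc l) j + \<bar>W j k\<bar> * \<bar>u l k\<bar>" for j
    using abs_triangle_ineq[of "u (Suc l) j" "u l k * W j k"]
    by (simp add: push_def add_at_def abs_mult mult.commute)
  have grow: "?Wg (?g' m) j = ?Wg (g m) j + (if m = l then \<bar>W j k\<bar> * \<bar>u l k\<bar> else 0)" for m j
  proof -
    have "?Wg (?g' m) j
      = (\<Sum>i<n. \<bar>W j i\<bar> * g m i + (if i = k then if m = l then \<bar>W j k\<bar> * \<bar>u l k\<bar> else 0 else 0))"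
      unfolding mat_app_def by (rule sum.cong) (auto simp: add_at_def algebra_simps)
    then show ?thesis
      using \<open>k < n\<close> by (simp add: sum.distrib mat_app_def)
  qed
  have "real (p l k) * \<theta> \<le> g l k"
    using hist unfolding push_history_def by (metis less_imp_le mult_zero_left of_nat_0)
  then have count: "real (add_at l k 1 p l k) * \<theta> < ?g' l k"
    using above by (simp add: add_at_def algebra_simps)
  show ?thesis
    unfolding push_history_def
  proof (intro conjI allI)
    fix m j
    show "0 \<le> ?g' m j"
      using hist by (auto simp: push_history_def add_at_def)
    show "add_at l k 1 p m j = 0 \<or> real (add_at l k 1 p m j) * \<theta> < ?g' m j"
      using count hist by (cases "m = l \<and> j = k") (auto simp: push_history_def add_at_def)
    show "\<bar>?u' 0 j\<bar> + ?g' 0 j \<le> \<bar>f j\<bar>"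
      using other_rows[of 0 j] row0[of j] by simp
    show "\<bar>?u' (Suc m) j\<bar> + ?g' (Suc m) j \<le> ?Wg (?g' m) j"
      unfolding grow using other_rows[of "Suc m" j] next_row[of j] row[of m j] by (cases "m = l") auto
  qed
qed

section \<open>The estimator\<close>

notation Seq (infixr ";;" 60)
notation ISet (infix ":=\<^sub>n" 61)
notation RSet (infix ":=\<^sub>r" 61)
notation ILess (infix "<\<^sub>n" 62)
notation RLess (infix "<\<^sub>r" 62)
notation IAdd (infixl "+\<^sub>n" 65)
notation ISub (infixl "-\<^sub>n" 65)
notation RAdd (infixl "+\<^sub>r" 65)
notation RSub (infixl "-\<^sub>r" 65)
notation RMul (infixl "*\<^sub>r" 70)
notation RDiv (infixl "'/\<^sub>r" 70)

abbreviation (input) equal_nat :: "iexp \<Rightarrow> iexp \<Rightarrow> bexp" (infix "=\<^sub>n" 62) where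
  "e =\<^sub>n f \<equiv> BAnd (BNot (e <\<^sub>n f)) (BNot (f <\<^sub>n e))"

abbreviation (input) real_reg :: "nat \<Rightarrow> rexp" where
  "real_reg x \<equiv> ROfNat (IReg x)"

abbreviation (input) real_const :: "nat \<Rightarrow> rexp" where
  "real_const k \<equiv> ROfNat (INat k)"

abbreviation (input) sq :: "rexp \<Rightarrow> rexp" where
  "sq e \<equiv> e *\<^sub>r e"

text \<open>Registers of natural numbers; the first five hold the input.\<close>

abbreviation (input) "n_reg \<equiv> 0 :: nat"
abbreviation (input) "w_reg \<equiv> 1 :: nat"
abbreviation (input) "L_reg \<equiv> 2 :: nat"
abbreviation (input) "nnz_reg \<equiv> 3 :: nat"
abbreviation (input) "f_row_reg \<equiv> 4 :: nat"
abbreviation (input) "h_reg \<equiv> 5 :: nat"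
abbreviation (input) "height_reg \<equiv> 6 :: nat"
abbreviation (input) "level_reg \<equiv> 7 :: nat"
abbreviation (input) "node_reg \<equiv> 8 :: nat"
abbreviation (input) "edges_reg \<equiv> 9 :: nat"
abbreviation (input) "neighbour_reg \<equiv> 10 :: nat"
abbreviation (input) "samples_reg \<equiv> 11 :: nat"
abbreviation (input) "position_reg \<equiv> 12 :: nat"
abbreviation (input) "steps_reg \<equiv> 13 :: nat"
abbreviation (input) "start_level_reg \<equiv> 14 :: nat"
abbreviation (input) "next_reg \<equiv> 15 :: nat"

text \<open>Registers of real numbers; the result overwrites the input \<open>\<epsilon>\<close>.\<close>

abbreviation (input) "eps_reg \<equiv> 0 :: nat"
abbreviation (input) "result_reg \<equiv> 0 :: nat"
abbreviation (input) "t_norm_reg \<equiv> 2 :: nat"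
abbreviation (input) "diag_reg \<equiv> 3 :: nat"
abbreviation (input) "exact_reg \<equiv> 4 :: nat"
abbreviation (input) "pushed_reg \<equiv> 5 :: nat"
abbreviation (input) "t_node_reg \<equiv> 6 :: nat"
abbreviation (input) "neighbour_diag_reg \<equiv> 7 :: nat"
abbreviation (input) "weight_reg \<equiv> 8 :: nat"
abbreviation (input) "required_reg \<equiv> 9 :: nat"
abbreviation (input) "total_reg \<equiv> 10 :: nat"
abbreviation (input) "t_start_reg \<equiv> 11 :: nat"
abbreviation (input) "sign_reg \<equiv> 12 :: nat"
abbreviation (input) "entry_reg \<equiv> 13 :: nat"

text \<open>The array \<open>residual_arr\<close> is real, with level \<open>l\<close> in row \<open>l\<close>; \<open>stack_arr\<close> is natural.  The loaded
  column occupies arrays of both kinds.\<close>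

abbreviation (input) "residual_arr \<equiv> 0 :: nat"
abbreviation (input) "stack_arr \<equiv> 0 :: nat"
abbreviation (input) "column_arr \<equiv> 1 :: nat"
abbreviation (input) "level_row \<equiv> 0 :: nat"
abbreviation (input) "node_row \<equiv> 1 :: nat"

definition search_test :: bexp where
  "search_test =
     ((real_reg h_reg *\<^sub>r sq (real_reg h_reg)) *\<^sub>r (real_reg nnz_reg *\<^sub>r sq (RReg eps_reg))
      <\<^sub>r sq (RReg t_norm_reg) *\<^sub>r (sq (sq (real_reg L_reg)) *\<^sub>r (real_reg f_row_reg *\<^sub>r real_reg n_reg)))"

definition scale_search :: com where
  "scale_search = h_reg :=\<^sub>n INat 1 ;; While search_test (h_reg :=\<^sub>n IReg h_reg +\<^sub>n INat 1)"

definition push_init :: com where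
  "push_init = GetDiag diag_reg (IReg w_reg) ;;
     RStore residual_arr (INat 0) (IReg w_reg) (real_const 1 /\<^sub>r RReg diag_reg) ;;
     exact_reg :=\<^sub>r real_const 0 ;;
     IStore stack_arr (INat level_row) (INat 0) (INat 0) ;;
     IStore stack_arr (INat node_row) (INat 0) (IReg w_reg) ;;
     height_reg :=\<^sub>n INat 1"

definition pop :: com where
  "pop = height_reg :=\<^sub>n IReg height_reg -\<^sub>n INat 1 ;;
     level_reg :=\<^sub>n IArr stack_arr (INat level_row) (IReg height_reg) ;;
     node_reg :=\<^sub>n IArr stack_arr (INat node_row) (IReg height_reg) ;;
     pushed_reg :=\<^sub>r RArr residual_arr (IReg level_reg) (IReg node_reg)"

text \<open>The threshold condition is \<open>\<bar>u\<bar> d h > 1\<close>, squared to avoid the absolute value.\<close>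

definition push_test :: bexp where
  "push_test = BAnd (IReg level_reg <\<^sub>n IReg L_reg)
     (real_const 1 <\<^sub>r sq (RReg pushed_reg *\<^sub>r (RReg diag_reg *\<^sub>r real_reg h_reg)))"

definition push_start :: com where
  "push_start = GetT t_node_reg (IReg node_reg) ;;
     exact_reg :=\<^sub>r RReg exact_reg +\<^sub>r RReg t_node_reg *\<^sub>r RReg pushed_reg ;;
     RStore residual_arr (IReg level_reg) (IReg node_reg) (real_const 0) ;;
     LoadCol edges_reg column_arr (IReg node_reg)"

definition push_edge :: com where
  "push_edge = edges_reg :=\<^sub>n IReg edges_reg -\<^sub>n INat 1 ;;
     neighbour_reg :=\<^sub>n IArr column_arr (INat 0) (IReg edges_reg) ;;
     GetDiag neighbour_diag_reg (IReg neighbour_reg) ;;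
     Cond (IReg neighbour_reg =\<^sub>n IReg node_reg)
       (weight_reg :=\<^sub>r real_const 1 /\<^sub>r real_const 2)
       (weight_reg :=\<^sub>r (real_const 0 -\<^sub>r RArr column_arr (INat 0) (IReg edges_reg))
                       /\<^sub>r (real_const 2 *\<^sub>r RReg neighbour_diag_reg)) ;;
     RStore residual_arr (IReg level_reg +\<^sub>n INat 1) (IReg neighbour_reg)
       (RArr residual_arr (IReg level_reg +\<^sub>n INat 1) (IReg neighbour_reg)
        +\<^sub>r RReg pushed_reg *\<^sub>r RReg weight_reg) ;;
     IStore stack_arr (INat level_row) (IReg height_reg) (IReg level_reg +\<^sub>n INat 1) ;;
     IStore stack_arr (INat node_row) (IReg height_reg) (IReg neighbour_reg) ;;
     height_reg :=\<^sub>n IReg height_reg +\<^sub>n INat 1"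

definition push_column :: com where
  "push_column = While (INat 0 <\<^sub>n IReg edges_reg) push_edge"

definition push_step :: com where
  "push_step = pop ;; Cond push_test (push_start ;; push_column) Skip"

definition push_loop :: com where
  "push_loop = While (INat 0 <\<^sub>n IReg height_reg) push_step"

definition draw_sign :: com where
  "draw_sign = GetT t_start_reg (IReg position_reg) ;;
     Cond (real_const 0 <\<^sub>r RReg t_start_reg)
       (sign_reg :=\<^sub>r real_const 1)
       (sign_reg :=\<^sub>r real_const 0 -\<^sub>r real_const 1)"

definition discard_long_walk :: com where
  "discard_long_walk = Cond (IReg steps_reg +\<^sub>n IReg start_level_reg <\<^sub>n IReg L_reg) Skip
     (sign_reg :=\<^sub>r real_const 0)"

definition update_sign :: com where
  "update_sign = Cond (IReg next_reg <\<^sub>n IReg n_reg)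
     (Cond (IReg next_reg =\<^sub>n IReg position_reg) Skip
        (Cond (real_const 0 <\<^sub>r RReg entry_reg)
           (sign_reg :=\<^sub>r real_const 0 -\<^sub>r RReg sign_reg) Skip))
     (sign_reg :=\<^sub>r real_const 0)"

definition walk_body :: com where
  "walk_body = steps_reg :=\<^sub>n IReg steps_reg -\<^sub>n INat 1 ;;
     Step next_reg entry_reg (IReg position_reg) ;;
     update_sign ;; position_reg :=\<^sub>n IReg next_reg"

definition walk :: com where
  "walk = While (BAnd (INat 0 <\<^sub>n IReg steps_reg) (IReg position_reg <\<^sub>n IReg n_reg)) walk_body"

definition record_sample :: com where
  "record_sample =
     total_reg :=\<^sub>r RReg total_reg
       +\<^sub>r RReg sign_reg *\<^sub>r RArr residual_arr (IReg start_level_reg) (IReg position_reg) ;;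
     samples_reg :=\<^sub>n IReg samples_reg +\<^sub>n INat 1"

definition draw_walk :: com where
  "draw_walk = Uniform steps_reg (IReg L_reg -\<^sub>n INat 1) ;;
     Uniform start_level_reg (IReg L_reg -\<^sub>n INat 1) ;;
     discard_long_walk ;; walk ;; record_sample"

definition sample_body :: com where
  "sample_body = SampleT position_reg ;; draw_sign ;; draw_walk"

definition sample_loop :: com where
  "sample_loop = While (real_reg samples_reg <\<^sub>r RReg required_reg) sample_body"

definition sample_weight :: rexp where
  "sample_weight = RReg t_norm_reg *\<^sub>r sq (real_reg L_reg)"

definition ratio_exp :: rexp where
  "ratio_exp = sample_weight /\<^sub>r (real_reg h_reg *\<^sub>r RReg eps_reg)"

definition sampling_init :: com where
  "sampling_init = required_reg :=\<^sub>r real_const 4 *\<^sub>r sq (RReg required_reg) ;;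
     total_reg :=\<^sub>r real_const 0 ;; samples_reg :=\<^sub>n INat 0"

definition combine :: com where
  "combine = result_reg :=\<^sub>r
     (RReg exact_reg +\<^sub>r sample_weight *\<^sub>r RReg total_reg /\<^sub>r real_reg samples_reg) /\<^sub>r real_const 2"

definition sampling :: com where
  "sampling = required_reg :=\<^sub>r ratio_exp ;;
     Cond (real_const 1 <\<^sub>r RReg required_reg)
       (sampling_init ;; sample_loop ;; combine)
       (result_reg :=\<^sub>r RReg exact_reg /\<^sub>r real_const 2)"

definition estimator :: com where
  "estimator = Cond (RReg eps_reg <\<^sub>r real_reg L_reg *\<^sub>r RReg t_norm_reg)
     (scale_search ;; push_init ;; push_loop ;; sampling)
     (result_reg :=\<^sub>r real_const 0)"

section \<open>Instances of the problem\<close>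

definition walk_mat :: "real mat \<Rightarrow> nat \<Rightarrow> nat \<Rightarrow> real" where
  "walk_mat M i k = (if i < dim_row M \<and> k < dim_row M then
     if i = k then 1/2 else - (M $$ (i,k)) / (2 * M $$ (i,i)) else 0)"

locale rdd_matrix =
  fixes M :: "real mat" and n :: nat
  assumes M: "M \<in> carrier_mat n n" and RDD: "RDD M"
begin

abbreviation "W \<equiv> walk_mat M"

lemma dims: "dim_row M = n" "dim_col M = n"
  using M by auto

lemma diag_pos: "i < n \<Longrightarrow> 0 < M $$ (i,i)"
  using RDD by (auto simp: RDD_def dims)

lemma substochastic_W: "substochastic n W"
  unfolding substochastic_def
proof (intro allI impI)
  fix i assume i: "i < n"
  have "(\<Sum>k<n. \<bar>W i k\<bar>) = \<bar>W i i\<bar> + (\<Sum>k\<in>{..<n} - {i}. \<bar>W i k\<bar>)"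
    using i by (subst sum.remove[of _ i]) auto
  also have "\<dots> = 1/2 + (\<Sum>k\<in>{..<n} - {i}. \<bar>M $$ (i,k)\<bar> / (2 * M $$ (i,i)))"
    using i diag_pos[OF i] by (auto simp: walk_mat_def dims abs_mult intro!: sum.cong)
  also have "\<dots> = 1/2 + (\<Sum>k\<in>{..<n} - {i}. \<bar>M $$ (i,k)\<bar>) / (2 * M $$ (i,i))"
    by (simp add: sum_divide_distrib)
  also have "\<dots> \<le> 1"
    using RDD i diag_pos[OF i] by (auto simp: RDD_def dims field_simps)
  finally show "(\<Sum>k<n. \<bar>W i k\<bar>) \<le> 1" .
qed

end

locale rdd_problem = rdd_matrix M n for M n +
  fixes t :: "real Matrix.vec" and acc :: access and L :: nat and \<epsilon> :: real
  assumes t: "t \<in> carrier_vec n" and t_nonzero: "t \<noteq> 0\<^sub>v n" and access: "valid_access M acc"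
    and eps_pos: "0 < \<epsilon>" and L_pos: "0 < L"
begin

abbreviation "f\<^sub>r \<equiv> f_row M acc"
abbreviation "\<tau> \<equiv> \<Sum>i<n. \<bar>t $ i\<bar>"

text \<open>Increasing \<open>h\<close>, the inverse of the push threshold, makes pushing dearer and sampling cheaper.  The
  least \<open>h\<close> that makes up for the cost of sampling is found by linear search.\<close>

definition balanced :: "nat \<Rightarrow> bool" where
  "balanced m \<longleftrightarrow> \<tau>\<^sup>2 * real L ^ 4 * real f\<^sub>r * real n \<le> real m ^ 3 * real (nnz M) * \<epsilon>\<^sup>2"

definition h :: nat where
  "h = (LEAST m. 1 \<le> m \<and> balanced m)"

lemma dim_pos: "0 < n"
  using t t_nonzero by (cases n) auto

lemma \<tau>_pos: "0 < \<tau>"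
proof -
  obtain i where "i < n" "t $ i \<noteq> 0"
    using t_nonzero t by (metis carrier_vecD eq_vecI index_zero_vec)
  then show ?thesis by (intro sum_pos2[of _ i]) auto
qed

lemma pnorm_1_t: "pnorm 1 t = \<tau>"
  using t by (simp add: pnorm_def one_ereal_def)

lemma dim_le_nnz: "n \<le> nnz M"
proof -
  have "card ((\<lambda>i. (i,i)) ` {..<n}) \<le> nnz M"
    unfolding nnz_def
  proof (rule card_mono)
    show "finite {(i,j). i < dim_row M \<and> j < dim_col M \<and> M $$ (i,j) \<noteq> 0}"
      by (rule finite_subset[of _ "{..<n} \<times> {..<n}"]) (auto simp: dims)
    show "(\<lambda>i. (i,i)) ` {..<n} \<subseteq> {(i,j). i < dim_row M \<and> j < dim_col M \<and> M $$ (i,j) \<noteq> 0}"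
      using diag_pos by (fastforce simp: dims)
  qed
  then show ?thesis by (simp add: card_image inj_on_def)
qed

lemma step_time_le: "j < n \<Longrightarrow> step_time acc j \<le> f\<^sub>r"
  unfolding f_row_def by (rule Max_ge) (auto simp: dims)

lemma f_row_ge_1: "1 \<le> f\<^sub>r"
  using step_time_le[OF dim_pos] access dim_pos by (force simp: valid_access_def dims)

lemma balanced_exists: "\<exists>m\<ge>1. balanced m"
proof -
  define Y where "Y = real (nnz M) * \<epsilon>\<^sup>2"
  define X where "X = \<tau>\<^sup>2 * real L ^ 4 * real f\<^sub>r * real n"
  have Y: "0 < Y"
    using dim_le_nnz dim_pos eps_pos by (simp add: Y_def)
  obtain k :: nat where "X / Y \<le> real k"
    using real_arch_simple by blast
  then have "X \<le> real (Suc k) * Y"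
    using Y by (simp add: field_simps)
  also have "\<dots> \<le> real (Suc k) ^ 3 * Y"
    using Y by (intro mult_right_mono self_le_power) auto
  finally show ?thesis
    by (intro exI[of _ "Suc k"]) (simp add: balanced_def X_def Y_def mult.assoc)
qed

lemma h_ge_1: "1 \<le> h" and balanced_h: "balanced h"
  using LeastI_ex[OF balanced_exists] by (auto simp: h_def)

lemma not_balanced_below_h: "1 \<le> m \<Longrightarrow> m < h \<Longrightarrow> \<not> balanced m"
  using not_less_Least[of m "\<lambda>m. 1 \<le> m \<and> balanced m"] by (auto simp: h_def)

end

locale rdd_instance = rdd_problem M n t acc L \<epsilon> for M n t acc L \<epsilon> +
  fixes w :: nat
  assumes w: "w < n"
begin

abbreviation "d \<equiv> M $$ (w,w)"
abbreviation "b \<equiv> unit_vec n w"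
abbreviation "scaled_unit_vec \<equiv> (\<lambda>_. 0)(w := 1 / d)"
abbreviation "target \<equiv> neumann_sum n W (($) t) L scaled_unit_vec"
abbreviation "run c s \<equiv> exec M b t acc c s"

definition \<theta> :: real where
  "\<theta> = 1 / (d * real h)"

definition inputs_kept :: "state \<Rightarrow> bool" where
  "inputs_kept s \<longleftrightarrow> ireg s n_reg = n \<and> ireg s w_reg = w \<and> ireg s L_reg = L \<and> ireg s nnz_reg = nnz M \<and>
     ireg s f_row_reg = f\<^sub>r \<and> rreg s eps_reg = \<epsilon> \<and> rreg s t_norm_reg = \<tau>"

lemma d_pos: "0 < d"
  using diag_pos w by simp

lemma \<theta>_pos: "0 < \<theta>"
  using d_pos h_ge_1 by (simp add: \<theta>_def)

lemma bval_search_test: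
  "inputs_kept s \<Longrightarrow> bval search_test s \<longleftrightarrow> \<not> balanced (ireg s h_reg)"
  by (auto simp: search_test_def inputs_kept_def balanced_def power2_eq_square power3_eq_cube
    power4_eq_xxxx mult.assoc)

lemma scale_search_spec:
  assumes "inputs_kept s" "rarr s = (\<lambda>_ _ _. 0)"
  shows "surely (run scale_search s)
    (\<lambda>s'. inputs_kept s' \<and> rarr s' = (\<lambda>_ _ _. 0) \<and> ireg s' h_reg = h \<and> clock s' \<le> clock s + 2 * h)"
    (is "surely _ ?found")
proof -
  define I where "I s' \<longleftrightarrow> inputs_kept s' \<and> rarr s' = (\<lambda>_ _ _. 0) \<and> 1 \<le> ireg s' h_reg \<and>
    ireg s' h_reg \<le> h \<and> clock s' + 1 = clock s + 2 * ireg s' h_reg" for s'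
  let ?s1 = "spend 1 (set_ireg h_reg 1 s)"
  have "surely (run (While search_test (h_reg :=\<^sub>n IReg h_reg +\<^sub>n INat 1)) ?s1) ?found"
  proof (rule surely_While[where I = I and T = "clock s + 2 * h"])
    fix s' assume s': "I s'" "bval search_test s'"
    then have "ireg s' h_reg \<noteq> h"
      using balanced_h by (auto simp: I_def bval_search_test)
    then show "surely (run (h_reg :=\<^sub>n IReg h_reg +\<^sub>n INat 1) (spend 1 s'))
      (\<lambda>s''. I s'' \<and> clock s' < clock s'')"
      using s' by (auto simp: I_def inputs_kept_def)
  next
    fix s' assume s': "I s'" "\<not> bval search_test s'"
    then have "ireg s' h_reg = h"
      using not_balanced_below_h[of "ireg s' h_reg"] by (force simp: I_def bval_search_test)
    then show "?found (spend 1 s')"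
      using s' by (auto simp: I_def inputs_kept_def)
  qed (use assms h_ge_1 in \<open>auto simp: I_def inputs_kept_def\<close>)
  then show ?thesis
    by (simp add: scale_search_def)
qed

end

section \<open>Correctness and cost of the push phase\<close>

definition stack :: "state \<Rightarrow> (nat \<times> nat) set" where
  "stack s = (\<lambda>i. (iarr s stack_arr level_row i, iarr s stack_arr node_row i)) ` {..<ireg s height_reg}"

definition scatter ::
    "(nat \<Rightarrow> nat \<Rightarrow> real) \<Rightarrow> nat \<Rightarrow> nat \<Rightarrow> real \<Rightarrow> nat set \<Rightarrow> (nat \<Rightarrow> nat \<Rightarrow> real) \<Rightarrow> nat \<Rightarrow> nat \<Rightarrow> real" where
  "scatter W l k x J u = u(l := (\<lambda>j. u l j + (if j \<in> J then x * W j k else 0)))"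

lemma scatter_empty: "scatter W l k x {} u = u"
  by (simp add: scatter_def)

lemma scatter_insert:
  "j \<notin> J \<Longrightarrow> scatter W l k x (insert j J) u = add_at l j (x * W j k) (scatter W l k x J u)"
  by (auto simp: scatter_def add_at_def fun_eq_iff)

lemma scatter_support: "(\<And>j. W j k \<noteq> 0 \<Longrightarrow> j \<in> J) \<Longrightarrow> scatter W l k x J u = scatter W l k x UNIV u"
  by (auto simp: scatter_def fun_eq_iff)

lemma push_eq_scatter: "push W l k u = scatter W (Suc l) k (u l k) UNIV (u(l := (u l)(k := 0)))"
  by (simp add: push_def scatter_def)

context rdd_problem
begin

definition push_cost :: "nat \<Rightarrow> nat" where
  "push_cost k = 10 + 30 * length (col_list acc k)"

definition push_time :: "nat \<Rightarrow> nat" where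
  "push_time w = (\<Sum>l<L. \<Sum>k<n. max_pushes n W h w l k * push_cost k)"

lemma col_list:
  assumes "k < n"
  shows "distinct (col_list acc k)" "\<And>j. j \<in> set (col_list acc k) \<longleftrightarrow> j < n \<and> M $$ (j,k) \<noteq> 0"
  using access assms by (auto simp: valid_access_def dims)

lemma walk_mat_nonzero: "k < n \<Longrightarrow> W j k \<noteq> 0 \<Longrightarrow> j \<in> set (col_list acc k)"
  using diag_pos by (fastforce simp: col_list walk_mat_def dims split: if_splits)

end

context rdd_instance
begin

definition push_budget :: "(nat \<Rightarrow> nat \<Rightarrow> nat) \<Rightarrow> nat" where
  "push_budget p = (\<Sum>l<L. \<Sum>k<n. (max_pushes n W h w l k - p l k) * push_cost k)"

lemma push_budget_add_at:
  assumes "l < L" "k < n" "Suc (p l k) \<le> max_pushes n W h w l k"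
  shows "push_budget p = push_budget (add_at l k 1 p) + push_cost k"
proof -
  let ?p' = "add_at l k 1 p" and ?m = "max_pushes n W h w"
  let ?paid = "\<lambda>m j. if j = k then if m = l then push_cost k else 0 else 0"
  have "(?m m j - p m j) * push_cost j = (?m m j - ?p' m j) * push_cost j + ?paid m j" for m j
  proof (cases "m = l \<and> j = k")
    case True
    then have "?m l k - p l k = Suc (?m l k - Suc (p l k))"
      using assms by simp
    then show ?thesis using True by (simp add: add_at_def)
  qed (auto simp: add_at_def)
  then have "push_budget p = (\<Sum>m<L. \<Sum>j<n. (?m m j - ?p' m j) * push_cost j + ?paid m j)"
    by (simp add: push_budget_def)
  also have "\<dots> = push_budget ?p' + push_cost k"
    using assms by (simp only: sum.distrib push_budget_def) simp
  finally show ?thesis .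
qed

definition push_base :: "state \<Rightarrow> bool" where
  "push_base s \<longleftrightarrow> inputs_kept s \<and> ireg s h_reg = h \<and> rreg s diag_reg = d \<and> snd ` stack s \<subseteq> {..<n}"

definition value_kept :: "state \<Rightarrow> bool" where
  "value_kept s \<longleftrightarrow> rreg s exact_reg + residual_sum n W (($) t) L (rarr s residual_arr) = target"

definition within_budget :: "nat \<Rightarrow> state \<Rightarrow> bool" where
  "within_budget T s \<longleftrightarrow> (\<exists>p g. push_history n W \<theta> scaled_unit_vec (rarr s residual_arr) p g \<and>
     clock s + 10 * ireg s height_reg + push_budget p \<le> T)"

definition above_threshold :: "state \<Rightarrow> (nat \<times> nat) set" where
  "above_threshold s = {(l,k). l < L \<and> k < n \<and> \<theta> < \<bar>rarr s residual_arr l k\<bar>}"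

definition push_inv :: "nat \<Rightarrow> state \<Rightarrow> bool" where
  "push_inv T s \<longleftrightarrow> push_base s \<and> value_kept s \<and> within_budget T s \<and> above_threshold s \<subseteq> stack s"

definition popped_inv :: "nat \<Rightarrow> state \<Rightarrow> bool" where
  "popped_inv T s \<longleftrightarrow> push_base s \<and> value_kept s \<and> within_budget T (spend 5 s) \<and>
     ireg s node_reg < n \<and> rreg s pushed_reg = rarr s residual_arr (ireg s level_reg) (ireg s node_reg) \<and>
     above_threshold s \<subseteq> insert (ireg s level_reg, ireg s node_reg) (stack s)"

lemma spend_simps [simp]:
  "inputs_kept (spend k s) = inputs_kept s" "stack (spend k s) = stack s"
  "push_base (spend k s) = push_base s" "value_kept (spend k s) = value_kept s"
  "above_threshold (spend k s) = above_threshold s"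
  by (simp_all add: inputs_kept_def stack_def push_base_def value_kept_def above_threshold_def)

lemma within_budget_antimono:
  assumes "within_budget T s" "rarr s' residual_arr = rarr s residual_arr"
    "clock s' + 10 * ireg s' height_reg \<le> clock s + 10 * ireg s height_reg"
  shows "within_budget T s'"
  using assms unfolding within_budget_def by (metis add_le_mono1 order.trans)

subsection \<open>The loop over a column\<close>

definition column_loaded :: "state \<Rightarrow> bool" where
  "column_loaded s \<longleftrightarrow> ireg s node_reg < n \<and>
     (\<forall>i<length (col_list acc (ireg s node_reg)).
        iarr s column_arr 0 i = col_list acc (ireg s node_reg) ! i \<and>
        rarr s column_arr 0 i = M $$ (col_list acc (ireg s node_reg) ! i, ireg s node_reg))"

definition column_inv :: "state \<Rightarrow> state \<Rightarrow> bool" where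
  "column_inv s\<^sub>0 s \<longleftrightarrow> (let l = ireg s\<^sub>0 level_reg; k = ireg s\<^sub>0 node_reg; x = rreg s\<^sub>0 pushed_reg;
       ks = col_list acc k; treated = set (drop (ireg s edges_reg) ks) in
     push_base s \<and> column_loaded s \<and> ireg s node_reg = k \<and> ireg s level_reg = l \<and>
     rreg s pushed_reg = x \<and> rreg s exact_reg = rreg s\<^sub>0 exact_reg \<and>
     rarr s residual_arr = scatter W (Suc l) k x treated (rarr s\<^sub>0 residual_arr) \<and>
     stack s = stack s\<^sub>0 \<union> Pair (Suc l) ` treated \<and> ireg s edges_reg \<le> length ks \<and>
     ireg s height_reg + ireg s edges_reg = ireg s\<^sub>0 height_reg + length ks \<and>
     clock s + 10 * ireg s edges_reg = clock s\<^sub>0 + 10 * length ks)"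

lemma push_edge_exec:
  assumes "ireg s node_reg = k" "k < n" "j < n" "ireg s edges_reg = Suc m"
    "iarr s column_arr 0 m = j" "rarr s column_arr 0 m = M $$ (j,k)"
  shows "surely (run push_edge s) (\<lambda>s'.
    ireg s' = (ireg s)(edges_reg := m, neighbour_reg := j, height_reg := Suc (ireg s height_reg)) \<and>
    rreg s' = (rreg s)(neighbour_diag_reg := M $$ (j,j), weight_reg := W j k) \<and>
    rarr s' = (rarr s)(residual_arr :=
      add_at (Suc (ireg s level_reg)) j (rreg s pushed_reg * W j k) (rarr s residual_arr)) \<and>
    iarr s' column_arr = iarr s column_arr \<and> stack s' = insert (Suc (ireg s level_reg), j) (stack s) \<and>
    clock s' = clock s + 9)"
  using assms
  by (cases j k rule: linorder_cases)
    (simp_all add: push_edge_def walk_mat_def dims add_at_def fun_eq_iff stack_def lessThan_Suc)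

lemma push_edge_spec:
  assumes inv: "column_inv s\<^sub>0 s" and "0 < ireg s edges_reg"
  shows "surely (run push_edge (spend 1 s)) (\<lambda>s'. column_inv s\<^sub>0 s' \<and> clock s < clock s')"
proof -
  define l k x where "l = ireg s\<^sub>0 level_reg" and "k = ireg s\<^sub>0 node_reg" and "x = rreg s\<^sub>0 pushed_reg"
  define ks m j where "ks = col_list acc k" and "m = ireg s edges_reg - 1" and "j = ks ! m"
  note column_inv =
    column_inv_def Let_def l_def[symmetric] k_def[symmetric] x_def[symmetric] ks_def[symmetric]
  have regs: "ireg s edges_reg = Suc m" "ireg s node_reg = k" "ireg s level_reg = l"
    "rreg s pushed_reg = x"
    and k: "k < n" and m: "m < length ks"
    using assms by (auto simp: column_inv column_loaded_def m_def)
  have drop_m: "drop m ks = j # drop (Suc m) ks"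
    using m by (simp add: Cons_nth_drop_Suc j_def)
  then have new: "j \<notin> set (drop (Suc m) ks)"
    using distinct_drop[OF col_list(1)[OF k], of m] by (simp add: ks_def)
  have j: "j < n"
    using m col_list(2)[OF k] by (metis j_def ks_def nth_mem)
  have entry: "iarr s column_arr 0 m = j" "rarr s column_arr 0 m = M $$ (j,k)"
    using inv m by (simp_all add: column_inv column_loaded_def j_def)
  let ?treated = "\<lambda>s'.
      ireg s' = (ireg s)(edges_reg := m, neighbour_reg := j, height_reg := Suc (ireg s height_reg)) \<and>
      rreg s' = (rreg s)(neighbour_diag_reg := M $$ (j,j), weight_reg := W j k) \<and>
      rarr s' = (rarr s)(residual_arr := add_at (Suc l) j (x * W j k) (rarr s residual_arr)) \<and>
      iarr s' column_arr = iarr s column_arr \<and> stack s' = insert (Suc l, j) (stack s) \<and>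
      clock s' = clock s + 10"
  have "surely (run push_edge (spend 1 s)) ?treated"
    by (rule ensures_mono[OF push_edge_exec[where k = k and m = m]]) (use regs k j entry in auto)
  then show ?thesis
  proof (rule ensures_mono)
    fix s' assume s': "?treated s'"
    have "push_base s" "column_loaded s"
      using inv by (simp_all add: column_inv)
    then have "push_base s'" "column_loaded s'"
      using s' j by (simp_all add: push_base_def inputs_kept_def column_loaded_def)
    then show "column_inv s\<^sub>0 s' \<and> clock s < clock s'"
      using inv s' regs m by (simp add: column_inv drop_m scatter_insert[OF new])
  qed auto
qed

lemma push_column_spec:
  assumes s: "push_base s" "column_loaded s"
    and edges: "ireg s edges_reg = length (col_list acc (ireg s node_reg))"
  shows "surely (run push_column s) (\<lambda>s'. push_base s' \<and> rreg s' exact_reg = rreg s exact_reg \<and>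
      rarr s' residual_arr
        = scatter W (Suc (ireg s level_reg)) (ireg s node_reg) (rreg s pushed_reg) UNIV
        (rarr s residual_arr) \<and>
      stack s' = stack s \<union> Pair (Suc (ireg s level_reg)) ` set (col_list acc (ireg s node_reg)) \<and>
      ireg s' height_reg = ireg s height_reg + length (col_list acc (ireg s node_reg)) \<and>
      clock s' = clock s + 1 + 10 * length (col_list acc (ireg s node_reg)))"
    (is "surely _ ?pushed")
  unfolding push_column_def
proof (rule surely_While[where I = "column_inv s"
      and T = "clock s + 10 * length (col_list acc (ireg s node_reg))"])
  show "column_inv s s"
    using s by (simp add: column_inv_def Let_def edges scatter_empty)
  fix s' assume inv: "column_inv s s'" and "\<not> bval (INat 0 <\<^sub>n IReg edges_reg) s'"
  then have "ireg s' edges_reg = 0" "ireg s node_reg < n"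
    by (auto simp: column_inv_def column_loaded_def Let_def)
  then show "?pushed (spend 1 s')"
    using inv scatter_support[of W "ireg s node_reg", OF walk_mat_nonzero]
    by (simp add: column_inv_def Let_def)
qed (use push_edge_spec in \<open>auto simp: column_inv_def Let_def\<close>)

subsection \<open>The loop over the stack\<close>

lemma push_init_exec:
  assumes "inputs_kept s" "rarr s = (\<lambda>_ _ _. 0)"
  shows "surely (run push_init s) (\<lambda>s'. ireg s' = (ireg s)(height_reg := 1) \<and>
      rreg s' = (rreg s)(diag_reg := d, exact_reg := 0) \<and>
      rarr s' residual_arr = initial_residual scaled_unit_vec \<and>
      stack s' = {(0, w)} \<and> clock s' = clock s + 6)"
  using assms by (simp add: push_init_def inputs_kept_def initial_residual_def
    stack_def lessThan_Suc fun_upd_def)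

lemma push_init_spec:
  assumes "inputs_kept s" "rarr s = (\<lambda>_ _ _. 0)" "ireg s h_reg = h"
  shows "surely (run push_init s) (push_inv (clock s + 16 + push_time w))"
proof (rule ensures_mono[OF push_init_exec[OF assms(1,2)]])
  fix s' assume s': "ireg s' = (ireg s)(height_reg := 1) \<and>
    rreg s' = (rreg s)(diag_reg := d, exact_reg := 0) \<and>
    rarr s' residual_arr = initial_residual scaled_unit_vec \<and>
    stack s' = {(0, w)} \<and> clock s' = clock s + 6"
  then have residual: "rarr s' residual_arr = initial_residual scaled_unit_vec"
    by simp
  have "within_budget (clock s + 16 + push_time w) s'"
    unfolding within_budget_def residual
    by (intro exI conjI, rule push_history_initial) (use s' in \<open>simp add: push_budget_def push_time_def\<close>)
  moreover have "above_threshold s' \<subseteq> stack s'"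
  proof -
    have "(l,k) = (0,w)" if "\<theta> < \<bar>initial_residual scaled_unit_vec l k\<bar>" for l k
      using that \<theta>_pos by (auto simp: initial_residual_def split: if_splits)
    then show ?thesis
      using s' unfolding above_threshold_def residual by blast
  qed
  ultimately show "push_inv (clock s + 16 + push_time w) s'"
    using s' assms w
    by (simp add: push_inv_def push_base_def inputs_kept_def value_kept_def residual_sum_initial)
qed auto

lemma pop_exec:
  assumes "ireg s height_reg = Suc m" "l = iarr s stack_arr level_row m"
    "k = iarr s stack_arr node_row m"
  shows "surely (run pop s) (\<lambda>s'. ireg s' = (ireg s)(height_reg := m, level_reg := l, node_reg := k) \<and>
      rreg s' = (rreg s)(pushed_reg := rarr s residual_arr l k) \<and> rarr s' = rarr s \<and>
      stack s = insert (l,k) (stack s') \<and> clock s' = clock s + 4)"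
  using assms by (simp add: pop_def stack_def lessThan_Suc)

lemma pop_spec:
  assumes inv: "push_inv T s" and "0 < ireg s height_reg"
  shows "surely (run pop (spend 1 s)) (\<lambda>s'. popped_inv T s' \<and> clock s < clock s')"
proof -
  obtain m where height: "ireg s height_reg = Suc m"
    using assms by (cases "ireg s height_reg") auto
  define l k where "l = iarr s stack_arr level_row m" and "k = iarr s stack_arr node_row m"
  show ?thesis
  proof (rule ensures_mono[OF pop_exec])
    fix s' assume s': "ireg s' = (ireg (spend 1 s))(height_reg := m, level_reg := l, node_reg := k) \<and>
      rreg s' = (rreg (spend 1 s))(pushed_reg := rarr (spend 1 s) residual_arr l k) \<and>
      rarr s' = rarr (spend 1 s) \<and> stack (spend 1 s) = insert (l,k) (stack s') \<and>
      clock s' = clock (spend 1 s) + 4"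
    have "within_budget T (spend 5 s')"
      by (rule within_budget_antimono[of T s]) (use inv s' height in \<open>simp_all add: push_inv_def\<close>)
    moreover have "push_base s" "value_kept s" "above_threshold s \<subseteq> stack s"
      using inv by (simp_all add: push_inv_def)
    ultimately show "popped_inv T s' \<and> clock s < clock s'"
      using s' height by (simp add: popped_inv_def push_base_def inputs_kept_def value_kept_def
        above_threshold_def)
  qed (simp_all add: height l_def k_def)
qed

lemma bval_push_test:
  assumes "popped_inv T s"
  shows "bval push_test s \<longleftrightarrow> (ireg s level_reg, ireg s node_reg) \<in> above_threshold s"
proof -
  have "1 < y * y \<longleftrightarrow> 1 < \<bar>y\<bar>" for y :: real
    using abs_square_less_1[of y] abs_square_le_1[of y] by (simp add: power2_eq_square not_le[symmetric])
  moreover have "1 < \<bar>x * (d * real h)\<bar> \<longleftrightarrow> \<theta> < \<bar>x\<bar>" for x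
    using d_pos h_ge_1 by (simp add: abs_mult \<theta>_def field_simps)
  ultimately show ?thesis
    using assms
    by (simp add: push_test_def popped_inv_def push_base_def inputs_kept_def above_threshold_def)
qed

lemma skip_spec:
  assumes inv: "popped_inv T s" and "\<not> bval push_test s"
  shows "push_inv T (spend 1 s)"
proof -
  have "within_budget T (spend 1 s)"
    by (rule within_budget_antimono[of T "spend 5 s"]) (use inv in \<open>simp_all add: popped_inv_def\<close>)
  then show ?thesis
    using inv assms(2) bval_push_test[OF inv] by (auto simp: popped_inv_def push_inv_def)
qed

lemma within_budget_push:
  assumes budget: "within_budget T (spend 5 s)" and above: "(l,k) \<in> above_threshold s"
    and s': "rarr s' residual_arr = push W l k (rarr s residual_arr)"
      "clock s' + 10 * ireg s' height_reg \<le> clock s + 5 + 10 * ireg s height_reg + push_cost k"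
  shows "within_budget T s'"
proof -
  let ?u = "rarr s residual_arr"
  have lk: "l < L" "k < n" "\<theta> < \<bar>?u l k\<bar>"
    using above by (auto simp: above_threshold_def)
  obtain p g where hist: "push_history n W \<theta> scaled_unit_vec ?u p g"
    and time: "clock s + 5 + 10 * ireg s height_reg + push_budget p \<le> T"
    using budget by (auto simp: within_budget_def)
  have hist': "push_history n W \<theta> scaled_unit_vec (push W l k ?u)
    (add_at l k 1 p) (add_at l k \<bar>?u l k\<bar> g)"
    by (rule push_history_push[OF hist lk(2,3)])
  have "add_at l k 1 p l k \<le> max_pushes n W h w l k"
    by (rule pushes_le_max_pushes[OF hist' d_pos _ \<theta>_def]) (use h_ge_1 in simp)
  then have "push_budget p = push_budget (add_at l k 1 p) + push_cost k"
    by (intro push_budget_add_at[OF lk(1,2)]) (simp add: add_at_def)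
  then show ?thesis
    unfolding within_budget_def s'(1) using hist' s'(2) time by (intro exI conjI) (assumption, simp)
qed

lemma above_threshold_push:
  assumes residual: "rarr s' residual_arr = push W l k (rarr s residual_arr)" and "k < n"
  shows "above_threshold s' \<subseteq> (above_threshold s - {(l,k)}) \<union> Pair (Suc l) ` set (col_list acc k)"
proof (rule subrelI)
  fix l' k' assume above: "(l',k') \<in> above_threshold s'"
  show "(l',k') \<in> (above_threshold s - {(l,k)}) \<union> Pair (Suc l) ` set (col_list acc k)"
  proof (cases "l' = Suc l \<and> W k' k \<noteq> 0")
    case True
    then show ?thesis using walk_mat_nonzero[OF \<open>k < n\<close>] by simp
  next
    case False
    then have "push W l k (rarr s residual_arr) l' k'
      = (if l' = l \<and> k' = k then 0 else rarr s residual_arr l' k')"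
      by (auto simp: push_def)
    then show ?thesis
      using above \<theta>_pos by (simp add: above_threshold_def residual split: if_splits)
  qed
qed

lemma push_start_exec:
  assumes "rreg s pushed_reg = x" "ireg s level_reg = l" "ireg s node_reg = k" "k < n"
  shows "surely (run push_start s) (\<lambda>s'. column_loaded s' \<and> stack s' = stack s \<and>
    ireg s' = (ireg s)(edges_reg := length (col_list acc k)) \<and>
    rreg s' = (rreg s)(t_node_reg := t $ k, exact_reg := rreg s exact_reg + t $ k * x) \<and>
    rarr s' residual_arr = (rarr s residual_arr)(l := (rarr s residual_arr l)(k := 0)) \<and>
    clock s' = clock s + 4 + length (col_list acc k))"
  using assms by (simp add: push_start_def column_loaded_def load_list_simps stack_def fun_upd_twist)

definition pushed :: "state \<Rightarrow> state \<Rightarrow> bool" where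
  "pushed s s' \<longleftrightarrow>
    (let l = ireg s level_reg; k = ireg s node_reg; u = rarr s residual_arr; ks = col_list acc k in
     push_base s' \<and> rreg s' exact_reg = rreg s exact_reg + t $ k * u l k \<and>
     rarr s' residual_arr = push W l k u \<and> stack s' = stack s \<union> Pair (Suc l) ` set ks \<and>
     ireg s' height_reg = ireg s height_reg + length ks \<and> clock s' = clock s + 6 + 11 * length ks)"

lemma push_start_column_spec:
  assumes inv: "popped_inv T s"
  shows "surely (run (push_start ;; push_column) (spend 1 s)) (pushed s)"
proof (rule ensures_Seq_surely)
  define l k u where "l = ireg s level_reg" and "k = ireg s node_reg" and "u = rarr s residual_arr"
  define ks where "ks = col_list acc k"
  have k: "k < n" and pushed_reg: "rreg s pushed_reg = u l k"
    using inv by (simp_all add: popped_inv_def l_def k_def u_def)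
  let ?started = "\<lambda>s\<^sub>1. column_loaded s\<^sub>1 \<and> stack s\<^sub>1 = stack s \<and>
    ireg s\<^sub>1 = (ireg s)(edges_reg := length ks) \<and>
    rreg s\<^sub>1 = (rreg s)(t_node_reg := t $ k, exact_reg := rreg s exact_reg + t $ k * u l k) \<and>
    rarr s\<^sub>1 residual_arr = u(l := (u l)(k := 0)) \<and> clock s\<^sub>1 = 5 + clock s + length ks"
  show "surely (run push_start (spend 1 s)) ?started"
    by (rule ensures_mono[OF push_start_exec])
      (use k pushed_reg in \<open>simp_all add: l_def k_def u_def ks_def\<close>)
  fix s\<^sub>1 assume s\<^sub>1: "?started s\<^sub>1"
  show "surely (run push_column s\<^sub>1) (pushed s)"
  proof (rule ensures_mono[OF push_column_spec])
    show "push_base s\<^sub>1"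
      using inv s\<^sub>1 by (simp add: popped_inv_def push_base_def inputs_kept_def)
  qed (use s\<^sub>1 pushed_reg in
    \<open>simp_all add: pushed_def Let_def push_eq_scatter l_def[symmetric] k_def[symmetric]
      u_def[symmetric] ks_def\<close>)
qed

lemma push_inv_if_pushed:
  assumes inv: "popped_inv T s" and test: "bval push_test s" and s': "pushed s s'"
  shows "push_inv T s'"
proof -
  define l k where "l = ireg s level_reg" and "k = ireg s node_reg"
  note pushed = s'[unfolded pushed_def Let_def, folded l_def k_def]
  have above: "(l,k) \<in> above_threshold s"
    using test bval_push_test[OF inv] by (simp add: l_def k_def)
  then have lk: "l < L" "k < n"
    by (auto simp: above_threshold_def)
  have "value_kept s'"
    using pushed inv residual_sum_push[OF lk, of "($) t" "rarr s residual_arr" W]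
    by (simp add: value_kept_def popped_inv_def)
  moreover have "within_budget T s'"
    by (rule within_budget_push[OF _ above])
      (use pushed inv in \<open>simp_all add: popped_inv_def push_cost_def\<close>)
  moreover have "above_threshold s' \<subseteq> stack s'"
  proof -
    have "above_threshold s' \<subseteq> (above_threshold s - {(l,k)}) \<union> Pair (Suc l) ` set (col_list acc k)"
      by (rule above_threshold_push) (use pushed lk in simp_all)
    moreover have "above_threshold s \<subseteq> insert (l,k) (stack s)"
      using inv by (simp add: popped_inv_def l_def k_def)
    ultimately show ?thesis using pushed by blast
  qed
  ultimately show ?thesis
    using pushed by (simp add: push_inv_def)
qed

lemma push_step_spec:
  assumes "push_inv T s" "0 < ireg s height_reg"
  shows "surely (run push_step (spend 1 s)) (\<lambda>s'. push_inv T s' \<and> clock s < clock s')"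
  unfolding push_step_def
proof (rule ensures_Seq_surely[OF pop_spec[OF assms]])
  fix s' assume s': "popped_inv T s' \<and> clock s < clock s'"
  show "surely (run (Cond push_test (push_start ;; push_column) Skip) s')
    (\<lambda>s'. push_inv T s' \<and> clock s < clock s')"
  proof (cases "bval push_test s'")
    case True
    have "surely (run (push_start ;; push_column) (spend 1 s'))
      (\<lambda>s'. push_inv T s' \<and> clock s < clock s')"
    proof (rule ensures_mono[OF push_start_column_spec])
      fix s'' assume "pushed s' s''"
      then show "push_inv T s'' \<and> clock s < clock s''"
        using s' True push_inv_if_pushed[of T s' s''] by (simp add: pushed_def Let_def)
    qed (use s' in auto)
    then show ?thesis using True by simp
  next
    case False
    then show ?thesis
      using s' skip_spec by simp
  qed
qed

lemma push_loop_spec: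
  assumes "push_inv T s"
  shows "surely (run push_loop s)
    (\<lambda>s'. push_base s' \<and> value_kept s' \<and> above_threshold s' = {} \<and> clock s' \<le> T + 1)"
    (is "surely _ ?done")
  unfolding push_loop_def
proof (rule surely_While[where I = "push_inv T" and T = T])
  fix s' assume "push_inv T s'" "\<not> bval (INat 0 <\<^sub>n IReg height_reg) s'"
  then show "?done (spend 1 s')"
    by (auto simp: push_inv_def within_budget_def stack_def)
qed (use assms push_step_spec in \<open>auto simp: push_inv_def within_budget_def\<close>)

end

section \<open>Correctness and cost of the sampling phase\<close>

subsection \<open>Proof rules for the sampling commands\<close>

lemma (in rdd_matrix) pmf_walk_step:
  assumes "j < n"
  shows "pmf (walk_step M j) (Some k) = (if k < n then \<bar>W j k\<bar> else 0)"
proof -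
  let ?f = "\<lambda>k. if k < n then \<bar>W j k\<bar> else 0"
  have "1/2 * ((if k = j then 1 else 0) + \<bar>AT M $$ (j,k)\<bar> / M $$ (j,j)) = \<bar>W j k\<bar>" if "k < n" for k
    using that assms diag_pos[OF assms] by (simp add: AT_def diag_part_def walk_mat_def dims abs_mult)
  then have walk_step: "walk_step M j = embed_spmf ?f"
    unfolding walk_step_def by (intro arg_cong[of _ _ embed_spmf] ext) (simp add: dims)
  have "(\<integral>\<^sup>+ k. ennreal (?f k) \<partial>count_space UNIV) = (\<Sum>k<n. ennreal (?f k))"
    by (rule nn_integral_count_space') auto
  also have "\<dots> \<le> 1"
    using substochastic_W assms by (simp add: substochastic_def)
  finally show ?thesis
    unfolding walk_step by (simp add: spmf_embed_spmf)
qed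

lemma (in rdd_problem) pmf_sample_abs: "pmf (sample_abs t) j = (if j < n then \<bar>t $ j\<bar> / \<tau> else 0)"
proof -
  let ?f = "\<lambda>j. if j < n then \<bar>t $ j\<bar> / \<tau> else 0"
  have sample_abs: "sample_abs t = embed_pmf ?f"
    using t unfolding sample_abs_def pnorm_1_t by simp
  have "(\<integral>\<^sup>+ j. ennreal (?f j) \<partial>count_space UNIV) = (\<Sum>j<n. ennreal (?f j))"
    by (rule nn_integral_count_space') auto
  also have "\<dots> = ennreal (\<Sum>j<n. ?f j)"
    using \<tau>_pos by (intro sum_ennreal) auto
  also have "(\<Sum>j<n. ?f j) = 1"
    using \<tau>_pos by (simp add: sum_divide_distrib[symmetric])
  finally show ?thesis
    unfolding sample_abs using \<tau>_pos by (subst pmf_embed_pmf) auto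
qed

context rdd_instance
begin

lemma ensures_SampleT:
  assumes "\<And>k. k < n \<Longrightarrow> Q (spend 1 (set_ireg x k s))"
    and "(\<Sum>k<n. \<bar>t $ k\<bar> / \<tau> * f (spend 1 (set_ireg x k s))) \<le> v"
  shows "ensures (run (SampleT x) s) Q f v"
proof -
  have "ensures (run (SampleT x) s) Q f
      (\<Sum>k<n. pmf (sample_abs t) k * f (spend 1 (set_ireg x k s)))"
    unfolding exec.simps
    by (rule ensures_map_pmf) (use assms(1) in \<open>auto simp: set_pmf_eq pmf_sample_abs split: if_splits\<close>)
  then show ?thesis
    by (rule ensures_mono) (use assms(2) in \<open>auto simp: pmf_sample_abs\<close>)
qed

lemma ensures_Uniform_below_L:
  assumes "inputs_kept s" "\<And>k. k < L \<Longrightarrow> Q (spend 1 (set_ireg x k s))"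
    and "(\<Sum>k<L. f (spend 1 (set_ireg x k s))) / real L \<le> v"
  shows "ensures (run (Uniform x (IReg L_reg -\<^sub>n INat 1)) s) Q f v"
proof -
  have ival: "ival (IReg L_reg -\<^sub>n INat 1) s = L - 1"
    using assms(1) by (simp add: inputs_kept_def)
  have range: "{..L - 1} = {..<L}" "Suc (L - 1) = L"
    using L_pos by auto
  show ?thesis
    by (rule ensures_mono[OF
      ensures_Uniform[of M b t acc x "IReg L_reg -\<^sub>n INat 1" s f, unfolded ival range]])
      (use assms L_pos in auto)
qed

lemma ensures_Step:
  fixes j x y :: nat and s :: state
  defines "moved k \<equiv> spend (step_time acc j) (set_ireg x k (set_rreg y (M $$ (j,k)) s))"
    and "stopped \<equiv> spend (step_time acc j) (set_ireg x n (set_rreg y 0 s))"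
  assumes j: "ival e s = j" "j < n"
    and Q: "\<And>k. k < n \<Longrightarrow> Q (moved k)" "Q stopped"
    and v: "f stopped = 0" "(\<Sum>k<n. \<bar>W j k\<bar> * f (moved k)) \<le> v"
  shows "ensures (run (Step x y e) s) Q f v"
proof -
  let ?A = "insert None (Some ` {..<n})" and ?s = "\<lambda>r. case r of None \<Rightarrow> stopped | Some k \<Rightarrow> moved k"
  have exec: "run (Step x y e) s = map_spmf ?s (spmf_of_pmf (walk_step M j))"
    unfolding exec.simps Let_def j(1) dims
    by (intro map_spmf_cong) (auto simp: moved_def stopped_def split: option.split)
  have "ensures (run (Step x y e) s) Q f (\<Sum>r\<in>?A. pmf (walk_step M j) r * f (?s r))"
    unfolding exec
  proof (rule ensures_map_pmf)
    show "set_pmf (walk_step M j) \<subseteq> ?A"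
    proof
      fix r assume "r \<in> set_pmf (walk_step M j)"
      then show "r \<in> ?A"
        using pmf_walk_step[OF j(2)] by (cases r) (auto simp: set_pmf_eq split: if_splits)
    qed
  qed (use Q in auto)
  moreover have "(\<Sum>r\<in>?A. pmf (walk_step M j) r * f (?s r)) = (\<Sum>k<n. \<bar>W j k\<bar> * f (moved k))"
    by (subst sum.insert) (auto simp: v(1) sum.reindex pmf_walk_step[OF j(2)])
  ultimately show ?thesis
    using v(2) by (auto elim: ensures_mono)
qed

subsection \<open>A signed random walk\<close>

definition sample_frame :: "state \<Rightarrow> state \<Rightarrow> bool" where
  "sample_frame s\<^sub>0 s \<longleftrightarrow> inputs_kept s \<and> rarr s residual_arr = rarr s\<^sub>0 residual_arr \<and>
     rreg s exact_reg = rreg s\<^sub>0 exact_reg \<and> rreg s required_reg = rreg s\<^sub>0 required_reg"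

definition walking :: "state \<Rightarrow> state \<Rightarrow> bool" where
  "walking s\<^sub>0 s \<longleftrightarrow> sample_frame s\<^sub>0 s \<and> rreg s total_reg = rreg s\<^sub>0 total_reg \<and>
     ireg s samples_reg = ireg s\<^sub>0 samples_reg \<and>
     \<bar>rreg s sign_reg\<bar> \<le> 1 \<and> (ireg s position_reg < n \<or> rreg s sign_reg = 0)"

definition walk_value :: "state \<Rightarrow> nat \<Rightarrow> nat \<Rightarrow> real" where
  "walk_value s j l = rreg s sign_reg * (mat_app n W ^^ j) (rarr s residual_arr l) (ireg s position_reg)"

lemma sampling_spend_simps [simp]:
  "sample_frame s\<^sub>0 (spend k s) = sample_frame s\<^sub>0 s" "walking s\<^sub>0 (spend k s) = walking s\<^sub>0 s"
  "walk_value (spend k s) j l = walk_value s j l"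
  by (simp_all add: sample_frame_def walking_def walk_value_def)

abbreviation end_value :: "state \<Rightarrow> real" where
  "end_value s \<equiv> walk_value s (ireg s steps_reg) (ireg s start_level_reg)"

definition next_sign :: "state \<Rightarrow> real" where
  "next_sign s = (if n \<le> ireg s next_reg then 0
     else if ireg s next_reg \<noteq> ireg s position_reg \<and> 0 < rreg s entry_reg then - rreg s sign_reg
     else rreg s sign_reg)"

lemma move_exec:
  assumes "inputs_kept s"
  shows "surely (run (update_sign ;; position_reg :=\<^sub>n IReg next_reg) s) (\<lambda>s'.
    ireg s' = (ireg s)(position_reg := ireg s next_reg) \<and> rreg s' = (rreg s)(sign_reg := next_sign s) \<and>
    rarr s' = rarr s \<and> clock s < clock s' \<and> clock s' \<le> clock s + 5)"
  using assms by (auto simp: update_sign_def next_sign_def inputs_kept_def)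

lemma abs_W_mult_next_sign:
  assumes "j < n" "k < n" "ireg s next_reg = k" "ireg s position_reg = j" "rreg s entry_reg = M $$ (j,k)"
  shows "\<bar>W j k\<bar> * next_sign s = rreg s sign_reg * W j k"
  using assms diag_pos[of j]
  by (auto simp: walk_mat_def next_sign_def dims abs_mult abs_if zero_less_divide_iff zero_less_mult_iff)

definition next_value :: "state \<Rightarrow> real" where
  "next_value s = next_sign s *
     (mat_app n W ^^ ireg s steps_reg) (rarr s residual_arr (ireg s start_level_reg)) (ireg s next_reg)"

lemma step_spec:
  assumes s: "walking s\<^sub>0 s" and position: "ireg s position_reg < n"
  shows "ensures (run (Step next_reg entry_reg (IReg position_reg)) s)
    (\<lambda>s'. walking s\<^sub>0 s' \<and> ireg s' start_level_reg = ireg s start_level_reg \<and>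
      ireg s' steps_reg = ireg s steps_reg \<and>
       clock s \<le> clock s' \<and> clock s' \<le> clock s + f\<^sub>r)
    (\<lambda>s'. c * next_value s') (c * walk_value s (Suc (ireg s steps_reg)) (ireg s start_level_reg))"
proof -
  define X where "X = ireg s position_reg"
  have X: "X < n"
    using position by (simp add: X_def)
  define v where "v = (mat_app n W ^^ ireg s steps_reg) (rarr s residual_arr (ireg s start_level_reg))"
  let ?moved = "\<lambda>k. spend (step_time acc X) (set_ireg next_reg k (set_rreg entry_reg (M $$ (X,k)) s))"
  let ?stopped = "spend (step_time acc X) (set_ireg next_reg n (set_rreg entry_reg 0 s))"
  show ?thesis
  proof (rule ensures_Step[where j = X])
    have summand: "\<bar>W X k\<bar> * (c * next_value (?moved k)) = c * (rreg s sign_reg * (W X k * v k))"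
      if "k < n" for k
    proof -
      have "\<bar>W X k\<bar> * next_sign (?moved k) = rreg s sign_reg * W X k"
        using abs_W_mult_next_sign[OF X that, of "?moved k"] by (simp add: X_def)
      then show ?thesis
        by (simp add: next_value_def v_def mult.assoc[symmetric] mult.commute[of c])
    qed
    have "(\<Sum>k<n. \<bar>W X k\<bar> * (c * next_value (?moved k))) = (\<Sum>k<n. c * (rreg s sign_reg * (W X k * v k)))"
      by (rule sum.cong) (use summand in auto)
    also have "\<dots> = c * walk_value s (Suc (ireg s steps_reg)) (ireg s start_level_reg)"
      by (simp add: walk_value_def mat_app_def sum_distrib_left X_def v_def)
    finally show "(\<Sum>k<n. \<bar>W X k\<bar> * (c * next_value (?moved k)))
        \<le> c * walk_value s (Suc (ireg s steps_reg)) (ireg s start_level_reg)" by simp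
    show "c * next_value ?stopped = 0"
      by (simp add: next_value_def next_sign_def)
  qed (use X s step_time_le[OF X] in \<open>simp_all add: X_def walking_def sample_frame_def inputs_kept_def\<close>)
qed

lemma move_spec:
  assumes s: "walking s\<^sub>0 s"
  shows "ensures (run (update_sign ;; position_reg :=\<^sub>n IReg next_reg) s)
    (\<lambda>s'. walking s\<^sub>0 s' \<and> ireg s' start_level_reg = ireg s start_level_reg \<and>
      ireg s' steps_reg = ireg s steps_reg \<and> clock s < clock s' \<and> clock s' \<le> clock s + 5)
    (\<lambda>s'. c * end_value s') (c * next_value s)"
    (is "ensures _ ?kept _ _")
proof (rule ensures_if_surely[OF move_exec])
  show "inputs_kept s"
    using s by (simp add: walking_def sample_frame_def)
  fix s' :: state
  assume s': "ireg s' = (ireg s)(position_reg := ireg s next_reg) \<and>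
    rreg s' = (rreg s)(sign_reg := next_sign s) \<and> rarr s' = rarr s \<and> clock s < clock s' \<and>
    clock s' \<le> clock s + 5"
  then show "?kept s'"
    using s by (simp add: walking_def sample_frame_def inputs_kept_def next_sign_def)
  have "end_value s' = next_value s"
    using s' by (simp add: walk_value_def next_value_def)
  then show "c * end_value s' \<le> c * next_value s" by simp
qed

lemma walk_body_spec:
  assumes s: "walking s\<^sub>0 s" and guard: "0 < ireg s steps_reg" "ireg s position_reg < n"
  shows "ensures (run walk_body (spend 1 s))
    (\<lambda>s'. walking s\<^sub>0 s' \<and> ireg s' start_level_reg = ireg s start_level_reg \<and>
       Suc (ireg s' steps_reg) = ireg s steps_reg \<and> clock s < clock s' \<and> clock s' \<le> clock s + 10 + f\<^sub>r)
    (\<lambda>s'. c * end_value s') (c * end_value s)"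
    (is "ensures _ ?moved ?v _")
proof -
  define s\<^sub>1 where "s\<^sub>1 = spend 1 (set_ireg steps_reg (ireg s steps_reg - 1) (spend 1 s))"
  have walking: "walking s\<^sub>0 s\<^sub>1" and position: "ireg s\<^sub>1 position_reg < n"
    using s guard by (simp_all add: s\<^sub>1_def walking_def sample_frame_def inputs_kept_def)
  have "walk_value s\<^sub>1 (Suc (ireg s\<^sub>1 steps_reg)) (ireg s\<^sub>1 start_level_reg) = end_value s"
    using guard by (simp add: s\<^sub>1_def walk_value_def)
  note step = step_spec[OF walking position, of c, unfolded this]
  have "run walk_body (spend 1 s) =
      run (Step next_reg entry_reg (IReg position_reg) ;;
        (update_sign ;; position_reg :=\<^sub>n IReg next_reg)) s\<^sub>1"
    by (simp add: walk_body_def s\<^sub>1_def)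
  moreover have "ensures \<dots> ?moved ?v (c * end_value s)"
    by (rule ensures_Seq[OF step], rule ensures_mono[OF move_spec[where s\<^sub>0 = s\<^sub>0]])
      (use guard in \<open>auto simp: s\<^sub>1_def\<close>)
  ultimately show ?thesis by simp
qed

lemma walk_spec:
  assumes "walking s\<^sub>0 s"
  shows "ensures (run walk s)
    (\<lambda>s'. walking s\<^sub>0 s' \<and> ireg s' start_level_reg = ireg s start_level_reg \<and>
       clock s \<le> clock s' \<and> clock s' \<le> clock s + 1 + ireg s steps_reg * (10 + f\<^sub>r))
    (\<lambda>s'. c * walk_value s' 0 (ireg s' start_level_reg)) (c * end_value s)"
    (is "ensures _ ?walked ?v _")
proof -
  define I where "I s' \<longleftrightarrow> walking s\<^sub>0 s' \<and> ireg s' start_level_reg = ireg s start_level_reg \<and>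
    clock s \<le> clock s' \<and>
    clock s' + ireg s' steps_reg * (10 + f\<^sub>r) \<le> clock s + ireg s steps_reg * (10 + f\<^sub>r)" for s'
  let ?guard = "BAnd (INat 0 <\<^sub>n IReg steps_reg) (IReg position_reg <\<^sub>n IReg n_reg)"
  have bval_guard: "bval ?guard s' \<longleftrightarrow> 0 < ireg s' steps_reg \<and> ireg s' position_reg < n" if "I s'" for s'
    using that by (simp add: I_def walking_def sample_frame_def inputs_kept_def)
  show ?thesis
    unfolding walk_def
  proof (rule ensures_While[where I = I and T = "clock s + ireg s steps_reg * (10 + f\<^sub>r)"
        and f = "\<lambda>s'. c * end_value s'"])
    fix s' assume s': "I s'" "bval ?guard s'"
    show "ensures (run walk_body (spend 1 s')) (\<lambda>s''. I s'' \<and> clock s' < clock s'')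
        (\<lambda>s''. c * end_value s'') (c * end_value s')"
    proof (rule ensures_mono[OF walk_body_spec[where s\<^sub>0 = s\<^sub>0]])
      fix s'' assume s'': "walking s\<^sub>0 s'' \<and> ireg s'' start_level_reg = ireg s' start_level_reg \<and>
        Suc (ireg s'' steps_reg) = ireg s' steps_reg \<and> clock s' < clock s'' \<and>
        clock s'' \<le> clock s' + 10 + f\<^sub>r"
      then have "ireg s' steps_reg * (10 + f\<^sub>r) = 10 + f\<^sub>r + ireg s'' steps_reg * (10 + f\<^sub>r)"
        by (metis mult_Suc)
      then show "I s'' \<and> clock s' < clock s''"
        using s'(1) s'' by (simp add: I_def)
    qed (use s' bval_guard in \<open>auto simp: I_def\<close>)
  next
    fix s' assume s': "I s'" "\<not> bval ?guard s'"
    then have "\<not> (0 < ireg s' steps_reg \<and> ireg s' position_reg < n)"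
      using bval_guard by blast
    moreover have "ireg s' position_reg < n \<or> rreg s' sign_reg = 0"
      using s'(1) by (simp add: I_def walking_def)
    ultimately have "ireg s' steps_reg = 0 \<or> rreg s' sign_reg = 0"
      by auto
    then have "end_value s' = walk_value s' 0 (ireg s' start_level_reg)"
      by (auto simp: walk_value_def)
    then show "?walked (spend 1 s') \<and> ?v (spend 1 s') \<le> c * end_value s'"
      using s'(1) by (simp add: I_def)
  qed (use assms in \<open>auto simp: I_def\<close>)
qed

end

context rdd_problem
begin

definition sample_cost :: nat where
  "sample_cost = 30 + L * (10 + f\<^sub>r)"

definition ratio :: real where
  "ratio = \<tau> * (real L)\<^sup>2 / (real h * \<epsilon>)"

definition sampling_cost :: nat where
  "sampling_cost = 10 + (if 1 < ratio then nat \<lceil>4 * ratio\<^sup>2\<rceil> * sample_cost else 0)"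

definition run_time :: "nat \<Rightarrow> nat" where
  "run_time w = (if \<epsilon> < real L * \<tau> then 20 + 2 * h + push_time w + sampling_cost else 2)"

end

context rdd_instance
begin

subsection \<open>A single sample\<close>

definition sampled :: "state \<Rightarrow> state \<Rightarrow> bool" where
  "sampled s\<^sub>0 s \<longleftrightarrow> sample_frame s\<^sub>0 s \<and> ireg s samples_reg = Suc (ireg s\<^sub>0 samples_reg) \<and>
     \<bar>rreg s total_reg - rreg s\<^sub>0 total_reg\<bar> \<le> \<theta> \<and> clock s\<^sub>0 < clock s \<and> clock s < clock s\<^sub>0 + sample_cost"

definition drawing :: "state \<Rightarrow> state \<Rightarrow> bool" where
  "drawing s\<^sub>0 s \<longleftrightarrow> walking s\<^sub>0 s \<and> ireg s position_reg < n \<and> clock s\<^sub>0 < clock s \<and> clock s \<le> clock s\<^sub>0 + 6"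

definition sample_value :: "state \<Rightarrow> nat \<Rightarrow> nat \<Rightarrow> real" where
  "sample_value s j l = (if j + l < L then walk_value s j l else 0)"

lemma sample_value_simps [simp]:
  "sample_value (spend k s) = sample_value s"
  "x \<noteq> position_reg \<Longrightarrow> sample_value (set_ireg x j s) = sample_value s"
  by (simp_all add: fun_eq_iff sample_value_def walk_value_def)

abbreviation sample_mean :: "state \<Rightarrow> real" where
  "sample_mean s \<equiv> residual_sum n W (($) t) L (rarr s residual_arr) / (\<tau> * (real L)\<^sup>2)"

lemma record_sample_spec:
  assumes s: "walking s\<^sub>0 s" "ireg s start_level_reg < L" and small: "above_threshold s\<^sub>0 = {}"
    and time: "clock s\<^sub>0 < clock s" "clock s + 3 \<le> clock s\<^sub>0 + sample_cost"
  shows "ensures (run record_sample s) (sampled s\<^sub>0) (\<lambda>s'. c * (rreg s' total_reg - rreg s\<^sub>0 total_reg))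
     (c * walk_value s 0 (ireg s start_level_reg))"
proof -
  let ?Y = "walk_value s 0 (ireg s start_level_reg)"
  have residual: "rarr s residual_arr = rarr s\<^sub>0 residual_arr"
    using s by (simp add: walking_def sample_frame_def)
  have "\<bar>?Y\<bar> \<le> \<theta>"
  proof (cases "rreg s sign_reg = 0")
    case False
    then have "\<bar>rreg s sign_reg\<bar> \<le> 1" "ireg s position_reg < n"
      using s by (auto simp: walking_def)
    moreover from this have "\<bar>rarr s residual_arr (ireg s start_level_reg) (ireg s position_reg)\<bar> \<le> \<theta>"
      using small s(2) by (force simp: above_threshold_def residual)
    ultimately have "\<bar>?Y\<bar> \<le> 1 * \<theta>"
      unfolding walk_value_def abs_mult by (intro mult_mono) auto
    then show ?thesis by simp
  qed (use \<theta>_pos in \<open>simp add: walk_value_def\<close>)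
  then show ?thesis
    using s time by (simp add: record_sample_def sampled_def walking_def sample_frame_def
      inputs_kept_def walk_value_def)
qed

lemma walk_from_level_spec:
  assumes s: "drawing s\<^sub>0 s" "ireg s steps_reg < L" "ireg s start_level_reg < L"
    and small: "above_threshold s\<^sub>0 = {}"
  shows "ensures (run (discard_long_walk ;; walk ;; record_sample) s) (sampled s\<^sub>0)
     (\<lambda>s'. c * (rreg s' total_reg - rreg s\<^sub>0 total_reg))
     (c * sample_value s (ireg s steps_reg) (ireg s start_level_reg))"
    (is "ensures _ _ ?gain ?v")
proof (rule ensures_Seq_surely)
  let ?sign = "if ireg s steps_reg + ireg s start_level_reg < L then rreg s sign_reg else 0"
  let ?discarded = "\<lambda>s' :: state. ireg s' = ireg s \<and> rreg s' = (rreg s)(sign_reg := ?sign) \<and>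
    rarr s' = rarr s \<and>
    clock s < clock s' \<and> clock s' \<le> clock s + 2"
  show "surely (run discard_long_walk s) ?discarded"
    using s by (simp add: discard_long_walk_def drawing_def walking_def sample_frame_def inputs_kept_def)
  fix s\<^sub>1 assume s\<^sub>1: "?discarded s\<^sub>1"
  have walking: "walking s\<^sub>0 s\<^sub>1"
    using s s\<^sub>1 by (simp add: drawing_def walking_def sample_frame_def inputs_kept_def)
  have end_value: "end_value s\<^sub>1 = sample_value s (ireg s steps_reg) (ireg s start_level_reg)"
    using s\<^sub>1 by (simp add: walk_value_def sample_value_def)
  show "ensures (run (walk ;; record_sample) s\<^sub>1) (sampled s\<^sub>0) ?gain ?v"
    unfolding end_value[symmetric]
  proof (rule ensures_Seq[OF walk_spec[OF walking]])
    fix s\<^sub>2 assume s\<^sub>2: "walking s\<^sub>0 s\<^sub>2 \<and> ireg s\<^sub>2 start_level_reg = ireg s\<^sub>1 start_level_reg \<and>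
      clock s\<^sub>1 \<le> clock s\<^sub>2 \<and> clock s\<^sub>2 \<le> clock s\<^sub>1 + 1 + ireg s\<^sub>1 steps_reg * (10 + f\<^sub>r)"
    then have "clock s\<^sub>2 \<le> clock s\<^sub>1 + 1 + ireg s steps_reg * (10 + f\<^sub>r)"
      using s\<^sub>1 by simp
    also have "\<dots> \<le> clock s\<^sub>1 + 1 + L * (10 + f\<^sub>r)"
      using s(2) by (intro add_mono mult_right_mono) auto
    finally have "clock s\<^sub>0 < clock s\<^sub>2" "clock s\<^sub>2 + 3 \<le> clock s\<^sub>0 + sample_cost"
      using s(1) s\<^sub>1 s\<^sub>2 by (auto simp: drawing_def sample_cost_def)
    then show "ensures (run record_sample s\<^sub>2) (sampled s\<^sub>0) ?gain
      (c * walk_value s\<^sub>2 0 (ireg s\<^sub>2 start_level_reg))"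
      using s s\<^sub>1 s\<^sub>2 small by (intro record_sample_spec) auto
  qed
qed

lemma draw_walk_spec:
  assumes s: "drawing s\<^sub>0 s" "clock s \<le> clock s\<^sub>0 + 4" and small: "above_threshold s\<^sub>0 = {}"
  shows "ensures (run draw_walk s) (sampled s\<^sub>0)
     (\<lambda>s'. c * (rreg s' total_reg - rreg s\<^sub>0 total_reg))
     (c * ((\<Sum>j<L. \<Sum>l<L. sample_value s j l) / (real L)\<^sup>2))"
    (is "ensures _ _ ?gain ?v")
  unfolding draw_walk_def
proof (rule ensures_Seq)
  let ?drawn_steps = "\<lambda>s\<^sub>1. drawing s\<^sub>0 s\<^sub>1 \<and> ireg s\<^sub>1 steps_reg < L \<and> clock s\<^sub>1 \<le> clock s\<^sub>0 + 5"
  let ?level_mean = "\<lambda>s\<^sub>1. c * (\<Sum>l<L. sample_value s\<^sub>1 (ireg s\<^sub>1 steps_reg) l) / real L"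
  show "ensures (run (Uniform steps_reg (IReg L_reg -\<^sub>n INat 1)) s) ?drawn_steps ?level_mean ?v"
  proof (rule ensures_Uniform_below_L)
    show "(\<Sum>j<L. ?level_mean (spend 1 (set_ireg steps_reg j s))) / real L \<le> ?v"
      by (simp add: sum_divide_distrib[symmetric] sum_distrib_left[symmetric] power2_eq_square)
  qed (use s in \<open>simp_all add: drawing_def walking_def sample_frame_def inputs_kept_def\<close>)
  fix s\<^sub>1 assume s\<^sub>1: "?drawn_steps s\<^sub>1"
  show "ensures (run (Uniform start_level_reg (IReg L_reg -\<^sub>n INat 1) ;; discard_long_walk ;;
    walk ;; record_sample) s\<^sub>1)
     (sampled s\<^sub>0) ?gain (?level_mean s\<^sub>1)"
  proof (rule ensures_Seq)
    let ?level_value = "\<lambda>s\<^sub>2. c * sample_value s\<^sub>2 (ireg s\<^sub>2 steps_reg) (ireg s\<^sub>2 start_level_reg)"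
    let ?drawn = "\<lambda>s\<^sub>2. drawing s\<^sub>0 s\<^sub>2 \<and> ireg s\<^sub>2 steps_reg < L \<and> ireg s\<^sub>2 start_level_reg < L"
    show "ensures (run (Uniform start_level_reg (IReg L_reg -\<^sub>n INat 1)) s\<^sub>1)
      ?drawn ?level_value (?level_mean s\<^sub>1)"
    proof (rule ensures_Uniform_below_L)
      show "(\<Sum>l<L. ?level_value (spend 1 (set_ireg start_level_reg l s\<^sub>1))) / real L \<le> ?level_mean s\<^sub>1"
        by (simp add: sum_distrib_left)
    qed (use s\<^sub>1 in \<open>simp_all add: drawing_def walking_def sample_frame_def inputs_kept_def\<close>)
    show "ensures (run (discard_long_walk ;; walk ;; record_sample) s\<^sub>2) (sampled s\<^sub>0)
      ?gain (?level_value s\<^sub>2)"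
      if "?drawn s\<^sub>2" for s\<^sub>2
      using that small by (intro walk_from_level_spec) auto
  qed
qed

definition start_value :: "state \<Rightarrow> nat \<Rightarrow> real" where
  "start_value s X = (if 0 < t $ X then 1 else - 1) *
     (\<Sum>j<L. \<Sum>l<L. if j + l < L then (mat_app n W ^^ j) (rarr s residual_arr l) X else 0)"

lemma sum_start_value:
  "(\<Sum>X<n. \<bar>t $ X\<bar> * start_value s X) = residual_sum n W (($) t) L (rarr s residual_arr)"
proof -
  let ?v = "\<lambda>X j l. t $ X * (if j + l < L then (mat_app n W ^^ j) (rarr s residual_arr l) X else 0)"
  have "\<bar>t $ X\<bar> * start_value s X = (\<Sum>j<L. \<Sum>l<L. ?v X j l)" for X
    unfolding sum_distrib_left[symmetric] by (simp add: start_value_def)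
  then have "(\<Sum>X<n. \<bar>t $ X\<bar> * start_value s X) = (\<Sum>X<n. \<Sum>j<L. \<Sum>l<L. ?v X j l)"
    by simp
  also have "\<dots> = (\<Sum>j<L. \<Sum>X<n. \<Sum>l<L. ?v X j l)"
    by (rule sum.swap)
  also have "\<dots> = (\<Sum>j<L. \<Sum>l<L. \<Sum>X<n. ?v X j l)"
    by (rule sum.cong[OF refl], rule sum.swap)
  also have "\<dots> = (\<Sum>l<L. \<Sum>j<L. \<Sum>X<n. ?v X j l)"
    by (rule sum.swap)
  also have "\<dots> = residual_sum n W (($) t) L (rarr s residual_arr)"
    unfolding residual_sum_eq by (intro sum.cong refl) auto
  finally show ?thesis .
qed

lemma sample_from_spec:
  assumes s: "inputs_kept s" "above_threshold s = {}" and X: "X < n"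
  shows "ensures (run (draw_sign ;; draw_walk) (spend 1 (set_ireg position_reg X s))) (sampled s)
     (\<lambda>s'. c * (rreg s' total_reg - rreg s total_reg)) (c * (start_value s X / (real L)\<^sup>2))"
proof (rule ensures_Seq_surely)
  let ?sign = "if 0 < t $ X then 1 else - 1 :: real"
  let ?signed = "\<lambda>s' :: state. ireg s' = (ireg s)(position_reg := X) \<and>
    rreg s' = (rreg s)(t_start_reg := t $ X, sign_reg := ?sign) \<and> rarr s' = rarr s \<and>
    clock s' = clock s + 4"
  show "surely (run draw_sign (spend 1 (set_ireg position_reg X s))) ?signed"
    by (simp add: draw_sign_def)
  fix s' assume s': "?signed s'"
  have "drawing s s'"
    using s s' X by (simp add: drawing_def walking_def sample_frame_def inputs_kept_def)
  moreover have "start_value s X = (\<Sum>j<L. \<Sum>l<L. sample_value s' j l)"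
    using s' unfolding start_value_def sum_distrib_left
    by (intro sum.cong refl) (simp add: sample_value_def walk_value_def)
  ultimately show "ensures (run draw_walk s') (sampled s)
     (\<lambda>s'. c * (rreg s' total_reg - rreg s total_reg)) (c * (start_value s X / (real L)\<^sup>2))"
    using s s' by (simp only:) (rule draw_walk_spec, simp_all)
qed

lemma sample_body_spec:
  assumes s: "inputs_kept s" "above_threshold s = {}"
  shows "ensures (run sample_body s) (sampled s) (\<lambda>s'. c * (rreg s' total_reg - rreg s total_reg))
     (c * sample_mean s)"
  unfolding sample_body_def
proof (rule ensures_Seq)
  let ?drawn = "\<lambda>s\<^sub>1. \<exists>X<n. s\<^sub>1 = spend 1 (set_ireg position_reg X s)"
  let ?v = "\<lambda>s\<^sub>1. c * (start_value s (ireg s\<^sub>1 position_reg) / (real L)\<^sup>2)"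
  show "ensures (run (SampleT position_reg) s) ?drawn ?v (c * sample_mean s)"
  proof (rule ensures_SampleT)
    have "(\<Sum>X<n. \<bar>t $ X\<bar> / \<tau> * ?v (spend 1 (set_ireg position_reg X s)))
        = (\<Sum>X<n. c * (\<bar>t $ X\<bar> * start_value s X) / (\<tau> * (real L)\<^sup>2))"
      by (rule sum.cong) auto
    also have "\<dots> = c * sample_mean s"
      by (simp add: sum_start_value[symmetric] sum_distrib_left sum_divide_distrib)
    finally show
      "(\<Sum>X<n. \<bar>t $ X\<bar> / \<tau> * ?v (spend 1 (set_ireg position_reg X s))) \<le> c * sample_mean s" by simp
  qed auto
  show "ensures (run (draw_sign ;; draw_walk) s\<^sub>1) (sampled s)
      (\<lambda>s'. c * (rreg s' total_reg - rreg s total_reg)) (?v s\<^sub>1)" if "?drawn s\<^sub>1" for s\<^sub>1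
    using that sample_from_spec[OF s] by auto
qed

subsection \<open>The mean of the samples\<close>

text \<open>For \<open>i\<close> samples with sum \<open>S\<close>, mean \<open>\<mu>\<close> and absolute values at most \<open>\<theta>\<close>, the process
  \<open>(S - i \<mu>)\<^sup>2 - i \<theta>\<^sup>2\<close> is a supermartingale.\<close>

definition spread_bound :: "nat \<Rightarrow> real \<Rightarrow> state \<Rightarrow> real" where
  "spread_bound N \<mu> s = (rreg s total_reg - real (ireg s samples_reg) * \<mu>)\<^sup>2 +
     (real N - real (ireg s samples_reg)) * \<theta>\<^sup>2"

lemma sample_body_spread_bound:
  assumes s: "inputs_kept s" "above_threshold s = {}"
  shows "ensures (run sample_body s) (sampled s) (spread_bound N (sample_mean s))
    (spread_bound N (sample_mean s) s)"
proof -
  define i where "i = real (ireg s samples_reg)"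
  define \<mu> where "\<mu> = sample_mean s"
  define D where "D = rreg s total_reg - i * \<mu>"
  show ?thesis
    unfolding \<mu>_def[symmetric]
  proof (rule ensures_affine[OF sample_body_spec[OF s, of "2 * (D - \<mu>)"],
        where a = 1 and b = "(D - \<mu>)\<^sup>2 + (real N - i) * \<theta>\<^sup>2"])
    fix s' assume s': "sampled s s'"
    define Y where "Y = rreg s' total_reg - rreg s total_reg"
    have "Y\<^sup>2 \<le> \<theta>\<^sup>2"
      using s' \<theta>_pos by (simp add: sampled_def Y_def abs_le_square_iff[symmetric])
    have "rreg s' total_reg - real (ireg s' samples_reg) * \<mu> = D - \<mu> + Y"
      using s' by (simp add: sampled_def D_def Y_def i_def algebra_simps)
    then have "spread_bound N \<mu> s' = (D - \<mu> + Y)\<^sup>2 + (real N - i - 1) * \<theta>\<^sup>2"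
      using s' by (simp add: spread_bound_def sampled_def i_def)
    also have "\<dots> \<le> 2 * (D - \<mu>) * Y + ((D - \<mu>)\<^sup>2 + (real N - i) * \<theta>\<^sup>2)"
      using \<open>Y\<^sup>2 \<le> \<theta>\<^sup>2\<close> by (simp add: power2_eq_square algebra_simps)
    finally show "spread_bound N \<mu> s' \<le>
        1 * (2 * (D - \<mu>) * (rreg s' total_reg - rreg s total_reg)) + ((D - \<mu>)\<^sup>2 + (real N - i) * \<theta>\<^sup>2)"
      by (simp add: Y_def)
  next
    have "2 * (D - \<mu>) * \<mu> + (D - \<mu>)\<^sup>2 = D\<^sup>2 - \<mu>\<^sup>2"
      by (simp add: power2_eq_square algebra_simps)
    then show "1 * (2 * (D - \<mu>) * sample_mean s) + ((D - \<mu>)\<^sup>2 + (real N - i) * \<theta>\<^sup>2) \<le> spread_bound N \<mu> s"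
      by (simp add: spread_bound_def \<mu>_def[symmetric] i_def[symmetric] D_def[symmetric])
  qed auto
qed

lemma sample_loop_spec:
  assumes s: "inputs_kept s" "above_threshold s = {}" "ireg s samples_reg = 0" "rreg s total_reg = 0"
  defines "N \<equiv> nat \<lceil>rreg s required_reg\<rceil>"
  shows "ensures (run sample_loop s)
    (\<lambda>s'. sample_frame s s' \<and> ireg s' samples_reg = N \<and> clock s' \<le> clock s + 1 + N * sample_cost)
    (\<lambda>s'. (rreg s' total_reg - real N * sample_mean s)\<^sup>2) (real N * \<theta>\<^sup>2)"
    (is "ensures _ ?finished ?deviation _")
proof -
  define I where "I s' \<longleftrightarrow> sample_frame s s' \<and> ireg s' samples_reg \<le> N \<and>
    clock s' + (N - ireg s' samples_reg) * sample_cost \<le> clock s + N * sample_cost" for s'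
  let ?test = "real_reg samples_reg <\<^sub>r RReg required_reg" and ?F = "spread_bound N (sample_mean s)"
  have bval_test: "bval ?test s' \<longleftrightarrow> ireg s' samples_reg < N" if "I s'" for s'
    using that unfolding I_def sample_frame_def N_def by simp linarith
  have "ensures (run (While ?test sample_body) s) ?finished ?deviation (?F s)"
  proof (rule ensures_While[where I = I and T = "clock s + N * sample_cost" and f = ?F])
    fix s' assume s': "I s'" "bval ?test s'"
    let ?s' = "spend 1 s'"
    have frame: "sample_frame s s'" and below: "ireg s' samples_reg < N"
      using s' bval_test by (auto simp: I_def)
    have "ensures (run sample_body ?s') (sampled ?s') (spread_bound N (sample_mean ?s'))
      (spread_bound N (sample_mean ?s') ?s')"
      by (rule sample_body_spread_bound)
        (use frame s in \<open>simp_all add: sample_frame_def above_threshold_def\<close>)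
    then show "ensures (run sample_body ?s') (\<lambda>s''. I s'' \<and> clock s' < clock s'') ?F (?F s')"
    proof (rule ensures_mono)
      fix s'' assume s'': "sampled ?s' s''"
      have "(N - ireg s' samples_reg) * sample_cost
        = sample_cost + (N - Suc (ireg s' samples_reg)) * sample_cost"
        using below by (metis Suc_diff_Suc mult_Suc)
      then show "I s'' \<and> clock s' < clock s''"
        using s'(1) s'' below by (simp add: I_def sampled_def sample_frame_def)
    qed (use frame in \<open>simp_all add: sample_frame_def spread_bound_def\<close>)
  next
    fix s' assume s': "I s'" "\<not> bval ?test s'"
    then have "ireg s' samples_reg = N"
      using bval_test[OF s'(1)] by (simp add: I_def)
    then show "?finished (spend 1 s') \<and> ?deviation (spend 1 s') \<le> ?F s'"
      using s'(1) by (simp add: I_def spread_bound_def)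
  qed (use s in \<open>auto simp: I_def sample_frame_def\<close>)
  then show ?thesis
    using s by (simp add: sample_loop_def spread_bound_def)
qed

subsection \<open>The estimate\<close>

definition accurate :: "state \<Rightarrow> bool" where
  "accurate s \<longleftrightarrow> \<bar>rreg s result_reg - target / 2\<bar> \<le> \<epsilon> / (2 * d)"

abbreviation failure :: "state \<Rightarrow> real" where
  "failure s \<equiv> if accurate s then 0 else 1"

lemma rval_ratio_exp: "inputs_kept s \<Longrightarrow> ireg s h_reg = h \<Longrightarrow> rval ratio_exp s = ratio"
  by (simp add: ratio_exp_def sample_weight_def ratio_def inputs_kept_def power2_eq_square)

lemma exact_part_accurate:
  assumes s: "value_kept s" "above_threshold s = {}" and ratio: "ratio \<le> 1"
  shows "\<bar>rreg s exact_reg / 2 - target / 2\<bar> \<le> \<epsilon> / (2 * d)"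
proof -
  have "\<bar>residual_sum n W (($) t) L (rarr s residual_arr)\<bar> \<le> (real L)\<^sup>2 * (\<tau> * \<theta>)"
    by (rule abs_residual_sum_le[OF substochastic_W]) (use s \<theta>_pos in \<open>force simp: above_threshold_def\<close>)+
  also have "\<dots> = ratio * (\<epsilon> / d)"
    using eps_pos by (simp add: ratio_def \<theta>_def mult_ac)
  also have "\<dots> \<le> 1 * (\<epsilon> / d)"
    using ratio eps_pos d_pos by (intro mult_right_mono) auto
  finally have "\<bar>residual_sum n W (($) t) L (rarr s residual_arr) / 2\<bar> \<le> \<epsilon> / (2 * d)"
    by simp
  moreover have
    "rreg s exact_reg / 2 - target / 2 = - (residual_sum n W (($) t) L (rarr s residual_arr) / 2)"
    using s(1) unfolding value_kept_def by (simp add: field_simps)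
  ultimately show ?thesis by (simp only: abs_minus_cancel)
qed

lemma combine_error:
  fixes S N :: real
  assumes s: "value_kept s" and N: "0 < N"
  defines "\<delta> \<equiv> \<epsilon> / (d * (\<tau> * (real L)\<^sup>2))"
  assumes error: "\<epsilon> / (2 * d) < \<bar>(rreg s exact_reg + \<tau> * (real L)\<^sup>2 * S / N) / 2 - target / 2\<bar>"
  shows "1 \<le> (S - N * sample_mean s)\<^sup>2 / (N * \<delta>)\<^sup>2"
proof -
  define K where "K = \<tau> * (real L)\<^sup>2"
  have K: "0 < K" using \<tau>_pos L_pos by (simp add: K_def)
  have \<delta>: "0 < \<delta>" "\<delta> = \<epsilon> / (d * K)"
    using eps_pos d_pos K by (simp_all add: \<delta>_def K_def)
  have "target = rreg s exact_reg + K * sample_mean s"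
    using s \<tau>_pos L_pos by (simp add: value_kept_def K_def)
  then have "(rreg s exact_reg + K * S / N) / 2 - target / 2 = K / (2 * N) * (S - N * sample_mean s)"
    using N by (simp add: field_simps)
  then have "\<epsilon> / (2 * d) < K / (2 * N) * \<bar>S - N * sample_mean s\<bar>"
    using error K N by (simp add: K_def[symmetric] abs_mult)
  then have "N * \<delta> \<le> \<bar>S - N * sample_mean s\<bar>"
    using K N d_pos by (simp add: \<delta>(2) field_simps)
  then have "(N * \<delta>)\<^sup>2 \<le> (S - N * sample_mean s)\<^sup>2"
    using N \<delta>(1) by (metis abs_le_square_iff abs_of_nonneg less_imp_le mult_pos_pos)
  then show ?thesis using N \<delta>(1) by simp
qed

lemma sample_and_combine_spec:
  assumes s: "inputs_kept s" "value_kept s" "above_threshold s = {}" "ireg s samples_reg = 0"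
      "rreg s total_reg = 0" "rreg s required_reg = 4 * ratio\<^sup>2"
  shows "ensures (run (sample_loop ;; combine) s)
    (\<lambda>s'. clock s' \<le> clock s + 2 + nat \<lceil>4 * ratio\<^sup>2\<rceil> * sample_cost) failure (1/4)"
    (is "ensures _ ?in_time _ _")
proof -
  define N where "N = nat \<lceil>rreg s required_reg\<rceil>"
  define \<delta> where "\<delta> = \<epsilon> / (d * (\<tau> * (real L)\<^sup>2))"
  have ratio: "\<theta> = \<delta> * ratio" and \<delta>: "0 < \<delta>" and ratio_pos: "0 < ratio"
    using eps_pos d_pos h_ge_1 \<tau>_pos L_pos by (simp_all add: \<theta>_def \<delta>_def ratio_def)
  have N_ge: "4 * ratio\<^sup>2 \<le> real N"
    using s by (simp add: N_def)
  then have N: "0 < real N"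
    using ratio_pos by (smt (verit) zero_less_power)
  have "real N * \<theta>\<^sup>2 / (real N * \<delta>)\<^sup>2 = ratio\<^sup>2 / real N"
    using N \<delta> by (simp add: ratio power2_eq_square field_simps)
  also have "\<dots> \<le> 1/4"
    using N N_ge by (simp add: field_simps)
  finally have variance: "real N * \<theta>\<^sup>2 / (real N * \<delta>)\<^sup>2 \<le> 1/4" .
  let ?finished = "\<lambda>s'. sample_frame s s' \<and> ireg s' samples_reg = N \<and>
    clock s' \<le> clock s + 1 + N * sample_cost"
  let ?v = "\<lambda>s'. (rreg s' total_reg - real N * sample_mean s)\<^sup>2 / (real N * \<delta>)\<^sup>2"
  have loop: "ensures (run sample_loop s) ?finished ?v (1/4)"
    by (rule ensures_affine[OF sample_loop_spec[OF s(1,3-5)], where a = "1 / (real N * \<delta>)\<^sup>2" and b = 0])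
      (use variance in \<open>auto simp: N_def\<close>)
  show ?thesis
  proof (rule ensures_Seq[OF loop])
    fix s' assume s': "?finished s'"
    define y where "y = (rreg s exact_reg + \<tau> * (real L)\<^sup>2 * rreg s' total_reg / real N) / 2"
    have "run combine s' = return_spmf (spend 1 (set_rreg result_reg y s'))"
      using s' by (simp add: combine_def sample_weight_def y_def sample_frame_def
        inputs_kept_def power2_eq_square)
    moreover have "failure (spend 1 (set_rreg result_reg y s')) \<le> ?v s'"
      using combine_error[OF s(2) N, of "rreg s' total_reg"]
      by (simp add: accurate_def y_def[symmetric] \<delta>_def not_le)
    ultimately show "ensures (run combine s') ?in_time failure (?v s')"
      using s' s by (simp add: N_def)
  qed
qed

lemma sampling_spec:
  assumes s: "push_base s" "value_kept s" "above_threshold s = {}"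
  shows "ensures (run sampling s) (\<lambda>s'. clock s' \<le> clock s + sampling_cost) failure (1/4)"
proof -
  define s\<^sub>1 where "s\<^sub>1 = spend 1 (spend 1 (set_rreg required_reg ratio s))"
  have rval: "rval ratio_exp s = ratio"
    by (rule rval_ratio_exp) (use s in \<open>simp_all add: push_base_def\<close>)
  show ?thesis
  proof (cases "1 < ratio")
    case False
    then show ?thesis
      using exact_part_accurate[OF s(2,3)]
      by (simp add: sampling_def rval accurate_def sampling_cost_def)
  next
    case True
    define s\<^sub>2 where "s\<^sub>2 = spend 1 (set_ireg samples_reg 0 (spend 1 (set_rreg total_reg 0
        (spend 1 (set_rreg required_reg (4 * ratio\<^sup>2) s\<^sub>1)))))"
    have "run sampling s = run (sample_loop ;; combine) s\<^sub>2"
      using True by (simp add: sampling_def sampling_init_def rval s\<^sub>1_def s\<^sub>2_def power2_eq_square)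
    moreover have "ensures (run (sample_loop ;; combine) s\<^sub>2)
        (\<lambda>s'. clock s' \<le> clock s\<^sub>2 + 2 + nat \<lceil>4 * ratio\<^sup>2\<rceil> * sample_cost) failure (1/4)"
      by (rule sample_and_combine_spec)
        (use s in \<open>simp_all add: s\<^sub>1_def s\<^sub>2_def push_base_def inputs_kept_def
          value_kept_def above_threshold_def\<close>)
    moreover have "clock s\<^sub>2 + 2 + nat \<lceil>4 * ratio\<^sup>2\<rceil> * sample_cost \<le> clock s + sampling_cost"
      using True by (simp add: s\<^sub>1_def s\<^sub>2_def sampling_cost_def)
    ultimately show ?thesis
      by (auto elim: ensures_mono)
  qed
qed

lemma estimator_spec:
  assumes s: "inputs_kept s" "rarr s = (\<lambda>_ _ _. 0)" "clock s = 0"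
  shows "ensures (run estimator s) (\<lambda>s'. clock s' \<le> run_time w) failure (1/4)"
proof (cases "\<epsilon> < real L * \<tau>")
  case True
  have "ensures (run (scale_search ;; push_init ;; push_loop ;; sampling) (spend 1 s))
    (\<lambda>s'. clock s' \<le> run_time w) failure (1/4)"
  proof (rule ensures_Seq_surely[OF scale_search_spec])
    fix s\<^sub>1 assume s\<^sub>1: "inputs_kept s\<^sub>1 \<and> rarr s\<^sub>1 = (\<lambda>_ _ _. 0) \<and> ireg s\<^sub>1 h_reg = h \<and>
      clock s\<^sub>1 \<le> clock (spend 1 s) + 2 * h"
    let ?T = "clock s\<^sub>1 + 16 + push_time w"
    have T: "?T + 1 + sampling_cost \<le> run_time w"
      using s\<^sub>1 s True by (simp add: run_time_def)
    show "ensures (run (push_init ;; push_loop ;; sampling) s\<^sub>1) (\<lambda>s'. clock s' \<le> run_time w)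
      failure (1/4)"
    proof (rule ensures_Seq_surely[OF push_init_spec])
      show "ensures (run (push_loop ;; sampling) s\<^sub>2) (\<lambda>s'. clock s' \<le> run_time w) failure (1/4)"
        if "push_inv ?T s\<^sub>2" for s\<^sub>2
        by (rule ensures_Seq_surely[OF push_loop_spec[OF that]])
          (rule ensures_mono[OF sampling_spec], use T in auto)
    qed (use s\<^sub>1 in auto)
  qed (use s in auto)
  then show ?thesis
    using True s by (simp add: estimator_def inputs_kept_def)
next
  case False
  have "\<bar>target\<bar> \<le> real L * (\<tau> * (1 / d))"
    by (rule abs_neumann_sum_le[OF substochastic_W]) (use d_pos in auto)
  also have "\<dots> \<le> \<epsilon> / d"
    using False d_pos by (simp add: divide_right_mono)
  finally have "\<bar>0 - target / 2\<bar> \<le> \<epsilon> / (2 * d)" by simp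
  then show ?thesis
    using False s by (simp add: estimator_def inputs_kept_def accurate_def run_time_def)
qed

end

section \<open>Norms of vectors and matrices\<close>

lemma index_mult_mat_vec_sum:
  assumes "A \<in> carrier_mat n m" "v \<in> carrier_vec m" "i < n"
  shows "(A *\<^sub>v v) $ i = (\<Sum>k<m. A $$ (i,k) * v $ k)"
  using assms by (auto simp: scalar_prod_def atLeast0LessThan intro!: sum.cong)

lemma pnorm_nonneg: "0 < dim_vec v \<Longrightarrow> 0 \<le> pnorm p v"
  by (auto simp: pnorm_def intro: order.trans[OF _ Max_ge[of _ "\<bar>v $ 0\<bar>"]])

lemma ereal_ge_1_cases:
  assumes "(1::ereal) \<le> p"
  obtains "p = \<infinity>" | r where "p = ereal r" "1 \<le> r"
  using assms by (cases p) auto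

lemma abs_le_pnorm:
  assumes "1 \<le> p" "i < dim_vec v"
  shows "\<bar>v $ i\<bar> \<le> pnorm p v"
  using assms(1)
proof (cases rule: ereal_ge_1_cases)
  case 1
  then show ?thesis using assms by (auto simp: pnorm_def)
next
  case (2 r)
  have "\<bar>v $ i\<bar> powr r \<le> (\<Sum>i<dim_vec v. \<bar>v $ i\<bar> powr r)"
    by (rule member_le_sum) (use assms in auto)
  then have "(\<bar>v $ i\<bar> powr r) powr (1/r) \<le> (\<Sum>i<dim_vec v. \<bar>v $ i\<bar> powr r) powr (1/r)"
    using 2 by (intro powr_mono2) auto
  then show ?thesis using 2 by (simp add: pnorm_def powr_powr)
qed

lemma pnorm_infinity_le:
  assumes "0 < dim_vec v" "\<And>i. i < dim_vec v \<Longrightarrow> \<bar>v $ i\<bar> \<le> m"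
  shows "pnorm \<infinity> v \<le> m"
  using assms by (auto simp: pnorm_def intro!: Max.boundedI)

lemma sum_nonzero_le_norm0:
  fixes c :: real
  assumes "\<And>i. i < dim_vec v \<Longrightarrow> v $ i \<noteq> 0 \<Longrightarrow> f i \<le> c" "\<And>i. i < dim_vec v \<Longrightarrow> v $ i = 0 \<Longrightarrow> f i = 0"
  shows "(\<Sum>i<dim_vec v. f i) \<le> real (norm0 v) * c"
proof -
  have "(\<Sum>i<dim_vec v. f i) \<le> (\<Sum>i<dim_vec v. if v $ i \<noteq> 0 then c else 0)"
    by (rule sum_mono) (use assms in auto)
  also have "\<dots> = real (card ({..<dim_vec v} \<inter> {i. v $ i \<noteq> 0})) * c"
    by (simp add: sum.If_cases)
  also have "{..<dim_vec v} \<inter> {i. v $ i \<noteq> 0} = {i. i < dim_vec v \<and> v $ i \<noteq> 0}"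
    by auto
  finally show ?thesis by (simp add: norm0_def)
qed

lemma pnorm_infinity_eq_0: "0 < dim_vec v \<Longrightarrow> norm0 v = 0 \<Longrightarrow> pnorm \<infinity> v = 0"
  by (intro antisym pnorm_infinity_le pnorm_nonneg) (auto simp: norm0_def)

lemma pnorm_le_norm0:
  assumes "1 \<le> p" "0 < dim_vec v"
  shows "pnorm p v \<le> real (norm0 v) * pnorm \<infinity> v"
  using assms(1)
proof (cases rule: ereal_ge_1_cases)
  case 1
  show ?thesis
  proof (cases "norm0 v = 0")
    case True
    then show ?thesis using 1 pnorm_infinity_eq_0[OF assms(2)] by simp
  next
    case False
    then have "1 * pnorm \<infinity> v \<le> real (norm0 v) * pnorm \<infinity> v"
      using assms(2) by (intro mult_right_mono pnorm_nonneg) auto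
    then show ?thesis using 1 by simp
  qed
next
  case (2 r)
  let ?m = "pnorm \<infinity> v"
  have m: "0 \<le> ?m"
    using assms(2) by (rule pnorm_nonneg)
  have "(\<Sum>i<dim_vec v. \<bar>v $ i\<bar> powr r) \<le> real (norm0 v) * ?m powr r"
    by (rule sum_nonzero_le_norm0) (use 2 abs_le_pnorm[of \<infinity>] in \<open>auto intro: powr_mono2\<close>)
  then have "pnorm p v \<le> (real (norm0 v) * ?m powr r) powr (1/r)"
    using 2 by (auto simp: pnorm_def intro!: powr_mono2 sum_nonneg)
  also have "\<dots> = real (norm0 v) powr (1/r) * ?m"
    using 2 m by (simp add: powr_mult powr_powr)
  also have "\<dots> \<le> real (norm0 v) powr 1 * ?m"
  proof (rule mult_right_mono[OF _ m])
    show "real (norm0 v) powr (1/r) \<le> real (norm0 v) powr 1"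
      using 2 powr_mono[of "1/r" 1 "real (norm0 v)"] by (cases "norm0 v = 0") auto
  qed
  finally show ?thesis by simp
qed

lemma pnorm_smult:
  assumes "1 \<le> p" "0 < dim_vec v"
  shows "pnorm p (c \<cdot>\<^sub>v v) = \<bar>c\<bar> * pnorm p v"
  using assms(1)
proof (cases rule: ereal_ge_1_cases)
  case 1
  have "Max ((\<lambda>i. \<bar>(c \<cdot>\<^sub>v v) $ i\<bar>) ` {..<dim_vec v})
    = Max ((\<lambda>x. \<bar>c\<bar> * x) ` (\<lambda>i. \<bar>v $ i\<bar>) ` {..<dim_vec v})"
    unfolding image_image by (intro arg_cong[of _ _ Max] image_cong) (auto simp: abs_mult)
  also have "\<dots> = \<bar>c\<bar> * Max ((\<lambda>i. \<bar>v $ i\<bar>) ` {..<dim_vec v})"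
    by (rule mono_Max_commute[symmetric]) (use assms in \<open>auto simp: mono_def mult_left_mono\<close>)
  finally show ?thesis using 1 by (simp add: pnorm_def)
next
  case (2 r)
  have "(\<Sum>i<dim_vec v. \<bar>(c \<cdot>\<^sub>v v) $ i\<bar> powr r) = \<bar>c\<bar> powr r * (\<Sum>i<dim_vec v. \<bar>v $ i\<bar> powr r)"
    unfolding sum_distrib_left by (rule sum.cong) (auto simp: abs_mult powr_mult)
  then have "pnorm p (c \<cdot>\<^sub>v v) = (\<bar>c\<bar> powr r * (\<Sum>i<dim_vec v. \<bar>v $ i\<bar> powr r)) powr (1/r)"
    using 2 by (simp add: pnorm_def)
  also have "\<dots> = \<bar>c\<bar> * (\<Sum>i<dim_vec v. \<bar>v $ i\<bar> powr r) powr (1/r)"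
    using 2 by (subst powr_mult) (auto simp: powr_powr sum_nonneg)
  finally show ?thesis using 2 by (simp add: pnorm_def)
qed

lemma pnorm_zero:
  assumes "1 \<le> p" "0 < n"
  shows "pnorm p (0\<^sub>v n) = 0"
proof -
  have "0 \<cdot>\<^sub>v 0\<^sub>v n = (0\<^sub>v n :: real Matrix.vec)"
    by (rule eq_vecI) auto
  then show ?thesis
    using pnorm_smult[of p "0\<^sub>v n" 0] assms by simp
qed

lemma eq_zero_if_pnorm_eq_0:
  assumes "1 \<le> p" "v \<in> carrier_vec n" "pnorm p v = 0"
  shows "v = 0\<^sub>v n"
proof (rule eq_vecI)
  fix i assume "i < dim_vec (0\<^sub>v n)"
  then show "v $ i = 0\<^sub>v n $ i"
    using abs_le_pnorm[OF assms(1), of i v] assms by auto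
qed (use assms in auto)

lemma bdd_above_pnorm_image:
  assumes "1 \<le> p" "0 < n" "B \<in> carrier_mat n n" "S \<subseteq> carrier_vec n"
  shows "bdd_above ((\<lambda>v. pnorm p (B *\<^sub>v v)) ` {v \<in> S. pnorm p v \<le> 1})"
proof -
  define K where "K = (\<Sum>i<n. \<Sum>k<n. \<bar>B $$ (i,k)\<bar>)"
  have "pnorm p (B *\<^sub>v v) \<le> real n * K" if v: "v \<in> S" "pnorm p v \<le> 1" for v
  proof -
    have vc: "v \<in> carrier_vec n" using v assms by auto
    have v1: "\<bar>v $ k\<bar> \<le> 1" if "k < n" for k
      using abs_le_pnorm[OF assms(1), of k v] v vc that by auto
    have "\<bar>(B *\<^sub>v v) $ i\<bar> \<le> K" if "i < n" for i
    proof -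
      have "\<bar>(B *\<^sub>v v) $ i\<bar> \<le> (\<Sum>k<n. \<bar>B $$ (i,k) * v $ k\<bar>)"
        unfolding index_mult_mat_vec_sum[OF assms(3) vc that] by (rule sum_abs)
      also have "\<dots> \<le> (\<Sum>k<n. \<bar>B $$ (i,k)\<bar>)"
        by (rule sum_mono) (use v1 in \<open>auto simp: abs_mult intro: mult_left_le\<close>)
      also have "\<dots> \<le> K" unfolding K_def
        by (rule member_le_sum[of i _ "\<lambda>i. \<Sum>k<n. \<bar>B $$ (i,k)\<bar>"]) (use that in \<open>auto intro: sum_nonneg\<close>)
      finally show ?thesis .
    qed
    then have "pnorm \<infinity> (B *\<^sub>v v) \<le> K"
      using assms by (intro pnorm_infinity_le) auto
    moreover have "norm0 (B *\<^sub>v v) \<le> n"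
      unfolding norm0_def using assms by (intro card_mono[of "{..<n}", simplified]) auto
    ultimately have "real (norm0 (B *\<^sub>v v)) * pnorm \<infinity> (B *\<^sub>v v) \<le> real n * K"
      using assms by (intro mult_mono pnorm_nonneg) auto
    then show ?thesis
      using pnorm_le_norm0[OF assms(1), of "B *\<^sub>v v"] assms by simp
  qed
  then show ?thesis by (intro bdd_aboveI[of _ "real n * K"]) auto
qed

lemma op_pnorm_on_nonneg:
  assumes "1 \<le> p" "0 < n" "B \<in> carrier_mat n n" "S \<subseteq> carrier_vec n" "0\<^sub>v n \<in> S"
  shows "0 \<le> op_pnorm_on p B S"
proof -
  have "pnorm p (B *\<^sub>v 0\<^sub>v n) \<le> op_pnorm_on p B S"
    unfolding op_pnorm_on_def
    by (intro cSUP_upper bdd_above_pnorm_image[OF assms(1-4)]) (use assms in \<open>auto simp: pnorm_zero\<close>)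
  moreover have "0 \<le> pnorm p (B *\<^sub>v 0\<^sub>v n)" by (rule pnorm_nonneg) (use assms in auto)
  ultimately show ?thesis by linarith
qed

lemma pnorm_mult_mat_vec_le:
  assumes p: "1 \<le> p" and n: "0 < n" and B: "B \<in> carrier_mat n n" and S: "S \<subseteq> carrier_vec n"
    and scale: "\<And>c v. v \<in> S \<Longrightarrow> c \<cdot>\<^sub>v v \<in> S" and v: "v \<in> S"
  shows "pnorm p (B *\<^sub>v v) \<le> op_pnorm_on p B S * pnorm p v"
proof (cases "pnorm p v = 0")
  case True
  then have "v = 0\<^sub>v n"
    using eq_zero_if_pnorm_eq_0[OF p] v S by blast
  then have "B *\<^sub>v v = 0\<^sub>v n" using B by auto
  then show ?thesis using True pnorm_zero[OF p n] by simp
next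
  case False
  let ?N = "pnorm p v"
  let ?v = "(1 / ?N) \<cdot>\<^sub>v v"
  have vc: "v \<in> carrier_vec n" using v S by auto
  have N: "0 < ?N" using False pnorm_nonneg[of v p] vc n by simp
  have "pnorm p ?v = 1"
    using N vc n by (subst pnorm_smult[OF p]) auto
  then have "pnorm p (B *\<^sub>v ?v) \<le> op_pnorm_on p B S"
    unfolding op_pnorm_on_def
    by (intro cSUP_upper bdd_above_pnorm_image[OF p n B S]) (use scale v in auto)
  moreover have "B *\<^sub>v ?v = (1 / ?N) \<cdot>\<^sub>v (B *\<^sub>v v)"
    using B vc by (simp add: mult_mat_vec)
  moreover have "pnorm p ((1 / ?N) \<cdot>\<^sub>v (B *\<^sub>v v)) = \<bar>1 / ?N\<bar> * pnorm p (B *\<^sub>v v)"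
    by (rule pnorm_smult[OF p]) (use B n in auto)
  ultimately show ?thesis using N by (simp add: field_simps)
qed

lemma pow_mat_Suc_mult_vec:
  fixes B :: "real mat"
  assumes "B \<in> carrier_mat n n" "v \<in> carrier_vec n"
  shows "(B ^\<^sub>m Suc l) *\<^sub>v v = (B ^\<^sub>m l) *\<^sub>v (B *\<^sub>v v)"
  using assms by (simp add: assoc_mult_mat_vec[of _ n n _ n])

lemma pnorm_pow_mat_mult_vec_le:
  assumes p: "1 \<le> p" and n: "0 < n" and B: "B \<in> carrier_mat n n" and S: "S \<subseteq> carrier_vec n" "0\<^sub>v n \<in> S"
    and scale: "\<And>c v. v \<in> S \<Longrightarrow> c \<cdot>\<^sub>v v \<in> S" and invariant: "\<And>v. v \<in> S \<Longrightarrow> B *\<^sub>v v \<in> S" and "v \<in> S"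
  shows "pnorm p ((B ^\<^sub>m l) *\<^sub>v v) \<le> op_pnorm_on p B S ^ l * pnorm p v"
  using \<open>v \<in> S\<close>
proof (induction l arbitrary: v)
  case 0
  then show ?case using S B by auto
next
  case (Suc l)
  have "pnorm p ((B ^\<^sub>m Suc l) *\<^sub>v v) = pnorm p ((B ^\<^sub>m l) *\<^sub>v (B *\<^sub>v v))"
    using pow_mat_Suc_mult_vec[OF B] Suc.prems S(1) by (metis subsetD)
  also have "\<dots> \<le> op_pnorm_on p B S ^ l * pnorm p (B *\<^sub>v v)"
    using Suc invariant by blast
  also have "\<dots> \<le> op_pnorm_on p B S ^ l * (op_pnorm_on p B S * pnorm p v)"
    by (intro mult_left_mono pnorm_mult_mat_vec_le[OF p n B S(1) scale Suc.prems] zero_le_power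
      op_pnorm_on_nonneg[OF p n B S])
  finally show ?case by (simp add: mult_ac)
qed

lemma pow_mat_mult_vec_index:
  assumes A: "A \<in> carrier_mat n n" and W: "\<And>i k. i < n \<Longrightarrow> k < n \<Longrightarrow> A $$ (i,k) = W i k"
    and "v \<in> carrier_vec n" "i < n"
  shows "((A ^\<^sub>m l) *\<^sub>v v) $ i = (mat_app n W ^^ l) (($) v) i"
  using \<open>v \<in> carrier_vec n\<close>
proof (induction l arbitrary: v)
  case 0
  then show ?case using A \<open>i < n\<close> by simp
next
  case (Suc l)
  have "((A ^\<^sub>m Suc l) *\<^sub>v v) $ i = (mat_app n W ^^ l) (($) (A *\<^sub>v v)) i"
    unfolding pow_mat_Suc_mult_vec[OF A Suc.prems] by (rule Suc.IH) (use A Suc.prems in auto)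
  also have "\<dots> = (mat_app n W ^^ l) (mat_app n W (($) v)) i"
    by (rule mat_app_pow_cong)
      (use assms Suc.prems in
        \<open>auto simp: index_mult_mat_vec_sum[OF A] mat_app_def simp del: index_mult_mat_vec\<close>)
  finally show ?case by (simp add: funpow_swap1)
qed

lemma pow_mat_intertwine:
  fixes B X W :: "real mat"
  assumes B: "B \<in> carrier_mat n n" and X: "X \<in> carrier_mat n n" and W: "W \<in> carrier_mat n n"
    and "X * W = B * X"
  shows "X * (W ^\<^sub>m l) = (B ^\<^sub>m l) * X"
proof (induction l)
  case 0
  then show ?case using assms by simp
next
  case (Suc l)
  have "X * (W ^\<^sub>m Suc l) = (X * (W ^\<^sub>m l)) * W"
    using X W by (simp add: assoc_mult_mat[of _ n n _ n _ n])
  also have "\<dots> = (B ^\<^sub>m l) * (X * W)"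
    unfolding Suc.IH using X W B by (simp add: assoc_mult_mat[of _ n n _ n _ n])
  also have "\<dots> = (B ^\<^sub>m Suc l) * X"
    unfolding assms(4) using X B by (simp add: assoc_mult_mat[of _ n n _ n _ n])
  finally show ?case .
qed

subsection \<open>Ranges\<close>

lemma mat_range_carrier: "B \<in> carrier_mat n m \<Longrightarrow> mat_range B \<subseteq> carrier_vec n"
  by (auto simp: mat_range_def intro: mult_mat_vec_carrier)

lemma mult_in_mat_range: "B \<in> carrier_mat n m \<Longrightarrow> x \<in> carrier_vec m \<Longrightarrow> B *\<^sub>v x \<in> mat_range B"
  by (auto simp: mat_range_def)

lemma zero_in_mat_range:
  assumes "B \<in> carrier_mat n m"
  shows "0\<^sub>v n \<in> mat_range B"
proof -
  have "B *\<^sub>v 0\<^sub>v m = 0\<^sub>v n" using assms by (intro eq_vecI) auto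
  then show ?thesis using mult_in_mat_range[OF assms, of "0\<^sub>v m"] by simp
qed

lemma smult_in_mat_range:
  fixes B :: "real mat"
  assumes "B \<in> carrier_mat n m" "v \<in> mat_range B"
  shows "c \<cdot>\<^sub>v v \<in> mat_range B"
proof -
  obtain x where x: "x \<in> carrier_vec m" "v = B *\<^sub>v x"
    using assms by (auto simp: mat_range_def)
  then have "c \<cdot>\<^sub>v v = B *\<^sub>v (c \<cdot>\<^sub>v x)"
    using mult_mat_vec[OF assms(1) x(1), of c] by simp
  then show ?thesis using mult_in_mat_range[OF assms(1)] x(1) by simp
qed

lemma mult_in_mat_range_commute:
  fixes B C :: "real mat"
  assumes B: "B \<in> carrier_mat n n" and C: "C \<in> carrier_mat n n" and "B * C = C * B" "v \<in> mat_range C"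
  shows "B *\<^sub>v v \<in> mat_range C"
proof -
  obtain x where x: "x \<in> carrier_vec n" "v = C *\<^sub>v x"
    using assms by (auto simp: mat_range_def)
  then have "B *\<^sub>v v = C *\<^sub>v (B *\<^sub>v x)"
    using assms by (metis assoc_mult_mat_vec)
  then show ?thesis using mult_in_mat_range[OF C] B x by simp
qed

section \<open>Truncation of the series\<close>

lemma suminf_minus_partial_sum_le:
  fixes a :: "nat \<Rightarrow> real"
  assumes "\<And>l. \<bar>a l\<bar> \<le> H * \<rho> ^ l" "0 \<le> \<rho>" "\<rho> < 1"
  shows "summable a" "\<bar>(\<Sum>l. a l) - (\<Sum>l<L. a l)\<bar> \<le> H * \<rho> ^ L / (1 - \<rho>)"
proof -
  have "summable (\<lambda>l. H * \<rho> ^ l)"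
    by (intro summable_mult summable_geometric) (use assms in auto)
  then show a: "summable a"
    by (rule summable_comparison_test'[of _ 0]) (use assms in auto)
  have geometric: "(\<lambda>l. H * \<rho> ^ L * \<rho> ^ l) sums (H * \<rho> ^ L * (1 / (1 - \<rho>)))"
    by (intro sums_mult geometric_sums) (use assms in auto)
  have tail_le: "norm (a (l + L)) \<le> H * \<rho> ^ L * \<rho> ^ l" for l
    using assms(1)[of "l + L"] by (simp add: power_add mult_ac)
  have "(\<Sum>l. a l) - (\<Sum>l<L. a l) = (\<Sum>l. a (l + L))"
    using suminf_split_initial_segment[OF a, of L] by simp
  also have "norm \<dots> \<le> (\<Sum>l. H * \<rho> ^ L * \<rho> ^ l)"
    by (rule norm_suminf_le[OF tail_le sums_summable[OF geometric]])
  also have "\<dots> = H * \<rho> ^ L / (1 - \<rho>)"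
    using sums_unique[OF geometric] by simp
  finally show "\<bar>(\<Sum>l. a l) - (\<Sum>l<L. a l)\<bar> \<le> H * \<rho> ^ L / (1 - \<rho>)" by simp
qed

lemma geometric_tail_le:
  fixes H E \<gamma> \<rho> :: real
  assumes "0 \<le> \<rho>" "\<rho> \<le> 1 - \<gamma> / 2" "0 < \<gamma>" "0 \<le> H" "0 < E"
    and L: "4 * (1 / \<gamma> * max 1 (ln (H / (\<gamma> * E)))) \<le> real L"
  shows "H * \<rho> ^ L / (1 - \<rho>) \<le> E"
proof -
  define X where "X = H / (\<gamma> * E)"
  have "\<gamma> * (4 * (1 / \<gamma> * max 1 (ln X))) \<le> \<gamma> * real L"
    using L assms(3) by (intro mult_left_mono) (auto simp: X_def)
  then have exponent: "2 * max 1 (ln X) \<le> \<gamma> * real L / 2"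
    using assms(3) by simp
  have decay: "X * exp (- (\<gamma> * real L / 2)) \<le> 1/2"
  proof (cases "X = 0")
    case False
    then have X: "0 < X"
      using assms by (simp add: X_def)
    have "exp (- (\<gamma> * real L / 2)) \<le> exp (- ln X + -1)"
      using exponent by simp
    also have "\<dots> = exp (-1) / X"
      using X unfolding exp_add by (simp add: exp_minus field_simps)
    also have "\<dots> \<le> (1/2) / X"
      using exp_ge_add_one_self[of "1::real"] X
      by (intro divide_right_mono) (auto simp: exp_minus field_simps)
    finally show ?thesis using X by (simp add: field_simps)
  qed simp
  have "\<rho> \<le> exp (- (\<gamma> / 2))"
    using assms(2) exp_ge_add_one_self[of "- (\<gamma> / 2)"] by linarith
  then have "\<rho> ^ L \<le> exp (- (\<gamma> / 2)) ^ L"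
    using assms(1) by (rule power_mono)
  also have "\<dots> = exp (- (\<gamma> * real L / 2))"
    by (simp add: exp_of_nat_mult[symmetric] mult_ac)
  finally have "H * \<rho> ^ L / (1 - \<rho>) \<le> H * exp (- (\<gamma> * real L / 2)) / (\<gamma> / 2)"
    using assms by (intro frac_le mult_left_mono) auto
  also have "\<dots> = 2 * E * (X * exp (- (\<gamma> * real L / 2)))"
    using assms by (simp add: X_def field_simps)
  also have "\<dots> \<le> 2 * E * (1/2)"
    using decay assms by (intro mult_left_mono) auto
  finally show ?thesis by simp
qed

definition walk_matrix :: "real mat \<Rightarrow> real mat" where
  "walk_matrix M = (1/2) \<cdot>\<^sub>m (1\<^sub>m (dim_row M) + diag_powr M (-1) * AT M)"

definition scaled_walk_matrix :: "real mat \<Rightarrow> ereal \<Rightarrow> real mat" where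
  "scaled_walk_matrix M p = (1/2) \<cdot>\<^sub>m (1\<^sub>m (dim_row M) + scaled_AT M p)"

definition contraction_factor :: "real mat \<Rightarrow> ereal \<Rightarrow> real" where
  "contraction_factor M p =
     op_pnorm_on p (scaled_walk_matrix M p) (mat_range (1\<^sub>m (dim_row M) - scaled_AT M p))"

definition walk_iterate :: "real mat \<Rightarrow> real Matrix.vec \<Rightarrow> nat \<Rightarrow> real Matrix.vec" where
  "walk_iterate M b l = (walk_matrix M ^\<^sub>m l) *\<^sub>v (diag_powr M (-1) *\<^sub>v b)"

context rdd_matrix
begin

lemma diag_powr_eq: "diag_powr M s = mat_diag n (\<lambda>i. M $$ (i,i) powr s)"
  by (auto simp: diag_powr_def mat_diag_def dims)

lemma diag_powr_carrier: "diag_powr M s \<in> carrier_mat n n"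
  by (simp add: diag_powr_eq)

lemma index_diag_powr_mult:
  "A \<in> carrier_mat n m \<Longrightarrow> i < n \<Longrightarrow> k < m \<Longrightarrow> (diag_powr M s * A) $$ (i,k) = M $$ (i,i) powr s * A $$ (i,k)"
  by (simp add: diag_powr_eq mat_diag_mult_left)

lemma index_mult_diag_powr:
  "A \<in> carrier_mat m n \<Longrightarrow> i < m \<Longrightarrow> k < n \<Longrightarrow> (A * diag_powr M s) $$ (i,k) = A $$ (i,k) * M $$ (k,k) powr s"
  by (simp add: diag_powr_eq mat_diag_mult_right)

lemma index_diag_powr_mult_vec:
  assumes "v \<in> carrier_vec n" "i < n"
  shows "(diag_powr M s *\<^sub>v v) $ i = M $$ (i,i) powr s * v $ i"
proof -
  have "(diag_powr M s *\<^sub>v v) $ i = (\<Sum>k<n. if i = k then M $$ (i,i) powr s * v $ i else 0)"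
    unfolding index_mult_mat_vec_sum[OF diag_powr_carrier assms]
    by (rule sum.cong) (use assms in \<open>auto simp: diag_powr_def dims\<close>)
  then show ?thesis using assms by simp
qed

lemma AT_carrier: "AT M \<in> carrier_mat n n"
  using M by (auto simp: AT_def diag_part_def)

lemma index_AT: "i < n \<Longrightarrow> k < n \<Longrightarrow> AT M $$ (i,k) = (if i = k then 0 else - M $$ (i,k))"
  by (auto simp: AT_def diag_part_def dims)

lemma scaled_AT_carrier: "scaled_AT M p \<in> carrier_mat n n"
  unfolding scaled_AT_def Let_def by (intro mult_carrier_mat[of _ n n] diag_powr_carrier AT_carrier)

lemma index_scaled_AT:
  assumes "i < n" "k < n"
  shows "scaled_AT M p $$ (i,k) =
    M $$ (i,i) powr (real_of_ereal (1/p) - 1) * AT M $$ (i,k) * M $$ (k,k) powr (- real_of_ereal (1/p))"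
  unfolding scaled_AT_def Let_def
  by (subst index_mult_diag_powr[OF mult_carrier_mat[OF diag_powr_carrier AT_carrier] assms])
    (simp add: index_diag_powr_mult[OF AT_carrier assms])

lemma walk_matrix_carrier: "walk_matrix M \<in> carrier_mat n n"
  using mult_carrier_mat[OF diag_powr_carrier AT_carrier] by (simp add: walk_matrix_def dims)

lemma index_walk_matrix:
  assumes "i < n" "k < n"
  shows "walk_matrix M $$ (i,k) = W i k"
proof -
  have "walk_matrix M $$ (i,k) = 1/2 * ((if i = k then 1 else 0) + (diag_powr M (-1) * AT M) $$ (i,k))"
    using assms carrier_matD[OF mult_carrier_mat[OF diag_powr_carrier[of "-1"] AT_carrier]]
    by (simp add: walk_matrix_def dims del: index_mult_mat)
  then show ?thesis
    using assms diag_pos[OF assms(1)]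
    by (cases "i = k") (simp_all add: index_diag_powr_mult[OF AT_carrier] index_AT walk_mat_def dims
      powr_minus_divide field_simps)
qed

lemma scaled_walk_matrix_carrier: "scaled_walk_matrix M p \<in> carrier_mat n n"
  using scaled_AT_carrier by (simp add: scaled_walk_matrix_def dims)

lemma diag_powr_mult_walk_matrix:
  "diag_powr M (real_of_ereal (1/p)) * walk_matrix M
    = scaled_walk_matrix M p * diag_powr M (real_of_ereal (1/p))"
    (is "?D * _ = _")
proof (rule eq_matI)
  define u where "u = real_of_ereal (1/p)"
  fix i k assume "i < dim_row (scaled_walk_matrix M p * ?D)" "k < dim_col (scaled_walk_matrix M p * ?D)"
  then have ik: "i < n" "k < n"
    using scaled_walk_matrix_carrier[of p] by (simp_all add: diag_powr_def dims)
  have pos: "0 < M $$ (i,i)" "0 < M $$ (k,k)"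
    using ik diag_pos by auto
  have "M $$ (i,i) powr u * W i k
    = 1/2 * ((if i = k then 1 else 0) + scaled_AT M p $$ (i,k)) * M $$ (k,k) powr u"
  proof (cases "i = k")
    case False
    have "M $$ (k,k) powr (- u) * M $$ (k,k) powr u = 1"
      using pos by (simp add: powr_add[symmetric])
    moreover have "M $$ (i,i) powr (u - 1) = M $$ (i,i) powr u / M $$ (i,i)"
      using pos by (simp add: powr_diff)
    ultimately show ?thesis
      using False ik by (simp add: index_scaled_AT index_AT walk_mat_def dims mult.assoc u_def)
  qed (use ik in \<open>simp add: index_scaled_AT index_AT walk_mat_def dims\<close>)
  also have "\<dots> = scaled_walk_matrix M p $$ (i,k) * M $$ (k,k) powr u"
    using ik scaled_AT_carrier[of p] by (simp add: scaled_walk_matrix_def dims)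
  finally show "(?D * walk_matrix M) $$ (i,k) = (scaled_walk_matrix M p * ?D) $$ (i,k)"
    using ik by (simp add: index_diag_powr_mult[OF walk_matrix_carrier] index_walk_matrix
      index_mult_diag_powr[OF scaled_walk_matrix_carrier] u_def)
qed (use scaled_walk_matrix_carrier[of p] walk_matrix_carrier in \<open>simp_all add: diag_powr_def dims\<close>)

lemma one_minus_scaled_AT_mult_diag_powr:
  "(1\<^sub>m n - scaled_AT M p) * diag_powr M (real_of_ereal (1/p))
    = diag_powr M (real_of_ereal (1/p) - 1) * M"
    (is "?C * ?D = ?R * M")
proof (rule eq_matI)
  define u where "u = real_of_ereal (1/p)"
  fix i k assume "i < dim_row (?R * M)" "k < dim_col (?R * M)"
  then have ik: "i < n" "k < n"
    by (simp_all add: diag_powr_def dims)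
  have pos: "0 < M $$ (i,i)" "0 < M $$ (k,k)"
    using ik diag_pos by auto
  have C: "?C \<in> carrier_mat n n"
    by (rule minus_carrier_mat[OF scaled_AT_carrier])
  have "(?C * ?D) $$ (i,k) = ((if i = k then 1 else 0) - scaled_AT M p $$ (i,k)) * M $$ (k,k) powr u"
    using ik scaled_AT_carrier[of p] by (simp add: index_mult_diag_powr[OF C] u_def)
  also have "\<dots> = M $$ (i,i) powr (u - 1) * M $$ (i,k)"
  proof (cases "i = k")
    case True
    then show ?thesis
      using ik pos by (simp add: index_scaled_AT index_AT powr_diff)
  next
    case False
    have "M $$ (k,k) powr (- u) * M $$ (k,k) powr u = 1"
      using pos by (simp add: powr_add[symmetric])
    then show ?thesis
      using False ik by (simp add: index_scaled_AT index_AT mult.assoc u_def)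
  qed
  finally show "(?C * ?D) $$ (i,k) = (?R * M) $$ (i,k)"
    using ik by (simp add: index_diag_powr_mult[OF M] u_def)
qed (use scaled_AT_carrier[of p] in \<open>simp_all add: diag_powr_def dims\<close>)

lemma scaled_walk_matrix_commute:
  "scaled_walk_matrix M p * (1\<^sub>m n - scaled_AT M p) = (1\<^sub>m n - scaled_AT M p) * scaled_walk_matrix M p"
proof -
  define A where "A = scaled_AT M p"
  have A: "A \<in> carrier_mat n n" "1\<^sub>m n - A \<in> carrier_mat n n" "A * A \<in> carrier_mat n n"
    using scaled_AT_carrier[of p] by (simp_all add: A_def minus_carrier_mat)
  have "(1\<^sub>m n + A) * (1\<^sub>m n - A) = (1\<^sub>m n - A) + (A - A * A)"
    using A by (simp add: add_mult_distrib_mat[OF _ A(1,2)] mult_minus_distrib_mat[OF A(1) _ A(1)])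
  also have "\<dots> = (1\<^sub>m n + A) - (A + A * A)"
    using A by (intro eq_matI) auto
  also have "\<dots> = (1\<^sub>m n - A) * (1\<^sub>m n + A)"
    using A(1) by (simp add: minus_mult_distrib_mat[OF one_carrier_mat A(1), of _ n]
      mult_add_distrib_mat[OF A(1) one_carrier_mat A(1)])
  finally have "(1\<^sub>m n + A) * (1\<^sub>m n - A) = (1\<^sub>m n - A) * (1\<^sub>m n + A)" .
  then show ?thesis
    unfolding scaled_walk_matrix_def A_def[symmetric] dims
    using A by (simp add: mult_smult_assoc_mat[of _ n n _ n] mult_smult_distrib[of _ n n _ n])
qed

lemma one_minus_scaled_AT_carrier: "1\<^sub>m n - scaled_AT M p \<in> carrier_mat n n"
  by (rule minus_carrier_mat[OF scaled_AT_carrier])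

lemma contraction_factor_nonneg: "1 \<le> p \<Longrightarrow> 0 < n \<Longrightarrow> 0 \<le> contraction_factor M p"
  unfolding contraction_factor_def dims
  by (rule op_pnorm_on_nonneg[OF _ _ scaled_walk_matrix_carrier mat_range_carrier zero_in_mat_range,
        OF _ _ one_minus_scaled_AT_carrier one_minus_scaled_AT_carrier])

lemma pnorm_pow_scaled_walk_matrix_le:
  assumes p: "1 \<le> p" and n: "0 < n" and v: "v \<in> mat_range (1\<^sub>m n - scaled_AT M p)"
  shows "pnorm p ((scaled_walk_matrix M p ^\<^sub>m l) *\<^sub>v v) \<le> contraction_factor M p ^ l * pnorm p v"
  unfolding contraction_factor_def dims
proof (rule pnorm_pow_mat_mult_vec_le[OF p n scaled_walk_matrix_carrier])
  note C = one_minus_scaled_AT_carrier[of p]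
  show "mat_range (1\<^sub>m n - scaled_AT M p) \<subseteq> carrier_vec n"
    by (rule mat_range_carrier[OF C])
  show "0\<^sub>v n \<in> mat_range (1\<^sub>m n - scaled_AT M p)"
    by (rule zero_in_mat_range[OF C])
  show "c \<cdot>\<^sub>v x \<in> mat_range (1\<^sub>m n - scaled_AT M p)" if "x \<in> mat_range (1\<^sub>m n - scaled_AT M p)" for c x
    by (rule smult_in_mat_range[OF C that])
  show "scaled_walk_matrix M p *\<^sub>v x \<in> mat_range (1\<^sub>m n - scaled_AT M p)"
    if "x \<in> mat_range (1\<^sub>m n - scaled_AT M p)" for x
    by (rule mult_in_mat_range_commute[OF scaled_walk_matrix_carrier C scaled_walk_matrix_commute that])
qed (rule v)

lemma gamma_max_witness:
  assumes "0 < n" "0 < \<gamma>" "\<gamma> \<le> gamma_max M"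
  obtains p where "1 \<le> p" "contraction_factor M p \<le> 1 - \<gamma> / 2"
proof -
  have "bdd_above ((\<lambda>p. 1 - contraction_factor M p) ` {1..\<infinity>})"
    by (intro bdd_aboveI[of _ 1]) (use contraction_factor_nonneg assms(1) in auto)
  moreover have "\<gamma> / 2 < (SUP p\<in>{1..\<infinity>}. 1 - contraction_factor M p)"
    using assms by (simp add: gamma_max_def contraction_factor_def scaled_walk_matrix_def)
  ultimately have "\<exists>p\<in>{1..\<infinity>}. \<gamma> / 2 < 1 - contraction_factor M p"
    by (subst (asm) less_cSUP_iff) auto
  then show ?thesis using that by force
qed

lemma diag_le_d_max: "i < n \<Longrightarrow> M $$ (i,i) \<le> d_max M"
  unfolding d_max_def by (rule Max_ge) (auto simp: dims)

lemma abs_diag_powr_mult_vec_le: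
  assumes v: "v \<in> carrier_vec n" and i: "i < n" and s: "0 \<le> s"
  shows "\<bar>(diag_powr M (s - 1) *\<^sub>v v) $ i\<bar> \<le> d_max M powr s * pnorm \<infinity> (diag_powr M (-1) *\<^sub>v v)"
proof -
  have "\<bar>(diag_powr M (s - 1) *\<^sub>v v) $ i\<bar> = M $$ (i,i) powr s * \<bar>(diag_powr M (-1) *\<^sub>v v) $ i\<bar>"
    using diag_pos[OF i]
    by (simp add: index_diag_powr_mult_vec[OF v i] abs_mult powr_diff powr_minus_divide)
  also have "\<dots> \<le> d_max M powr s * pnorm \<infinity> (diag_powr M (-1) *\<^sub>v v)"
    using diag_pos[OF i] diag_le_d_max[OF i] s i
    by (intro mult_mono powr_mono2 abs_le_pnorm) (auto simp: diag_powr_def dims)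
  finally show ?thesis .
qed

lemma pnorm_diag_powr_mult_vec_le:
  assumes v: "v \<in> carrier_vec n" and "1 \<le> p" "0 < n" "0 \<le> s"
  shows "pnorm p (diag_powr M (s - 1) *\<^sub>v v)
    \<le> d_max M powr s * (real (norm0 v) * pnorm \<infinity> (diag_powr M (-1) *\<^sub>v v))"
proof -
  let ?x = "diag_powr M (s - 1) *\<^sub>v v"
  have dim: "dim_vec ?x = n"
    by (simp add: diag_powr_def dims)
  have "norm0 ?x = norm0 v"
  proof -
    have "?x $ i \<noteq> 0 \<longleftrightarrow> v $ i \<noteq> 0" if "i < n" for i
      using that diag_pos[OF that] by (simp add: index_diag_powr_mult_vec[OF v] del: index_mult_mat_vec)
    then show ?thesis
      using v dim unfolding norm0_def by (intro arg_cong[of _ _ card]) auto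
  qed
  moreover have "pnorm \<infinity> ?x \<le> d_max M powr s * pnorm \<infinity> (diag_powr M (-1) *\<^sub>v v)"
  proof (rule pnorm_infinity_le)
    fix i assume "i < dim_vec ?x"
    then show "\<bar>?x $ i\<bar> \<le> d_max M powr s * pnorm \<infinity> (diag_powr M (-1) *\<^sub>v v)"
      unfolding dim by (rule abs_diag_powr_mult_vec_le[OF v _ assms(4)])
  qed (use assms dim in simp)
  ultimately have "real (norm0 ?x) * pnorm \<infinity> ?x
      \<le> real (norm0 v) * (d_max M powr s * pnorm \<infinity> (diag_powr M (-1) *\<^sub>v v))"
    by (simp add: mult_left_mono)
  then show ?thesis
    using pnorm_le_norm0[of p ?x] assms dim by (simp add: mult.left_commute)
qed

lemma diag_powr_mult_range:
  assumes "b \<in> mat_range M"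
  shows "diag_powr M (real_of_ereal (1/p) - 1) *\<^sub>v b \<in> mat_range (1\<^sub>m n - scaled_AT M p)"
proof -
  define u where "u = real_of_ereal (1/p)"
  obtain x where x: "x \<in> carrier_vec n" "b = M *\<^sub>v x"
    using assms M by (auto simp: mat_range_def)
  have "diag_powr M (u - 1) *\<^sub>v b = (diag_powr M (u - 1) * M) *\<^sub>v x"
    unfolding x(2) by (rule assoc_mult_mat_vec[OF diag_powr_carrier M x(1), symmetric])
  also have "\<dots> = (1\<^sub>m n - scaled_AT M p) *\<^sub>v (diag_powr M u *\<^sub>v x)"
    unfolding u_def one_minus_scaled_AT_mult_diag_powr[symmetric]
    by (rule assoc_mult_mat_vec[OF one_minus_scaled_AT_carrier diag_powr_carrier x(1)])
  finally show ?thesis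
    using mult_in_mat_range[OF one_minus_scaled_AT_carrier
      mult_mat_vec_carrier[OF diag_powr_carrier x(1)]]
    by (simp add: u_def)
qed

lemma scaled_rhs_carrier: "b \<in> carrier_vec n \<Longrightarrow> diag_powr M s *\<^sub>v b \<in> carrier_vec n"
  by (rule mult_mat_vec_carrier[OF diag_powr_carrier])

lemma walk_iterate_carrier: "b \<in> carrier_vec n \<Longrightarrow> walk_iterate M b l \<in> carrier_vec n"
  unfolding walk_iterate_def
  by (intro mult_mat_vec_carrier[of _ n n] pow_carrier_mat walk_matrix_carrier scaled_rhs_carrier)

lemma index_walk_iterate:
  assumes "b \<in> carrier_vec n" "i < n"
  shows "walk_iterate M b l $ i = (mat_app n W ^^ l) (($) (diag_powr M (-1) *\<^sub>v b)) i"
  unfolding walk_iterate_def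
  by (rule pow_mat_mult_vec_index[OF walk_matrix_carrier index_walk_matrix
    scaled_rhs_carrier[OF assms(1)] assms(2)])

lemma diag_powr_mult_walk_iterate:
  fixes p :: ereal
  assumes b: "b \<in> carrier_vec n"
  defines "u \<equiv> real_of_ereal (1/p)"
  shows "diag_powr M u *\<^sub>v walk_iterate M b l
    = (scaled_walk_matrix M p ^\<^sub>m l) *\<^sub>v (diag_powr M (u - 1) *\<^sub>v b)"
proof -
  let ?D = "diag_powr M u" and ?v = "diag_powr M (-1) *\<^sub>v b"
  note pow_carriers =
    pow_carrier_mat[OF walk_matrix_carrier] pow_carrier_mat[OF scaled_walk_matrix_carrier]
  have "?D *\<^sub>v ?v = (?D * diag_powr M (-1)) *\<^sub>v b"
    by (rule assoc_mult_mat_vec[OF diag_powr_carrier diag_powr_carrier b, symmetric])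
  also have "?D * diag_powr M (-1) = diag_powr M (u - 1)"
    unfolding diag_powr_eq mat_diag_diag powr_add[symmetric] by simp
  finally have start: "?D *\<^sub>v ?v = diag_powr M (u - 1) *\<^sub>v b" .
  have "?D *\<^sub>v walk_iterate M b l = (?D * (walk_matrix M ^\<^sub>m l)) *\<^sub>v ?v"
    unfolding walk_iterate_def
    by (rule
      assoc_mult_mat_vec[OF diag_powr_carrier pow_carriers(1) scaled_rhs_carrier[OF b], symmetric])
  also have "?D * (walk_matrix M ^\<^sub>m l) = (scaled_walk_matrix M p ^\<^sub>m l) * ?D"
    unfolding u_def
    by (rule pow_mat_intertwine[OF scaled_walk_matrix_carrier diag_powr_carrier walk_matrix_carrier
      diag_powr_mult_walk_matrix])
  also have "((scaled_walk_matrix M p ^\<^sub>m l) * ?D) *\<^sub>v ?v = (scaled_walk_matrix M p ^\<^sub>m l) *\<^sub>v (?D *\<^sub>v ?v)"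
    by (rule assoc_mult_mat_vec[OF pow_carriers(2) diag_powr_carrier scaled_rhs_carrier[OF b]])
  finally show ?thesis unfolding start .
qed

text \<open>\<open>D\<^sup>u W D\<^sup>-\<^sup>u\<close>, with \<open>u = 1/p\<close>, is the matrix whose restricted \<open>p\<close>-norm occurs in \<open>gamma_max\<close>, and
  \<open>b \<in> range M\<close> puts the rescaled right-hand side into the invariant subspace on which it contracts.\<close>

lemma abs_walk_iterate_le:
  assumes n: "0 < n" and p: "1 \<le> p" and range: "b \<in> mat_range M" and i: "i < n"
  defines "u \<equiv> real_of_ereal (1/p)"
  shows "\<bar>walk_iterate M b l $ i\<bar> \<le> M $$ (i,i) powr (-u) * (contraction_factor M p ^ l *
    (d_max M powr u * (real (norm0 b) * pnorm \<infinity> (diag_powr M (-1) *\<^sub>v b))))"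
    (is "_ \<le> _ * ?K")
proof -
  let ?z = "(scaled_walk_matrix M p ^\<^sub>m l) *\<^sub>v (diag_powr M (u - 1) *\<^sub>v b)"
  have b: "b \<in> carrier_vec n"
    using range mat_range_carrier[OF M] by blast
  have u: "0 \<le> u"
    using p by (cases rule: ereal_ge_1_cases) (simp_all add: u_def one_ereal_def)
  have "M $$ (i,i) powr u * \<bar>walk_iterate M b l $ i\<bar> = \<bar>?z $ i\<bar>"
    unfolding u_def diag_powr_mult_walk_iterate[OF b, symmetric]
    by (simp add: index_diag_powr_mult_vec[OF walk_iterate_carrier[OF b] i]
      abs_mult del: index_mult_mat_vec)
  also have "\<dots> \<le> pnorm p ?z"
    by (rule abs_le_pnorm[OF p]) (use i carrier_matD[OF scaled_walk_matrix_carrier[of p]] in simp)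
  also have "\<dots> \<le> contraction_factor M p ^ l * pnorm p (diag_powr M (u - 1) *\<^sub>v b)"
    unfolding u_def by (rule pnorm_pow_scaled_walk_matrix_le[OF p n diag_powr_mult_range[OF range]])
  also have "\<dots> \<le> ?K"
    by (intro mult_left_mono pnorm_diag_powr_mult_vec_le[OF b p n u] zero_le_power
      contraction_factor_nonneg p n)
  finally show ?thesis
    using diag_pos[OF i] by (simp add: powr_minus field_simps)
qed

lemma abs_scalar_prod_le:
  assumes t: "t \<in> carrier_vec n" and y: "y \<in> carrier_vec n" and u: "u \<le> 1"
    and decay: "\<And>i. i < n \<Longrightarrow> \<bar>y $ i\<bar> \<le> M $$ (i,i) powr (-u) * K" and K: "0 \<le> K"
  shows "\<bar>t \<bullet> y\<bar> \<le> real (norm0 t) * (d_max M powr (1 - u) * pnorm \<infinity> (diag_powr M (-1) *\<^sub>v t) * K)"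
proof -
  have "\<bar>t \<bullet> y\<bar> \<le> (\<Sum>i<dim_vec t. \<bar>t $ i * y $ i\<bar>)"
    using t y unfolding scalar_prod_def by (simp add: atLeast0LessThan sum_abs)
  also have "\<dots> \<le> real (norm0 t) * (d_max M powr (1 - u) * pnorm \<infinity> (diag_powr M (-1) *\<^sub>v t) * K)"
  proof (rule sum_nonzero_le_norm0)
    fix i assume "i < dim_vec t"
    then have i: "i < n" using t by simp
    have "\<bar>t $ i * y $ i\<bar> \<le> \<bar>t $ i\<bar> * (M $$ (i,i) powr (-u) * K)"
      unfolding abs_mult by (intro mult_left_mono decay i) simp
    also have "\<dots> = \<bar>(diag_powr M ((1 - u) - 1) *\<^sub>v t) $ i\<bar> * K"
      by (simp add: index_diag_powr_mult_vec[OF t i] abs_mult del: index_mult_mat_vec)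
    also have "\<dots> \<le> d_max M powr (1 - u) * pnorm \<infinity> (diag_powr M (-1) *\<^sub>v t) * K"
      using u by (intro mult_right_mono K abs_diag_powr_mult_vec_le[OF t i]) auto
    finally show "\<bar>t $ i * y $ i\<bar> \<le> d_max M powr (1 - u) * pnorm \<infinity> (diag_powr M (-1) *\<^sub>v t) * K" .
  qed simp
  finally show ?thesis .
qed

lemma abs_scalar_prod_walk_iterate_le:
  assumes n: "0 < n" and p: "1 \<le> p" and t: "t \<in> carrier_vec n" and range: "b \<in> mat_range M"
  shows "\<bar>t \<bullet> walk_iterate M b l\<bar> \<le> d_max M * real (norm0 t) * pnorm \<infinity> (diag_powr M (-1) *\<^sub>v t) *
    real (norm0 b) * pnorm \<infinity> (diag_powr M (-1) *\<^sub>v b) * contraction_factor M p ^ l"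
proof -
  define u where "u = real_of_ereal (1/p)"
  let ?T = "pnorm \<infinity> (diag_powr M (-1) *\<^sub>v t)" and ?B = "real (norm0 b) * pnorm \<infinity> (diag_powr M (-1) *\<^sub>v b)"
  have b: "b \<in> carrier_vec n"
    using range mat_range_carrier[OF M] by blast
  have u: "u \<le> 1"
    using p by (cases rule: ereal_ge_1_cases) (simp_all add: u_def one_ereal_def)
  have K: "0 \<le> contraction_factor M p ^ l * (d_max M powr u * ?B)"
    using n p contraction_factor_nonneg
    by (auto simp: diag_powr_def dims intro!: mult_nonneg_nonneg pnorm_nonneg)
  have "\<bar>t \<bullet> walk_iterate M b l\<bar> \<le>
      real (norm0 t) *
        (d_max M powr (1 - u) * ?T * (contraction_factor M p ^ l * (d_max M powr u * ?B)))"
    by (rule abs_scalar_prod_le[OF t walk_iterate_carrier[OF b] u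
      abs_walk_iterate_le[OF n p range, folded u_def] K])
  also have "\<dots> = (d_max M powr (1 - u) * d_max M powr u) *
    (real (norm0 t) * ?T * ?B * contraction_factor M p ^ l)"
    by (simp only: mult_ac)
  also have "d_max M powr (1 - u) * d_max M powr u = d_max M"
    using diag_pos[OF n] diag_le_d_max[OF n] by (simp add: powr_add[symmetric])
  finally show ?thesis by (simp only: mult_ac)
qed

lemma scalar_prod_x_star:
  assumes t: "t \<in> carrier_vec n" and b: "b \<in> carrier_vec n"
    and summable: "\<And>i. i < n \<Longrightarrow> summable (\<lambda>l. walk_iterate M b l $ i)"
  shows "t \<bullet> x_star M b = 1/2 * (\<Sum>l. t \<bullet> walk_iterate M b l)"
proof -
  have x_star: "dim_vec (x_star M b) = n"
    "\<And>i. i < n \<Longrightarrow> x_star M b $ i = 1/2 * (\<Sum>l. walk_iterate M b l $ i)"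
    by (simp_all add: x_star_def Let_def walk_iterate_def walk_matrix_def dims del: index_mult_mat_vec)
  have "t \<bullet> x_star M b = (\<Sum>i<n. 1/2 * (\<Sum>l. t $ i * walk_iterate M b l $ i))"
    unfolding scalar_prod_def x_star(1) atLeast0LessThan
    by (intro sum.cong) (auto simp: x_star(2) suminf_mult[OF summable])
  also have "\<dots> = 1/2 * (\<Sum>l. \<Sum>i<n. t $ i * walk_iterate M b l $ i)"
    unfolding sum_distrib_left[symmetric] by (subst suminf_sum) (auto intro: summable_mult summable)
  also have "(\<lambda>l. \<Sum>i<n. t $ i * walk_iterate M b l $ i) = (\<lambda>l. t \<bullet> walk_iterate M b l)"
    using carrier_vecD[OF walk_iterate_carrier[OF b]] by (simp add: scalar_prod_def atLeast0LessThan)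
  finally show ?thesis .
qed

lemma neumann_sum_eq_sum_scalar_prod:
  assumes b: "b \<in> carrier_vec n"
  shows "neumann_sum n W (($) t) m (($) (diag_powr M (-1) *\<^sub>v b)) = (\<Sum>l<m. t \<bullet> walk_iterate M b l)"
  using carrier_vecD[OF walk_iterate_carrier[OF b]]
  by (simp add: neumann_sum_def scalar_prod_def atLeast0LessThan index_walk_iterate[OF b]
    del: index_mult_mat_vec)

lemma truncation_error:
  assumes n: "0 < n" and t: "t \<in> carrier_vec n" and \<gamma>: "0 < \<gamma>" "\<gamma> \<le> gamma_max M" and E: "0 < E"
    and range: "b \<in> mat_range M" and L: "4 * L_scale M t b \<gamma> E \<le> real L"
  shows "\<bar>neumann_sum n W (($) t) L (($) (diag_powr M (-1) *\<^sub>v b)) / 2 - t \<bullet> x_star M b\<bar> \<le> E / 2"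
proof -
  obtain p where p: "1 \<le> p" "contraction_factor M p \<le> 1 - \<gamma> / 2"
    using gamma_max_witness[OF n \<gamma>] .
  let ?\<rho> = "contraction_factor M p"
  let ?H = "d_max M * real (norm0 t) * pnorm \<infinity> (diag_powr M (-1) *\<^sub>v t) *
    real (norm0 b) * pnorm \<infinity> (diag_powr M (-1) *\<^sub>v b)"
  have b: "b \<in> carrier_vec n"
    using range mat_range_carrier[OF M] by blast
  have \<rho>: "0 \<le> ?\<rho>" "?\<rho> < 1"
    using contraction_factor_nonneg[OF p(1) n] p(2) \<gamma>(1) by auto
  have "summable (\<lambda>l. walk_iterate M b l $ i)" if "i < n" for i
    by (rule suminf_minus_partial_sum_le(1)[OF _ \<rho>, where H = "M $$ (i,i) powr (- real_of_ereal (1/p)) *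
        (d_max M powr real_of_ereal (1/p) * (real (norm0 b) * pnorm \<infinity> (diag_powr M (-1) *\<^sub>v b)))"])
      (use abs_walk_iterate_le[OF n p(1) range that] in \<open>simp add: mult_ac\<close>)
  then have x_star: "t \<bullet> x_star M b = 1/2 * (\<Sum>l. t \<bullet> walk_iterate M b l)"
    by (rule scalar_prod_x_star[OF t b])
  have "\<bar>(\<Sum>l. t \<bullet> walk_iterate M b l) - (\<Sum>l<L. t \<bullet> walk_iterate M b l)\<bar> \<le> ?H * ?\<rho> ^ L / (1 - ?\<rho>)"
    by (rule suminf_minus_partial_sum_le(2)[OF abs_scalar_prod_walk_iterate_le[OF n p(1) t range] \<rho>])
  also have "\<dots> \<le> E"
  proof (rule geometric_tail_le[OF \<rho>(1) p(2) \<gamma>(1) _ E])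
    show "0 \<le> ?H"
      using n diag_pos[OF n] diag_le_d_max[OF n]
      by (auto simp: diag_powr_def dims intro!: mult_nonneg_nonneg pnorm_nonneg)
    show "4 * (1 / \<gamma> * max 1 (ln (?H / (\<gamma> * E)))) \<le> real L"
      using L by (simp add: L_scale_def)
  qed
  finally show ?thesis
    unfolding x_star neumann_sum_eq_sum_scalar_prod[OF b] by (simp add: field_simps abs_minus_commute)
qed

end

section \<open>Average running time\<close>

context rdd_problem
begin

definition row_mean :: real where
  "row_mean = real (nnz M) / real n"

text \<open>At push threshold \<open>1 / (x d)\<close> the push cost and the sampling cost are both \<open>L a x\<close>, where \<open>a\<close> is
  \<open>row_mean\<close> and \<open>x\<close> is \<open>balance_point\<close>.\<close>

definition balance_point :: real where
  "balance_point = (\<tau>\<^sup>2 * real L ^ 4 * real f\<^sub>r / (row_mean * \<epsilon>\<^sup>2)) powr (1/3)"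

definition cost :: real where
  "cost = real f\<^sub>r powr (1/3) * (real (nnz M) / real n) powr (2/3) * pnorm 1 t powr (2/3)
     * real L powr (7/3) * \<epsilon> powr (-2/3)"

lemma row_mean_ge_1: "1 \<le> row_mean"
  using dim_le_nnz dim_pos by (simp add: row_mean_def)

lemma balance_point_pow3: "balance_point ^ 3 = \<tau>\<^sup>2 * real L ^ 4 * real f\<^sub>r / (row_mean * \<epsilon>\<^sup>2)"
proof -
  define X where "X = \<tau>\<^sup>2 * real L ^ 4 * real f\<^sub>r / (row_mean * \<epsilon>\<^sup>2)"
  have "0 < X"
    using \<tau>_pos L_pos f_row_ge_1 row_mean_ge_1 eps_pos by (simp add: X_def)
  then show ?thesis
    by (simp add: balance_point_def X_def[symmetric] powr_power)
qed

lemma balance_point_pos: "0 < balance_point"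
  using \<tau>_pos L_pos f_row_ge_1 row_mean_ge_1 eps_pos by (simp add: balance_point_def)

lemma balanced_iff: "balanced m \<longleftrightarrow> balance_point \<le> real m"
proof -
  have "balanced m \<longleftrightarrow> balance_point ^ 3 \<le> real m ^ 3"
    unfolding balanced_def balance_point_pow3 row_mean_def
    using dim_le_nnz dim_pos eps_pos by (simp add: field_simps)
  then show ?thesis
    using balance_point_pos by (simp add: power_mono_iff)
qed

lemma balance_point_le_h: "balance_point \<le> real h"
  using balanced_h by (simp add: balanced_iff)

lemma h_le_balance_point: "real (h - 1) \<le> balance_point"
proof (cases "h = 1")
  case True
  then show ?thesis using balance_point_pos by simp
next
  case False
  then have "\<not> balanced (h - 1)"
    using h_ge_1 by (intro not_balanced_below_h) auto
  then show ?thesis by (simp add: balanced_iff)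
qed

lemma cost_eq: "cost = real L * row_mean * balance_point"
proof -
  have pos: "0 < real L" "0 < row_mean" "0 < real f\<^sub>r"
    using L_pos row_mean_ge_1 f_row_ge_1 by auto
  have "balance_point = exp (1/3 * ln (\<tau>\<^sup>2 * real L ^ 4 * real f\<^sub>r / (row_mean * \<epsilon>\<^sup>2)))"
    using pos \<tau>_pos eps_pos by (simp add: balance_point_def powr_def)
  also have "ln (\<tau>\<^sup>2 * real L ^ 4 * real f\<^sub>r / (row_mean * \<epsilon>\<^sup>2))
      = 2 * ln \<tau> + 4 * ln (real L) + ln (real f\<^sub>r) - ln row_mean - 2 * ln \<epsilon>"
    using pos \<tau>_pos eps_pos by (simp add: ln_mult ln_div ln_realpow)
  finally have "real L * row_mean * balance_point = exp (ln (real L)) * exp (ln row_mean) *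
      exp (1/3 * (2 * ln \<tau> + 4 * ln (real L) + ln (real f\<^sub>r) - ln row_mean - 2 * ln \<epsilon>))"
    using pos by simp
  also have "\<dots> = exp (1/3 * ln (real f\<^sub>r)) * exp (2/3 * ln row_mean) * exp (2/3 * ln \<tau>) *
      exp (7/3 * ln (real L)) * exp (-2/3 * ln \<epsilon>)"
    unfolding exp_add[symmetric] by (simp add: field_simps)
  finally show ?thesis
    using pos \<tau>_pos eps_pos by (simp add: cost_def powr_def pnorm_1_t row_mean_def[symmetric])
qed

lemma ratio_cost_le: "ratio\<^sup>2 * (real L * real f\<^sub>r) \<le> cost"
proof -
  have h: "0 < real h" using h_ge_1 by simp
  have "ratio\<^sup>2 * (real L * real f\<^sub>r) = real L * row_mean * (balance_point ^ 3 / (real h)\<^sup>2)"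
    unfolding balance_point_pow3 ratio_def using row_mean_ge_1 eps_pos h
    by (simp add: field_simps power_numeral_reduce)
  also have "\<dots> \<le> real L * row_mean * balance_point"
  proof (rule mult_left_mono)
    have "balance_point * balance_point\<^sup>2 \<le> balance_point * (real h)\<^sup>2"
      using balance_point_le_h balance_point_pos by (intro mult_left_mono power_mono) auto
    then show "balance_point ^ 3 / (real h)\<^sup>2 \<le> balance_point"
      using h by (simp add: field_simps power_numeral_reduce)
  qed (use row_mean_ge_1 in simp)
  finally show ?thesis by (simp add: cost_eq)
qed

lemma cost_ge_1:
  assumes "\<epsilon> < real L * \<tau>"
  shows "1 \<le> cost"
proof -
  have "1 \<le> real L" "1 \<le> real f\<^sub>r" "1 \<le> real L * \<tau> / \<epsilon>"
    using L_pos f_row_ge_1 assms eps_pos by auto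
  then have "1 * 1 * 1 * 1 \<le> real L ^ 5 * row_mean\<^sup>2 * real f\<^sub>r * (real L * \<tau> / \<epsilon>)\<^sup>2"
    using row_mean_ge_1 by (intro mult_mono one_le_power) auto
  also have "\<dots> = cost ^ 3"
    unfolding cost_eq power_mult_distrib balance_point_pow3 using row_mean_ge_1 eps_pos
    by (simp add: field_simps power_numeral_reduce)
  finally have "1 ^ 3 \<le> cost ^ 3" by simp
  moreover have "0 \<le> cost"
    using balance_point_pos row_mean_ge_1 by (simp add: cost_eq)
  ultimately show ?thesis
    by (subst (asm) power_mono_iff) auto
qed

lemma sum_length_col_list: "(\<Sum>k<n. length (col_list acc k)) = nnz M"
proof -
  let ?C = "\<lambda>k. {j. j < n \<and> M $$ (j,k) \<noteq> 0}"
  have "length (col_list acc k) = card (?C k)" if "k < n" for k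
  proof -
    have "set (col_list acc k) = ?C k"
      using col_list(2)[OF that] by auto
    then show ?thesis
      using distinct_card[OF col_list(1)[OF that]] by simp
  qed
  then have "(\<Sum>k<n. length (col_list acc k)) = card (Sigma {..<n} ?C)"
    by simp
  also have "\<dots> = card ((\<lambda>(k,j). (j,k)) ` Sigma {..<n} ?C)"
    by (rule card_image[symmetric]) (auto simp: inj_on_def)
  also have "(\<lambda>(k,j). (j,k)) ` Sigma {..<n} ?C = {(i,j). i < n \<and> j < n \<and> M $$ (i,j) \<noteq> 0}"
    by (auto simp: image_iff)
  finally show ?thesis by (simp add: nnz_def dims)
qed

lemma sum_push_time_le: "real (\<Sum>w<n. push_time w) \<le> 40 * cost * real n"
proof -
  have "(\<Sum>w<n. push_time w) = (\<Sum>l<L. \<Sum>w<n. \<Sum>k<n. max_pushes n W h w l k * push_cost k)"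
    unfolding push_time_def by (rule sum.swap)
  also have "\<dots> = (\<Sum>l<L. \<Sum>k<n. (\<Sum>w<n. max_pushes n W h w l k) * push_cost k)"
    unfolding sum_distrib_right by (rule sum.cong[OF refl], rule sum.swap)
  also have "\<dots> \<le> (\<Sum>l<L. \<Sum>k<n. (h - 1) * push_cost k)"
    by (intro sum_mono mult_right_mono sum_max_pushes_le substochastic_W h_ge_1) auto
  also have "\<dots> = L * ((h - 1) * (10 * n + 30 * nnz M))"
    by (simp add: push_cost_def sum_distrib_left[symmetric] sum.distrib sum_length_col_list)
  also have "\<dots> \<le> L * ((h - 1) * (40 * nnz M))"
    using dim_le_nnz by (intro mult_left_mono) auto
  finally have "real (\<Sum>w<n. push_time w) \<le> real (L * ((h - 1) * (40 * nnz M)))"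
    by (rule of_nat_mono)
  also have "\<dots> = 40 * (real L * row_mean * real (h - 1)) * real n"
    using dim_pos by (simp add: row_mean_def)
  also have "\<dots> \<le> 40 * cost * real n"
    unfolding cost_eq using h_le_balance_point row_mean_ge_1
    by (intro mult_right_mono mult_left_mono) auto
  finally show ?thesis .
qed

lemma sampling_cost_le:
  assumes "\<epsilon> < real L * \<tau>"
  shows "real sampling_cost \<le> 10 + 205 * cost"
proof (cases "1 < ratio")
  case False
  then show ?thesis
    using cost_ge_1[OF assms] by (simp add: sampling_cost_def)
next
  case True
  then have "1 \<le> ratio\<^sup>2"
    by (intro one_le_power) simp
  then have samples: "real (nat \<lceil>4 * ratio\<^sup>2\<rceil>) \<le> 5 * ratio\<^sup>2"
    by linarith
  have "1 \<le> real L" "1 \<le> real f\<^sub>r"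
    using L_pos f_row_ge_1 by auto
  then have "1 \<le> real L * real f\<^sub>r" "real L \<le> real L * real f\<^sub>r"
    using mult_mono[of 1 "real L" 1 "real f\<^sub>r"] mult_left_mono[of 1 "real f\<^sub>r" "real L"] by auto
  then have "real sample_cost \<le> 41 * (real L * real f\<^sub>r)"
    by (simp add: sample_cost_def algebra_simps)
  with samples have
    "real (nat \<lceil>4 * ratio\<^sup>2\<rceil>) * real sample_cost \<le> (5 * ratio\<^sup>2) * (41 * (real L * real f\<^sub>r))"
    by (intro mult_mono) auto
  also have "\<dots> \<le> 205 * cost"
    using ratio_cost_le by simp
  finally show ?thesis
    using True by (simp add: sampling_cost_def)
qed

lemma average_run_time: "(\<Sum>w<n. real (run_time w)) / real n \<le> 300 * max 1 cost"
proof (cases "\<epsilon> < real L * \<tau>")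
  case False
  then show ?thesis
    using dim_pos by (simp add: run_time_def)
next
  case True
  have cost: "1 \<le> cost"
    by (rule cost_ge_1[OF True])
  have "1 \<le> real L * row_mean"
    using L_pos row_mean_ge_1 mult_mono[of 1 "real L" 1 row_mean] by simp
  then have "balance_point \<le> cost"
    using balance_point_pos by (simp add: cost_eq)
  then have h: "real h \<le> 2 * cost"
    using h_le_balance_point h_ge_1 cost by linarith
  have "(\<Sum>w<n. real (run_time w))
    = real n * (20 + 2 * real h + real sampling_cost) + real (\<Sum>w<n. push_time w)"
    using True by (simp add: run_time_def sum.distrib algebra_simps)
  also have "\<dots> \<le> real n * (20 + 2 * (2 * cost) + (10 + 205 * cost)) + 40 * cost * real n"
    using sum_push_time_le sampling_cost_le[OF True] h by (intro add_mono mult_left_mono) auto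
  also have "\<dots> = real n * (30 + 249 * cost)"
    by (simp add: algebra_simps)
  also have "\<dots> \<le> real n * (300 * max 1 cost)"
    using cost by (intro mult_left_mono) auto
  finally show ?thesis
    using dim_pos by (simp add: field_simps)
qed

end

context rdd_instance
begin

lemma estimator_initial_spec:
  "ensures (run estimator (initial M t acc w L \<epsilon> \<gamma>)) (\<lambda>s. clock s \<le> run_time w) failure (1/4)"
  by (rule estimator_spec) (simp_all add: initial_def inputs_kept_def dims pnorm_1_t)

lemma estimator_halts_within: "halts_within (run estimator (initial M t acc w L \<epsilon> \<gamma>)) (run_time w)"
  by (rule halts_within_if_ensures[OF estimator_initial_spec])

lemma index_scaled_unit_vec: "i < n \<Longrightarrow> (diag_powr M (-1) *\<^sub>v b) $ i = scaled_unit_vec i"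
  using d_pos w by (subst index_diag_powr_mult_vec) (auto simp: powr_minus_divide)

lemma pnorm_scaled_unit_vec: "pnorm \<infinity> (diag_powr M (-1) *\<^sub>v b) = 1 / d"
proof (rule antisym)
  have dim: "dim_vec (diag_powr M (-1) *\<^sub>v b) = n"
    by (simp add: diag_powr_def dims)
  show "pnorm \<infinity> (diag_powr M (-1) *\<^sub>v b) \<le> 1 / d"
  proof (rule pnorm_infinity_le)
    fix i assume "i < dim_vec (diag_powr M (-1) *\<^sub>v b)"
    then show "\<bar>(diag_powr M (-1) *\<^sub>v b) $ i\<bar> \<le> 1 / d"
      unfolding dim using d_pos by (simp add: index_scaled_unit_vec del: index_mult_mat_vec)
  qed (use dim dim_pos in simp)
  show "1 / d \<le> pnorm \<infinity> (diag_powr M (-1) *\<^sub>v b)"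
    using abs_le_pnorm[of \<infinity> w "diag_powr M (-1) *\<^sub>v b", unfolded dim] w d_pos
    by (simp add: index_scaled_unit_vec del: index_mult_mat_vec)
qed

lemma target_truncation_error:
  assumes "0 < \<gamma>" "\<gamma> \<le> gamma_max M" "b \<in> mat_range M"
    and "4 * L_scale M t b \<gamma> (\<epsilon> * pnorm \<infinity> (diag_powr M (-1) *\<^sub>v b)) \<le> real L"
  shows "\<bar>target / 2 - t \<bullet> x_star M b\<bar> \<le> \<epsilon> / (2 * d)"
proof -
  have "target = neumann_sum n W (($) t) L (($) (diag_powr M (-1) *\<^sub>v b))"
    unfolding neumann_sum_def
    by (intro sum.cong refl arg_cong2[of _ _ _ _ "(*)"] mat_app_pow_cong)
      (auto simp: index_scaled_unit_vec simp del: index_mult_mat_vec)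
  moreover have "0 < \<epsilon> * pnorm \<infinity> (diag_powr M (-1) *\<^sub>v b)"
    using eps_pos d_pos by (simp add: pnorm_scaled_unit_vec)
  ultimately show ?thesis
    using truncation_error[OF dim_pos t assms(1,2) _ assms(3,4)] by (simp add: pnorm_scaled_unit_vec)
qed

lemma estimator_accurate:
  assumes "0 < \<gamma>" "\<gamma> \<le> gamma_max M" "b \<in> mat_range M"
    and "4 * L_scale M t b \<gamma> (\<epsilon> * pnorm \<infinity> (diag_powr M (-1) *\<^sub>v b)) \<le> real L"
  shows "measure (measure_spmf (run estimator (initial M t acc w L \<epsilon> \<gamma>)))
    {s. \<bar>result s - t \<bullet> x_star M b\<bar> \<le> \<epsilon> * pnorm \<infinity> (diag_powr M (-1) *\<^sub>v b)} \<ge> 3/4"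
    (is "measure (measure_spmf ?run) ?A \<ge> _")
proof -
  have "s \<in> ?A" if "accurate s" for s
  proof -
    have "\<bar>result s - t \<bullet> x_star M b\<bar> \<le> \<epsilon> / (2 * d) + \<epsilon> / (2 * d)"
      using that target_truncation_error[OF assms] by (simp add: accurate_def result_def)
    then show ?thesis by (simp add: pnorm_scaled_unit_vec)
  qed
  then have "ensures ?run (\<lambda>s. clock s \<le> run_time w) (\<lambda>s. if s \<in> ?A then 0 else 1) (1/4)"
    by (intro ensures_mono[OF estimator_initial_spec]) auto
  then show ?thesis
    using measure_ge_if_ensures by fastforce
qed

end

theorem theorem7p4:
  fixes Q :: "real poly"
  shows "\<exists>P c\<^sub>1. 0 < c\<^sub>1 \<and> (\<forall>c\<^sub>2\<ge>c\<^sub>1. \<exists>C>0.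
    \<forall>(n::nat) M t acc (\<epsilon>::real) (\<gamma>::real) (L::nat).
      M \<in> carrier_mat n n \<longrightarrow> t \<in> carrier_vec n \<longrightarrow> t \<noteq> 0\<^sub>v n \<longrightarrow>
      poly_bounded Q n (elements_mat M \<union> set\<^sub>v t) \<longrightarrow>
      RDD M \<longrightarrow> valid_access M acc \<longrightarrow>
      0 < \<epsilon> \<longrightarrow> 0 < \<gamma> \<longrightarrow> \<gamma> \<le> gamma_max M \<longrightarrow>
      (\<forall>w<n. let b = unit_vec n w;
                  K = L_scale M t b \<gamma> (\<epsilon> * pnorm \<infinity> (diag_powr M (-1) *\<^sub>v b))
              in c\<^sub>1 * K \<le> real L \<and> real L \<le> c\<^sub>2 * K) \<longrightarrow>
      (\<exists>T :: nat \<Rightarrow> nat.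
        (\<forall>w<n. let b = unit_vec n w;
                    run = exec M b t acc P (initial M t acc w L \<epsilon> \<gamma>)
                in halts_within run (T w) \<and>
                   (b \<in> mat_range M \<longrightarrow>
                      measure (measure_spmf run)
                        {s. \<bar>result s - t \<bullet> x_star M b\<bar>
                              \<le> \<epsilon> * pnorm \<infinity> (diag_powr M (-1) *\<^sub>v b)} \<ge> 3/4)) \<and>
        (\<Sum>w<n. real (T w)) / real n \<le>
          C * max 1 (real (f_row M acc) powr (1/3) * (real (nnz M) / real n) powr (2/3)
            * pnorm 1 t powr (2/3) * real L powr (7/3) * \<epsilon> powr (-2/3))))"
proof (rule exI[of _ estimator], rule exI[of _ 4], intro conjI allI impI exI[of _ "300::real"], goal_cases)
  case (3 c\<^sub>2 n M t acc \<epsilon> \<gamma> L)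
  then have n: "0 < n"
    by (cases n) auto
  have L_large:
    "4 * L_scale M t (unit_vec n w) \<gamma> (\<epsilon> * pnorm \<infinity> (diag_powr M (-1) *\<^sub>v unit_vec n w)) \<le> real L"
    if "w < n" for w
    using 3(11) that by (simp add: Let_def)
  have "0 < L_scale M t (unit_vec n 0) \<gamma> (\<epsilon> * pnorm \<infinity> (diag_powr M (-1) *\<^sub>v unit_vec n 0))"
    unfolding L_scale_def using 3(9) by (intro mult_pos_pos) auto
  then have "0 < L"
    using L_large[OF n] by linarith
  then interpret rdd_problem M n t acc L \<epsilon>
    using 3 by unfold_locales auto
  have inst: "rdd_instance M n t acc L \<epsilon> w" if "w < n" for w
    using that by unfold_locales
  show ?case
    unfolding Let_def
  proof (intro exI[of _ run_time] conjI allI impI)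
    fix w assume w: "w < n"
    show "halts_within (exec M (unit_vec n w) t acc estimator (initial M t acc w L \<epsilon> \<gamma>)) (run_time w)"
      by (rule rdd_instance.estimator_halts_within[OF inst[OF w]])
  qed (use 3 inst L_large rdd_instance.estimator_accurate average_run_time[unfolded cost_def] in auto)
qed simp_all

end
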